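(* Let $n$ be a positive integer, let $K \subset \bar F$ be a finite extension of $F$ of degree $r$, and let $x \in K$. Then: (1) If $F[x] \neq K$ or $n < r$, then $\rho_{K,n}(x) = 0$. (2) The function $\rho_{K,n}$ is continuous on $K$. (3) For any finite extension $L \subset \bar F$ of $F$ and any isomorphism of $F$-algebras $\sigma : K \to L$, $\rho_{K,n}(x) = \rho_{L,n}(\sigma(x))$. (4) For every matrix $\begin{pmatrix} a & b \\ c & d\end{pmatrix} \in \mathrm{GL}_2(\mathcal{O}_F)$ with $cx+d \neq 0$, we have $\rho_{K,n}\!\left(\frac{ax+b}{cx+d}\right) = \|cx+d\|^{2r}\cdot \rho_{K,n}(x)$. (5) $\rho_{K,n}(x) \leq \rho_{K,n+1}(x)$, and the inequality is strict if and only if $F[x] = K$ and $r \leq n < 2r-1$. (6) If $F[x] = K$ and $x \in \mathcal{O}_K$, then $$\rho_{K,r}(x) = \|D_K\| \cdot \frac{1}{\#(\mathcal{O}_K/\mathcal{O}_F[x])}\cdot \frac{q^{r+1}-q^r}{q^{r+1}-1},$$ and for all $n \geq 2r-1$, $$\rho_{K,n}(x) = \|D_K\| \cdot \int_{\mathcal{O}_F[x]} \|t\|^r\, dt,$$ where $dt$ is the Haar measure $\lambda_K$.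
   Context: Let $p$ be a prime, $F$ a finite extension of $\mathbb{Q}_p$ with ring of integers $\mathcal{O}_F$ and residue field of cardinality $q$, and $\bar F$ an algebraic closure of $F$; all finite extensions of $F$ are taken inside $\bar F$. Let $\|\cdot\|$ be the absolute value on $\bar F$ normalized by $\|p\| = p^{-[F:\mathbb{Q}_p]}$. For $m \geq 0$, $\Omega_m$ is the set of polynomials of degree at most $m$ with coefficients in $\mathcal{O}_F$, identified with $\mathcal{O}_F^{m+1}$ and endowed with the probability measure $\lambda_F^{\otimes(m+1)}$ ($\lambda_F$ the Haar measure on $F$ with $\lambda_F(\mathcal{O}_F)=1$); $dQ$ denotes integration against it. For a finite extension $K$ of $F$, $\lambda_K$ is the Haar measure on $K$ with $\lambda_K(\mathcal{O}_K)=1$, and $D_K$ is the discriminant of $K/F$ (defined up to a unit, so $\|D_K\|$ is well defined). The density function $\rho_{K,n}: K \to \mathbb{R}_{\geq 0}$ (with $r=[K:F]$) is defined as follows: for $x \in \mathcal{O}_K$, $\rho_{K,n}(x) = \frac{\|D_K\|}{\#(\mathcal{O}_K/\mathcal{O}_F[x])}\int_{\Omega_{n-r}} \|Q(x)\|^r\, dQ$ if $n \geq r$ and $F[x]=K$, and $\rho_{K,n}(x)=0$ otherwise; for $x \in K \setminus \mathcal{O}_K$, $\rho_{K,n}(x) = \|x\|^{-2r}\rho_{K,n}(x^{-1})$.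
   Formalization: In (5) the range "r ≤ n < 2r−1" is corrected to "r−1 ≤ n < 2r−1": for F[x] = K, r ≥ 2 and n = r−1, part (1) gives ρ_{K,n}(x) = 0 while ρ_{K,n+1}(x) > 0, so the inequality is strict there and the printed equivalence fails. *)

theory Defs
  imports
    "HOL-Analysis.Set_Integral"
    "HOL-Analysis.Finite_Product_Measure"
    "Jordan_Normal_Form.Determinant"
begin

text \<open>
  The algebraic closure of F is the universe of a type of class
  \<open>{alg_closed_field, field_char_0, metric_space}\<close>; all fields are subsets of it.
  The absolute value is the distance to \<open>0\<close>; the locale \<open>padic_setting\<close> below ties the
  metric to the field operations.
\<close>

definition pnorm :: "'a::{zero,metric_space} \<Rightarrow> real" where
  "pnorm x = dist x 0"

definition is_subfield :: "'a::field set \<Rightarrow> bool" where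
  "is_subfield K \<longleftrightarrow> 0 \<in> K \<and> 1 \<in> K \<and>
     (\<forall>x\<in>K. \<forall>y\<in>K. x + y \<in> K \<and> x * y \<in> K) \<and> (\<forall>x\<in>K. - x \<in> K \<and> inverse x \<in> K)"

text \<open>\<open>b 0, \<dots>, b (r - 1)\<close> is a basis of the free module \<open>M\<close> over the ring \<open>R\<close>
  (used for fields and for rings of integers).\<close>

definition is_basis :: "'a::comm_ring_1 set \<Rightarrow> 'a set \<Rightarrow> nat \<Rightarrow> (nat \<Rightarrow> 'a) \<Rightarrow> bool" where
  "is_basis R M r b \<longleftrightarrow>
     (\<forall>c. (\<forall>i<r. c i \<in> R) \<longrightarrow> (\<Sum>i<r. c i * b i) \<in> M) \<and>
     (\<forall>y\<in>M. \<exists>!c. c \<in> {..<r} \<rightarrow>\<^sub>E R \<and> y = (\<Sum>i<r. c i * b i))"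

definition finite_extension :: "'a::field set \<Rightarrow> 'a set \<Rightarrow> bool" where
  "finite_extension F K \<longleftrightarrow>
     is_subfield F \<and> is_subfield K \<and> F \<subseteq> K \<and> (\<exists>r b. is_basis F K r b)"

definition ext_degree :: "'a::field set \<Rightarrow> 'a set \<Rightarrow> nat" where
  "ext_degree F K = (THE r. \<exists>b. is_basis F K r b)"

definition adjoin :: "'a::comm_ring_1 set \<Rightarrow> 'a \<Rightarrow> 'a set" where
  "adjoin R x = {poly P x | P. range (coeff P) \<subseteq> R}"

text \<open>The field of \<open>p\<close>-adic numbers is \<open>closure \<rat>\<close>. Multiplicativity, the ultrametric
  inequality and the value at \<open>p\<close> force the absolute value on \<open>\<rat>\<close> to be a power of the
  \<open>p\<close>-adic one, and completeness makes \<open>closure \<rat>\<close> the completion of \<open>\<rat>\<close>.\<close>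

locale padic_setting =
  fixes p :: nat and F :: "'a::{alg_closed_field, field_char_0, metric_space} set"
  assumes prime_p: "prime p"
    and dist_eq: "\<And>x y :: 'a. dist x y = pnorm (x - y)"
    and pnorm_mult: "\<And>x y :: 'a. pnorm (x * y) = pnorm x * pnorm y"
    and pnorm_ultrametric: "\<And>x y :: 'a. pnorm (x + y) \<le> max (pnorm x) (pnorm y)"
    and complete_Qp: "complete (closure \<rat> :: 'a set)"
    and finite_F: "finite_extension (closure \<rat>) F"
    and pnorm_p: "pnorm (of_nat p :: 'a) = 1 / real p ^ ext_degree (closure \<rat>) F"
    and algebraic_over_F: "\<And>y :: 'a. \<exists>P. P \<noteq> 0 \<and> range (coeff P) \<subseteq> F \<and> poly P y = 0"

definition int_ring :: "'a::{field,metric_space} set \<Rightarrow> 'a set" where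
  "int_ring K = {x \<in> K. pnorm x \<le> 1}"

text \<open>The cardinality of the quotient of additive groups \<open>A / B\<close>.\<close>

definition quot_card :: "'a::ab_group_add set \<Rightarrow> 'a set \<Rightarrow> nat" where
  "quot_card A B = card (A // {(u, v). u \<in> A \<and> v \<in> A \<and> u - v \<in> B})"

definition residue_card :: "'a::{field,metric_space} set \<Rightarrow> nat" where
  "residue_card F = quot_card (int_ring F) {x \<in> F. pnorm x < 1}"

definition haar :: "'a::{field,metric_space} set \<Rightarrow> 'a measure" where
  "haar K = (THE M. space M = K \<and> sets M = sets (restrict_space borel K) \<and>
     (\<forall>a\<in>K. \<forall>A\<in>sets M. emeasure M ((+) a ` A) = emeasure M A) \<and>
     emeasure M (int_ring K) = 1)"

text \<open>The trace of multiplication by \<open>x\<close> on the \<open>F\<close>-vector space \<open>K\<close>.\<close>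

definition field_trace :: "'a::field set \<Rightarrow> 'a set \<Rightarrow> 'a \<Rightarrow> 'a" where
  "field_trace F K x = (THE t. \<exists>b T.
     is_basis F K (ext_degree F K) b \<and>
     (\<forall>i<ext_degree F K. \<forall>j<ext_degree F K. T i j \<in> F) \<and>
     (\<forall>j<ext_degree F K. x * b j = (\<Sum>i<ext_degree F K. T i j * b i)) \<and>
     t = (\<Sum>i<ext_degree F K. T i i))"

text \<open>The discriminant of some basis of \<open>int_ring K\<close> over \<open>int_ring F\<close>; another choice of
  basis multiplies it by the square of a unit of \<open>int_ring F\<close>.\<close>

definition discriminant :: "'a::{field,metric_space} set \<Rightarrow> 'a set \<Rightarrow> 'a" where
  "discriminant F K = (SOME D. \<exists>b.
     is_basis (int_ring F) (int_ring K) (ext_degree F K) b \<and>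
     D = Determinant.det (mat (ext_degree F K) (ext_degree F K)
           (\<lambda>(i, j). field_trace F K (b i * b j))))"

text \<open>A polynomial of degree at most \<open>m\<close> is represented by its coefficients, indexed by \<open>{..m}\<close>.\<close>

definition Omega :: "'a::{field,metric_space} set \<Rightarrow> nat \<Rightarrow> (nat \<Rightarrow> 'a) measure" where
  "Omega F m = PiM {..m} (\<lambda>_. restrict_space (haar F) (int_ring F))"

definition poly_of :: "nat \<Rightarrow> (nat \<Rightarrow> 'a::comm_ring_1) \<Rightarrow> 'a poly" where
  "poly_of m c = (\<Sum>i\<le>m. monom (c i) i)"

definition rho_int :: "'a::{field,metric_space} set \<Rightarrow> 'a set \<Rightarrow> nat \<Rightarrow> 'a \<Rightarrow> real" where
  "rho_int F K n x =
     (let r = ext_degree F K in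
      if n \<ge> r \<and> adjoin F x = K then
        pnorm (discriminant F K) / real (quot_card (int_ring K) (adjoin (int_ring F) x)) *
        (\<integral>c. pnorm (poly (poly_of (n - r) c) x) ^ r \<partial>Omega F (n - r))
      else 0)"

definition rho :: "'a::{field,metric_space} set \<Rightarrow> 'a set \<Rightarrow> nat \<Rightarrow> 'a \<Rightarrow> real" where
  "rho F K n x =
     (if x \<in> int_ring K then rho_int F K n x
      else pnorm x powi (- 2 * int (ext_degree F K)) * rho_int F K n (inverse x))"

definition alg_iso :: "'a::field set \<Rightarrow> 'a set \<Rightarrow> 'a set \<Rightarrow> ('a \<Rightarrow> 'a) \<Rightarrow> bool" where
  "alg_iso F K L \<sigma> \<longleftrightarrow> bij_betw \<sigma> K L \<and> (\<forall>a\<in>F. \<sigma> a = a) \<and>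
     (\<forall>y\<in>K. \<forall>z\<in>K. \<sigma> (y + z) = \<sigma> y + \<sigma> z \<and> \<sigma> (y * z) = \<sigma> y * \<sigma> z)"

definition GL :: "nat \<Rightarrow> 'a::comm_ring_1 set \<Rightarrow> 'a mat set" where
  "GL k R = {A \<in> carrier_mat k k. elements_mat A \<subseteq> R \<and>
     (\<exists>B\<in>carrier_mat k k. elements_mat B \<subseteq> R \<and> A * B = 1\<^sub>m k \<and> B * A = 1\<^sub>m k)}"

end

theory Submission
  imports Defs "HOL-Probability.Distribution_Functions" "Jordan_Normal_Form.Char_Poly"
begin

text \<open>
  Let \<open>W\<^sub>m(x)\<close> be the compact group of all \<open>Q(x)\<close> with \<open>Q \<in> \<Omega>\<^sub>m\<close>. For \<open>x\<close> in \<open>\<O>\<^sub>K\<close>, the order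
  \<open>\<O>\<^sub>F[x]\<close> is \<open>W\<^bsub>r-1\<^esub>(x)\<close> and its index is the inverse of its Haar measure. So, up to the discriminant,
  \<open>\<rho>\<^bsub>K,n\<^esub>(x)\<close> is \<open>\<lambda>\<^sub>K(W\<^bsub>r-1\<^esub>(x)) \<cdot> E \<bar>Q(x)\<bar>\<^sup>r / max(1, \<bar>x\<bar>)\<close> with exponent \<open>(n+1)r\<close> in the denominator
  and \<open>Q\<close> random in \<open>\<Omega>\<^bsub>n-r\<^esub>\<close>. This expression makes sense for all \<open>x\<close> in \<open>K\<close>, and it satisfies the
  homography law because \<open>(c x + d)\<^sup>m W\<^sub>m(\<gamma> x) = W\<^sub>m(x)\<close> for \<open>\<gamma>\<close> in \<open>GL\<^sub>2(\<O>\<^sub>F)\<close>; inversion is the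
  case that defines \<open>\<rho>\<close> outside \<open>\<O>\<^sub>K\<close>.

  The law of \<open>\<bar>Q(x)\<bar>\<close> depends only on the group \<open>W\<^sub>m(x)\<close>, since all balls of the same radius
  centred in the group have the same mass. Hence \<open>E \<bar>Q(x)\<bar>\<^sup>r\<close> stabilizes for integral \<open>x\<close> once
  \<open>n - r \<ge> r - 1\<close>, where it is the normalized integral over \<open>\<O>\<^sub>F[x]\<close>. Raising the degree by one shifts the argument by
  a random element \<open>a\<close>, and \<open>\<bar>Q(x) + a\<bar>\<close> dominates \<open>\<bar>Q(x)\<bar>\<close> in mean because a minimal element
  of the coset can serve as \<open>a\<close>. If \<open>F[x] = K\<close> then \<open>W\<^bsub>r-1\<^esub>\<close> is locally constant near \<open>x\<close>;
  otherwise its measure tends to \<open>0\<close> there, which gives continuity.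
\<close>

text \<open>Haar measure, degree, trace and discriminant enter the statement through
  \<open>THE\<close> or \<open>SOME\<close>, so each needs its own existence or uniqueness argument.
  Haar measure is the image of Lebesgue measure on the half-line \<open>[0, \<infinity>)\<close>
  under the map that reads the base-\<open>q\<close> digits of a real number as digits in powers of
  the uniformizer; uniqueness follows because invariance fixes the mass of every ball. Of the
  discriminant, the argument uses only that it is nonzero (for strict inequality) and that
  isomorphic fields receive the same value. The normalization of the absolute value at
  \<open>p\<close> acts through one consequence: the uniformizer of \<open>F\<close> has absolute
  value \<open>1 / q\<close>. Hence multiplication by \<open>a\<close> in \<open>K\<close> scales
  Haar measure by \<open>pnorm a ^ r\<close>, and this makes the powers of
  \<open>pnorm (c * x + d)\<close> in the homography law add up to \<open>2 * r\<close>. Compactness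
  of the rings of integers is derived: for the \<open>p\<close>-adic numbers from completeness and
  the approximation of integral elements by natural numbers, for \<open>F\<close> and then
  \<open>K\<close> from an integral basis.\<close>

locale valued_field =
  fixes L :: "'a::{field_char_0, metric_space} set"
  assumes dist_eq: "\<And>x y :: 'a. dist x y = pnorm (x - y)"
    and pnorm_mult: "\<And>x y :: 'a. pnorm (x * y) = pnorm x * pnorm y"
    and pnorm_ultrametric: "\<And>x y :: 'a. pnorm (x + y) \<le> max (pnorm x) (pnorm y)"
    and subfield: "is_subfield L"
begin

section \<open>Ultrametric fields: estimates and continuity of the operations\<close>

lemma pnorm_zero [simp]: "pnorm (0 :: 'a) = 0"
  by (simp add: pnorm_def)

lemma pnorm_nonneg [simp]: "0 \<le> pnorm (x :: 'a)"
  by (simp add: pnorm_def)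

lemma pnorm_eq_0_iff [simp]: "pnorm (x :: 'a) = 0 \<longleftrightarrow> x = 0"
  by (simp add: pnorm_def)

lemma pnorm_le_0_iff [simp]: "pnorm (x :: 'a) \<le> 0 \<longleftrightarrow> x = 0"
  by (simp add: pnorm_def)

lemma pnorm_pos_iff [simp]: "0 < pnorm (x :: 'a) \<longleftrightarrow> x \<noteq> 0"
  by (simp add: pnorm_def)

lemma pnorm_one [simp]: "pnorm (1 :: 'a) = 1"
proof -
  have "pnorm (1 :: 'a) * pnorm (1 :: 'a) = pnorm (1 :: 'a) * 1"
    using pnorm_mult[of 1 1] by simp
  then show ?thesis
    by (subst (asm) mult_cancel_left) auto
qed

lemma pnorm_power: "pnorm (x ^ k :: 'a) = pnorm x ^ k"
  by (induction k) (auto simp: pnorm_mult)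

lemma pnorm_minus [simp]: "pnorm (- x :: 'a) = pnorm x"
proof -
  have "pnorm (- 1 :: 'a) ^ 2 = 1"
    using pnorm_power[of "-1" 2] by simp
  then have "pnorm (- 1 :: 'a) = 1"
    using pnorm_nonneg[of "-1"] unfolding power2_eq_1_iff by linarith
  then show ?thesis
    using pnorm_mult[of "-1" x] by simp
qed

lemma pnorm_diff_commute: "pnorm (x - y :: 'a) = pnorm (y - x)"
  by (metis pnorm_minus minus_diff_eq)

lemma pnorm_diff_le: "pnorm (x - y :: 'a) \<le> max (pnorm x) (pnorm y)"
  using pnorm_ultrametric[of x "- y"] by simp

lemma pnorm_add_le: "pnorm (x :: 'a) \<le> s \<Longrightarrow> pnorm y \<le> s \<Longrightarrow> pnorm (x + y) \<le> s"
  using pnorm_ultrametric[of x y] by linarith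

lemma pnorm_sub_le: "pnorm (x :: 'a) \<le> s \<Longrightarrow> pnorm y \<le> s \<Longrightarrow> pnorm (x - y) \<le> s"
  using pnorm_diff_le[of x y] by linarith

lemma pnorm_add_less: "pnorm (x :: 'a) < s \<Longrightarrow> pnorm y < s \<Longrightarrow> pnorm (x + y) < s"
  using pnorm_ultrametric[of x y] by linarith

lemma pnorm_sub_less: "pnorm (x :: 'a) < s \<Longrightarrow> pnorm y < s \<Longrightarrow> pnorm (x - y) < s"
  using pnorm_diff_le[of x y] by linarith

lemma pnorm_triangle_le:
  "pnorm (x - y :: 'a) \<le> s \<Longrightarrow> pnorm (y - z) \<le> s \<Longrightarrow> pnorm (x - z) \<le> s"
  using pnorm_add_le[of "x - y" s "y - z"] by simp


lemma pnorm_inverse: "pnorm (inverse x :: 'a) = inverse (pnorm x)"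
proof (cases "x = 0")
  case False
  then have "pnorm x * pnorm (inverse x) = 1"
    by (simp flip: pnorm_mult)
  then show ?thesis
    by (metis inverse_unique)
qed simp

lemma pnorm_divide: "pnorm (x / y :: 'a) = pnorm x / pnorm y"
  by (simp add: divide_inverse pnorm_mult pnorm_inverse)

lemma pnorm_sum_le:
  "0 \<le> s \<Longrightarrow> (\<And>i. i \<in> I \<Longrightarrow> pnorm (f i :: 'a) \<le> s) \<Longrightarrow> pnorm (sum f I) \<le> s"
  by (induction I rule: infinite_finite_induct) (simp_all add: pnorm_add_le)

lemma pnorm_of_nat_le_1: "pnorm (of_nat k :: 'a) \<le> 1"
proof (induction k)
  case (Suc k)
  then show ?case
    using pnorm_add_le[of 1 1 "of_nat k"] by simp
qed simp

lemma pnorm_of_int_le_1: "pnorm (of_int k :: 'a) \<le> 1"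
  by (cases k rule: int_cases2) (simp_all add: pnorm_of_nat_le_1)


lemma tendsto_pnorm_iff: "(f \<longlongrightarrow> (l :: 'a)) G \<longleftrightarrow> ((\<lambda>z. pnorm (f z - l)) \<longlongrightarrow> 0) G"
  by (simp add: tendsto_dist_iff[of f] dist_eq)

lemma tendsto_pnorm: "(f \<longlongrightarrow> (l :: 'a)) G \<Longrightarrow> ((\<lambda>z. pnorm (f z)) \<longlongrightarrow> pnorm l) G"
  unfolding pnorm_def by (intro tendsto_intros)

text \<open>The type class provides a metric and field operations with no relation between them;
  continuity of the operations comes from the ultrametric inequality and multiplicativity assumed in
  the locale.\<close>

lemma tendsto_vf_add:
  assumes "(f \<longlongrightarrow> (l :: 'a)) G" "(g \<longlongrightarrow> m) G"
  shows "((\<lambda>z. f z + g z) \<longlongrightarrow> l + m) G"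
  unfolding tendsto_pnorm_iff
proof (rule tendsto_sandwich[OF _ _ tendsto_const])
  show "((\<lambda>z. pnorm (f z - l) + pnorm (g z - m)) \<longlongrightarrow> 0) G"
    using tendsto_add[OF assms[unfolded tendsto_pnorm_iff]] by simp
  have "pnorm (f z + g z - (l + m)) \<le> pnorm (f z - l) + pnorm (g z - m)" for z
  proof -
    have "f z + g z - (l + m) = (f z - l) + (g z - m)"
      by simp
    then have "pnorm (f z + g z - (l + m)) \<le> max (pnorm (f z - l)) (pnorm (g z - m))"
      using pnorm_ultrametric[of "f z - l" "g z - m"] by metis
    then show ?thesis
      using pnorm_nonneg[of "f z - l"] pnorm_nonneg[of "g z - m"] by linarith
  qed
  then show "\<forall>\<^sub>F z in G. pnorm (f z + g z - (l + m)) \<le> pnorm (f z - l) + pnorm (g z - m)"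
    by simp
qed simp

lemma tendsto_vf_cmult:
  assumes "(f \<longlongrightarrow> (l :: 'a)) G"
  shows "((\<lambda>z. c * f z) \<longlongrightarrow> c * l) G"
proof -
  have "((\<lambda>z. pnorm c * pnorm (f z - l)) \<longlongrightarrow> 0) G"
    using tendsto_mult_left[OF assms[unfolded tendsto_pnorm_iff], of "pnorm c"] by simp
  then show ?thesis
    unfolding tendsto_pnorm_iff by (simp add: pnorm_mult[symmetric] algebra_simps)
qed

lemma tendsto_vf_mult:
  assumes f: "(f \<longlongrightarrow> (l :: 'a)) G" and g: "(g \<longlongrightarrow> m) G"
  shows "((\<lambda>z. f z * g z) \<longlongrightarrow> l * m) G"
proof -
  have "((\<lambda>z. pnorm (f z) * pnorm (g z - m)) \<longlongrightarrow> 0) G"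
    using tendsto_mult[OF tendsto_pnorm[OF f] g[unfolded tendsto_pnorm_iff]] by simp
  then have "((\<lambda>z. f z * (g z - m)) \<longlongrightarrow> 0) G"
    by (simp add: tendsto_pnorm_iff pnorm_mult)
  from tendsto_vf_add[OF this tendsto_vf_cmult[OF f, of m]] show ?thesis
    by (simp add: algebra_simps)
qed

lemma tendsto_vf_power: "(f \<longlongrightarrow> (l :: 'a)) G \<Longrightarrow> ((\<lambda>z. f z ^ k) \<longlongrightarrow> l ^ k) G"
  by (induction k) (auto intro: tendsto_vf_mult)

lemma tendsto_vf_sum:
  "(\<And>i. i \<in> I \<Longrightarrow> ((\<lambda>z. f z i) \<longlongrightarrow> (l i :: 'a)) G) \<Longrightarrow> ((\<lambda>z. sum (f z) I) \<longlongrightarrow> sum l I) G"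
  by (induction I rule: infinite_finite_induct) (auto intro: tendsto_vf_add)

lemma continuous_on_vf_add: "continuous_on S (\<lambda>z. a + z :: 'a)"
  unfolding continuous_on_def by (auto intro!: tendsto_vf_add tendsto_ident_at)

lemma continuous_on_vf_cmult: "continuous_on S (\<lambda>z. c * z :: 'a)"
  unfolding continuous_on_def by (auto intro!: tendsto_vf_cmult tendsto_ident_at)

lemma continuous_on_pnorm: "continuous_on S (pnorm :: 'a \<Rightarrow> real)"
  unfolding continuous_on_def by (auto intro!: tendsto_pnorm tendsto_ident_at)

lemma closed_pnorm_le: "closed {y :: 'a. pnorm (y - a) \<le> s}"
proof -
  have "{y :: 'a. pnorm (y - a) \<le> s} = cball a s"
    by (auto simp: dist_eq pnorm_diff_commute)
  then show ?thesis by simp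
qed

lemma open_pnorm_le: "0 < s \<Longrightarrow> open {y :: 'a. pnorm (y - a) \<le> s}"
proof (unfold open_dist, intro ballI exI conjI allI impI)
  fix y z assume "0 < s" "y \<in> {y. pnorm (y - a) \<le> s}" "dist z y < s"
  then show "z \<in> {y. pnorm (y - a) \<le> s}"
    using pnorm_triangle_le[of z y s a] by (auto simp: dist_eq)
qed

lemma compact_add_image:
  assumes "compact (A :: 'a set)" "compact B"
  shows "compact {u + v | u v. u \<in> A \<and> v \<in> B}"
proof -
  have "continuous_on (A \<times> B) (\<lambda>z. fst z + snd z)"
    unfolding continuous_on_def
  proof
    fix w show "((\<lambda>z. fst z + snd z) \<longlongrightarrow> fst w + snd w) (at w within A \<times> B)"
      by (intro tendsto_vf_add tendsto_fst tendsto_snd tendsto_ident_at)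
  qed
  from compact_continuous_image[OF this compact_Times[OF assms]]
  show ?thesis
    by (rule arg_cong[where f = compact, THEN iffD1, rotated]) force
qed

lemma compact_cmult_image: "compact (A :: 'a set) \<Longrightarrow> compact ((\<lambda>z. c * z) ` A)"
  by (rule compact_continuous_image[OF continuous_on_vf_cmult])

lemma compact_translate: "compact (A :: 'a set) \<Longrightarrow> compact ((\<lambda>z. c + z) ` A)"
  by (rule compact_continuous_image[OF continuous_on_vf_add])

lemma zero_L [simp]: "0 \<in> L" and one_L [simp]: "1 \<in> L"
  and add_L: "x \<in> L \<Longrightarrow> y \<in> L \<Longrightarrow> x + y \<in> L"
  and mult_L: "x \<in> L \<Longrightarrow> y \<in> L \<Longrightarrow> x * y \<in> L"
  and minus_L: "x \<in> L \<Longrightarrow> - x \<in> L"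
  and inverse_L: "x \<in> L \<Longrightarrow> inverse x \<in> L"
  using subfield by (auto simp: is_subfield_def)

lemma diff_L: "x \<in> L \<Longrightarrow> y \<in> L \<Longrightarrow> x - y \<in> L"
  using add_L[of x "- y"] minus_L by simp

lemma divide_L: "x \<in> L \<Longrightarrow> y \<in> L \<Longrightarrow> x / y \<in> L"
  by (simp add: divide_inverse mult_L inverse_L)

lemma power_L: "x \<in> L \<Longrightarrow> x ^ k \<in> L"
  by (induction k) (auto simp: mult_L)

lemma sum_L: "(\<And>i. i \<in> I \<Longrightarrow> f i \<in> L) \<Longrightarrow> sum f I \<in> L"
  by (induction I rule: infinite_finite_induct) (auto simp: add_L)


lemma of_nat_L: "of_nat k \<in> L"
  by (induction k) (auto simp: add_L)


definition \<O> :: "'a set" where "\<O> = int_ring L"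

lemma int_ring_iff: "x \<in> \<O> \<longleftrightarrow> x \<in> L \<and> pnorm x \<le> 1"
  by (simp add: \<O>_def int_ring_def)

lemma int_ring_L: "x \<in> \<O> \<Longrightarrow> x \<in> L"
  by (simp add: int_ring_iff)

lemma zero_int [simp]: "0 \<in> \<O>" and one_int [simp]: "1 \<in> \<O>"
  and add_int: "x \<in> \<O> \<Longrightarrow> y \<in> \<O> \<Longrightarrow> x + y \<in> \<O>"
  and diff_int: "x \<in> \<O> \<Longrightarrow> y \<in> \<O> \<Longrightarrow> x - y \<in> \<O>"
  and minus_int: "x \<in> \<O> \<Longrightarrow> - x \<in> \<O>"
  and mult_int: "x \<in> \<O> \<Longrightarrow> y \<in> \<O> \<Longrightarrow> x * y \<in> \<O>"
  by (auto simp: int_ring_iff add_L diff_L minus_L mult_L pnorm_mult mult_le_one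
      intro: pnorm_add_le pnorm_sub_le)

lemma power_int: "x \<in> \<O> \<Longrightarrow> x ^ k \<in> \<O>"
  by (induction k) (auto simp: mult_int)

lemma sum_int: "(\<And>i. i \<in> I \<Longrightarrow> f i \<in> \<O>) \<Longrightarrow> sum f I \<in> \<O>"
  by (induction I rule: infinite_finite_induct) (auto simp: add_int)


end

section \<open>Local fields: uniformizer and value group\<close>

locale local_field = valued_field +
  assumes compact_int: "compact (int_ring L)"
    and nontrivial: "\<exists>y\<in>L. 0 < pnorm y \<and> pnorm y < 1"
begin

text \<open>In an ultrametric the open unit ball is also closed, so its part in
  \<open>int_ring L\<close> is compact and \<open>pnorm\<close> attains a maximum there;
  \<open>nontrivial\<close> makes this maximum positive. Discreteness of the value group is thus a
  consequence of compactness.\<close>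

lemma uniformizer_exists:
  "\<exists>y. y \<in> L \<and> 0 < pnorm y \<and> pnorm y < 1 \<and> (\<forall>z\<in>L. pnorm z < 1 \<longrightarrow> pnorm z \<le> pnorm y)"
proof -
  obtain w where w: "w \<in> L" "0 < pnorm w" "pnorm w < 1"
    using nontrivial by auto

  have "closed {z :: 'a. pnorm z < 1}"
  proof (unfold closed_sequential_limits, intro allI impI, elim conjE)
    fix f and l :: 'a assume f: "\<forall>n. f n \<in> {z. pnorm z < 1}" "f \<longlonglongrightarrow> l"
    have "(\<lambda>n. dist (f n) l) \<longlonglongrightarrow> 0"
      using f(2) by (simp add: tendsto_dist_iff[of f])
    then have "\<forall>\<^sub>F n in sequentially. dist (f n) l < 1"
      by (rule order_tendstoD(2)) simp
    then obtain n where "dist (f n) l < 1"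
      by (auto simp: eventually_sequentially)
    then show "l \<in> {z. pnorm z < 1}"
      using f(1) pnorm_sub_less[of "f n" 1 "f n - l"] by (auto simp: dist_eq)
  qed
  then have "compact (int_ring L \<inter> {z. pnorm z < 1})"
    using compact_int by (rule compact_Int_closed[rotated])
  moreover have "int_ring L \<inter> {z. pnorm z < 1} \<noteq> {}"
    using w by (auto simp: int_ring_def)
  ultimately obtain y where y: "y \<in> int_ring L \<inter> {z. pnorm z < 1}"
      "\<forall>z\<in>int_ring L \<inter> {z. pnorm z < 1}. pnorm z \<le> pnorm y"
    using continuous_attains_sup[OF _ _ continuous_on_pnorm] by blast
  then have "pnorm w \<le> pnorm y"
    using w by (auto simp: int_ring_def)
  then show ?thesis
    using y w by (intro exI[of _ y]) (auto simp: int_ring_def)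
qed

definition unif :: 'a where
  "unif = (SOME y. y \<in> L \<and> 0 < pnorm y \<and> pnorm y < 1 \<and> (\<forall>z\<in>L. pnorm z < 1 \<longrightarrow> pnorm z \<le> pnorm y))"

lemma unif: "unif \<in> L" "0 < pnorm unif" "pnorm unif < 1"
    "\<And>z. z \<in> L \<Longrightarrow> pnorm z < 1 \<Longrightarrow> pnorm z \<le> pnorm unif"
  using someI_ex[OF uniformizer_exists] unfolding unif_def[symmetric] by blast+

lemma unif_nonzero [simp]: "unif \<noteq> 0"
  using unif(2) by auto

lemma unif_int: "unif \<in> \<O>"
  using unif by (simp add: int_ring_iff)


lemma unif_power_small:
  assumes "0 < (s :: real)" shows "\<exists>k. pnorm unif ^ k < s"
  using real_arch_pow_inv[OF assms unif(3)] by blast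

lemma pnorm_less_unif_power:
  assumes "z \<in> L" "pnorm z < pnorm unif ^ k"
  shows "pnorm z \<le> pnorm unif ^ Suc k"
proof -
  have "pnorm (z / unif ^ k) < 1"
    using assms unif by (simp add: pnorm_divide pnorm_power divide_simps)
  then have "pnorm (z / unif ^ k) \<le> pnorm unif"
    using assms unif by (intro unif(4)) (auto intro: divide_L power_L)
  then show ?thesis
    using unif by (simp add: pnorm_divide pnorm_power divide_simps mult.commute)
qed

text \<open>No value lies strictly between consecutive powers of \<open>pnorm unif\<close>. If
  \<open>Suc j\<close> is the least exponent whose power is below \<open>pnorm z\<close>, then
  \<open>pnorm z\<close> is squeezed onto the power \<open>j\<close>; exponent \<open>0\<close> is
  excluded as least one by \<open>pnorm z \<le> 1\<close>.\<close>

lemma pnorm_int_cases: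
  assumes "z \<in> L" "z \<noteq> 0" "pnorm z \<le> 1"
  shows "\<exists>k. pnorm z = pnorm unif ^ k"
proof -
  obtain k where k: "pnorm unif ^ k < pnorm z"
    using unif_power_small[of "pnorm z"] assms by auto
  define m where "m = (LEAST k. pnorm unif ^ k < pnorm z)"
  have m: "pnorm unif ^ m < pnorm z" "\<And>j. j < m \<Longrightarrow> \<not> pnorm unif ^ j < pnorm z"
    unfolding m_def using LeastI[of "\<lambda>k. pnorm unif ^ k < pnorm z", OF k] not_less_Least by auto
  obtain j where j: "m = Suc j"
    using m(1) assms by (cases m) auto
  have "pnorm z \<le> pnorm unif ^ j"
    using m(2)[of j] j by simp
  moreover have "\<not> pnorm z < pnorm unif ^ j"
    using pnorm_less_unif_power[OF assms(1), of j] m(1) j by auto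
  ultimately show ?thesis by (intro exI[of _ j]) auto
qed

lemma scale_into_int:
  assumes "z \<in> L" shows "\<exists>k. unif ^ k * z \<in> \<O>"
proof (cases "z = 0")
  case False
  then obtain k where "pnorm unif ^ k < inverse (pnorm z)"
    using unif_power_small[of "inverse (pnorm z)"] by auto
  then have "pnorm (unif ^ k * z) \<le> 1"
    using False by (simp add: pnorm_mult pnorm_power field_simps)
  then show ?thesis
    using assms unif by (auto simp: int_ring_iff mult_L power_L)
qed simp

end

section \<open>Partition of a compact group into balls of one radius\<close>

definition add_subgroup :: "'a::ab_group_add set \<Rightarrow> bool" where
  "add_subgroup W \<longleftrightarrow> 0 \<in> W \<and> (\<forall>x\<in>W. \<forall>y\<in>W. x - y \<in> W)"

lemma add_subgroupD:
  assumes "add_subgroup W"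
  shows "0 \<in> W" "x \<in> W \<Longrightarrow> y \<in> W \<Longrightarrow> x - y \<in> W" "y \<in> W \<Longrightarrow> - y \<in> W"
    "x \<in> W \<Longrightarrow> y \<in> W \<Longrightarrow> x + y \<in> W"
proof -
  show 0: "0 \<in> W" and d: "x \<in> W \<Longrightarrow> y \<in> W \<Longrightarrow> x - y \<in> W" for x y
    using assms by (auto simp: add_subgroup_def)
  show m: "y \<in> W \<Longrightarrow> - y \<in> W" for y
    using d[OF 0, of y] by simp
  show "x \<in> W \<Longrightarrow> y \<in> W \<Longrightarrow> x + y \<in> W"
    using d[OF _ m, of x y] by simp
qed

text \<open>For a subgroup \<open>W\<close> these are the cosets of the ball of radius
  \<open>s\<close> in \<open>W\<close>. As a set of sets it counts classes, not
  representatives.\<close>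

definition ball_cosets :: "'a::{ab_group_add, metric_space} set \<Rightarrow> real \<Rightarrow> 'a set set" where
  "ball_cosets W s = (\<lambda>a. {y \<in> W. pnorm (y - a) \<le> s}) ` W"

lemma emeasure_Union_disjoint:
  assumes "finite C" "C \<subseteq> sets M" "disjoint C"
  shows "emeasure M (\<Union> C) = (\<Sum>A\<in>C. emeasure M A)"
  using sum_emeasure[of "\<lambda>A. A" C M] assms
  by (simp add: disjoint_family_on_def disjoint_def)

context valued_field
begin

lemma ball_cosets_eq:
  "pnorm (b - a :: 'a) \<le> s \<Longrightarrow> {y \<in> W. pnorm (y - a) \<le> s} = {y \<in> W. pnorm (y - b) \<le> s}"
  using pnorm_triangle_le[of _ b s a] pnorm_triangle_le[of _ a s b] pnorm_diff_commute[of a b]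
  by auto

lemma finite_ball_cosets:
  assumes "compact (W :: 'a set)" "0 < s"
  shows "finite (ball_cosets W s)"
proof -
  have *: "W \<subseteq> (\<Union>a\<in>W. {y. pnorm (y - a) \<le> s})"
    using assms(2) by force
  obtain C where C: "C \<subseteq> W" "finite C" "W \<subseteq> (\<Union>a\<in>C. {y. pnorm (y - a) \<le> s})"
    by (rule compactE_image[OF assms(1) open_pnorm_le[OF assms(2)] *])
  have "ball_cosets W s \<subseteq> (\<lambda>a. {y \<in> W. pnorm (y - a) \<le> s}) ` C"
    unfolding ball_cosets_def
  proof safe
    fix a assume "a \<in> W"
    then obtain c where "c \<in> C" "pnorm (a - c) \<le> s"
      using C(3) by auto
    then show "{y \<in> W. pnorm (y - a) \<le> s} \<in> (\<lambda>a. {y \<in> W. pnorm (y - a) \<le> s}) ` C"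
      using ball_cosets_eq by blast
  qed
  then show ?thesis
    using C(2) finite_surj by blast
qed

lemma disjoint_ball_cosets: "disjoint (ball_cosets (W :: 'a set) s)"
proof (rule disjointI)
  fix A B assume "A \<in> ball_cosets W s" "B \<in> ball_cosets W s" "A \<noteq> B"
  then obtain a b where ab: "A = {y \<in> W. pnorm (y - a) \<le> s}" "B = {y \<in> W. pnorm (y - b) \<le> s}"
    unfolding ball_cosets_def by blast
  show "A \<inter> B = {}"
  proof (rule ccontr)
    assume "A \<inter> B \<noteq> {}"
    then obtain y where "pnorm (y - a) \<le> s" "pnorm (y - b) \<le> s"
      unfolding ab by blast
    then have "pnorm (b - a) \<le> s"
      using pnorm_triangle_le[of b y s a] pnorm_diff_commute[of b y] by simp
    then show False
      using ball_cosets_eq[of b a s W] \<open>A \<noteq> B\<close> ab by simp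
  qed
qed

lemma Union_ball_cosets: "0 \<le> s \<Longrightarrow> \<Union> (ball_cosets (W :: 'a set) s) = W"
  by (auto simp: ball_cosets_def)

end

section \<open>Digit expansions and balls in a local field\<close>

context local_field
begin

lemma compact_O: "compact \<O>"
  using compact_int by (simp add: \<O>_def)

lemma add_subgroup_O: "add_subgroup \<O>"
  by (simp add: add_subgroup_def diff_int)

text \<open>The maximal ideal is the closed ball of radius \<open>pnorm unif\<close>, so this is the
  order of the residue field; \<open>residue_card_eq\<close> identifies it with
  \<open>residue_card\<close>.\<close>

definition resq :: nat where "resq = card (ball_cosets \<O> (pnorm unif))"

lemma resq_ge_2: "2 \<le> resq"
proof -
  let ?c = "\<lambda>a. {y \<in> \<O>. pnorm (y - a) \<le> pnorm unif}"
  have "1 \<in> ?c 1" "1 \<notin> ?c 0"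
    using unif by auto
  then have ne: "?c 0 \<noteq> ?c 1"
    by blast
  have "card {A, B} = 2" if "A \<noteq> B" for A B :: "'a set"
    using that by simp
  from this[OF ne] have "card {?c 0, ?c 1} = 2" .
  moreover have "{?c 0, ?c 1} \<subseteq> ball_cosets \<O> (pnorm unif)"
    unfolding ball_cosets_def using zero_int one_int by blast
  then have "card {?c 0, ?c 1} \<le> resq"
    unfolding resq_def by (rule card_mono[OF finite_ball_cosets[OF compact_O unif(2)]])
  ultimately show ?thesis
    by linarith
qed

lemma digits_exist:
  "\<exists>rep. rep 0 = 0 \<and> (\<forall>d<resq. rep d \<in> \<O>) \<and>
     (\<forall>y\<in>\<O>. \<exists>!d. d < resq \<and> pnorm (y - rep d) \<le> pnorm unif)"
proof -
  let ?c = "\<lambda>a. {y \<in> \<O>. pnorm (y - a) \<le> pnorm unif}"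
  obtain f where f: "bij_betw f {..<resq} (ball_cosets \<O> (pnorm unif))"
    unfolding resq_def
    using ex_bij_betw_nat_finite[OF finite_ball_cosets[OF compact_O unif(2)]]
    by (auto simp: atLeast0LessThan)
  have "\<exists>a. a \<in> \<O> \<and> f d = ?c a" if "d < resq" for d
    using bij_betwE[OF f] that by (auto simp: ball_cosets_def)
  then obtain r where r: "\<And>d. d < resq \<Longrightarrow> r d \<in> \<O>" "\<And>d. d < resq \<Longrightarrow> f d = ?c (r d)"
    by metis
  have uniq: "\<exists>!d. d < resq \<and> pnorm (y - r d) \<le> pnorm unif" if y: "y \<in> \<O>" for y
  proof -
    have eq: "f d = ?c y \<longleftrightarrow> pnorm (y - r d) \<le> pnorm unif" if d: "d < resq" for d
    proof
      assume "f d = ?c y"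
      then have "y \<in> f d"
        using y by simp
      then show "pnorm (y - r d) \<le> pnorm unif"
        unfolding r(2)[OF d] by simp
    next
      assume "pnorm (y - r d) \<le> pnorm unif"
      then show "f d = ?c y"
        using r(2)[OF d] ball_cosets_eq[of y "r d"] by simp
    qed
    have "?c y \<in> f ` {..<resq}"
      unfolding bij_betw_imp_surj_on[OF f] ball_cosets_def using y by blast
    then obtain d where "d < resq" "f d = ?c y"
      by (metis (no_types, lifting) imageE lessThan_iff)
    moreover have "e = d" if "e < resq" "f e = ?c y" for e
      using inj_onD[OF bij_betw_imp_inj_on[OF f], of e d] that \<open>d < resq\<close> \<open>f d = ?c y\<close> by simp
    ultimately show ?thesis
      using eq by metis
  qed
  show ?thesis
  \<comment> \<open>A translate of a system of representatives is again one; translating by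
    \<open>r 0\<close> makes the digit of index \<open>0\<close> vanish, so that leading zeros of an
    expansion contribute nothing.\<close>
  proof (intro exI[of _ "\<lambda>d. r d - r 0"] conjI allI impI ballI)
    fix d assume "d < resq"
    then show "r d - r 0 \<in> \<O>"
      using resq_ge_2 by (auto intro!: diff_int r)
  next
    fix y assume "y \<in> \<O>"
    then have "y + r 0 \<in> \<O>"
      using resq_ge_2 by (auto intro!: add_int r)
    from uniq[OF this] show "\<exists>!d. d < resq \<and> pnorm (y - (r d - r 0)) \<le> pnorm unif"
      by (simp add: algebra_simps)
  qed simp
qed

definition digit :: "nat \<Rightarrow> 'a" where
  "digit = (SOME rep. rep 0 = 0 \<and> (\<forall>d<resq. rep d \<in> \<O>) \<and>
     (\<forall>y\<in>\<O>. \<exists>!d. d < resq \<and> pnorm (y - rep d) \<le> pnorm unif))"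

lemma digit: "digit 0 = 0" "\<And>d. d < resq \<Longrightarrow> digit d \<in> \<O>"
    "\<And>y. y \<in> \<O> \<Longrightarrow> \<exists>!d. d < resq \<and> pnorm (y - digit d) \<le> pnorm unif"
  using someI_ex[OF digits_exist] unfolding digit_def[symmetric] by blast+

text \<open>The fractional parts: \<open>fracpart m\<close> for \<open>m\<close> with base-\<open>resq\<close> digits \<open>d\<^sub>0, d\<^sub>1, \<dots>\<close>
  is the sum of the \<open>digit d\<^sub>i / unif ^ (i + 1)\<close>.\<close>

function fracpart :: "nat \<Rightarrow> 'a" where
  "fracpart m = (if m = 0 then 0 else (fracpart (m div resq) + digit (m mod resq)) / unif)"
  by pat_completeness auto
termination
proof (relation "Wellfounded.measure id")
  fix m :: nat assume "m \<noteq> 0"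
  then show "(m div resq, m) \<in> Wellfounded.measure id"
    using resq_ge_2 by (auto intro: div_less_dividend)
qed simp

declare fracpart.simps [simp del]

lemma fracpart_0 [simp]: "fracpart 0 = 0"
  by (simp add: fracpart.simps)

lemma fracpart_step: "unif * fracpart m = fracpart (m div resq) + digit (m mod resq)"
proof (cases "m = 0")
  case False
  then show ?thesis by (subst fracpart.simps) simp
qed (simp add: digit)

lemma fracpart_L: "fracpart m \<in> L"
proof (induction m rule: less_induct)
  case (less m)
  show ?case
  proof (cases "m = 0")
    case False
    then have "m div resq < m"
      using resq_ge_2 by (auto intro: div_less_dividend)
    moreover have "digit (m mod resq) \<in> L"
      using digit(2)[of "m mod resq"] resq_ge_2 by (auto simp: int_ring_iff)
    ultimately show ?thesis
      using less False unif by (subst fracpart.simps) (auto intro!: divide_L add_L)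
  qed simp
qed

text \<open>Multiplication by \<open>unif\<close> strips the lowest digit: the remaining parts
  differ by at most \<open>1\<close>, so they agree by induction, and then the two digits are
  congruent, hence equal. Together with \<open>fracpart_surj\<close>, natural numbers label the
  cosets of \<open>\<O>\<close> in \<open>L\<close>.\<close>

lemma fracpart_inj: "pnorm (fracpart m - fracpart n) \<le> 1 \<Longrightarrow> m = n"
proof (induction "m + n" arbitrary: m n rule: less_induct)
  case less
  let ?d = "digit (m mod resq)" and ?e = "digit (n mod resq)"
  have lt: "m mod resq < resq" "n mod resq < resq"
    using resq_ge_2 by auto
  have O: "?d \<in> \<O>" "?e \<in> \<O>"
    using lt by (auto intro: digit(2))
  have eq: "unif * (fracpart m - fracpart n) = (fracpart (m div resq) - fracpart (n div resq)) + (?d - ?e)"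
    using fracpart_step[of m] fracpart_step[of n] by (simp add: algebra_simps)
  have le: "pnorm (unif * (fracpart m - fracpart n)) \<le> pnorm unif"
    using less(2) by (simp add: pnorm_mult mult_left_le)
  have "pnorm (fracpart (m div resq) - fracpart (n div resq)) \<le> 1"
  proof -
    have "pnorm (unif * (fracpart m - fracpart n)) \<le> 1" "pnorm (?d - ?e) \<le> 1"
      using le unif(3) diff_int[OF O] by (auto simp: int_ring_iff)
    from pnorm_sub_le[OF this] show ?thesis
      unfolding eq by simp
  qed
  then have div: "m div resq = n div resq"
  proof (cases "m = 0 \<and> n = 0")
    case False
    then have "m div resq + n div resq < m + n"
      using resq_ge_2 by (metis add.right_neutral add_less_le_mono add_le_less_mono bot_nat_0.not_eq_extremum
          div_less_dividend div_le_dividend less_le_trans one_less_numeral_iff semiring_norm(76))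
    then show ?thesis
      using less(1) \<open>pnorm (fracpart (m div resq) - fracpart (n div resq)) \<le> 1\<close> by blast
  qed simp
  then have "pnorm (?d - ?e) \<le> pnorm unif"
    using le eq by simp
  moreover have "pnorm (?d - ?d) \<le> pnorm unif"
    by simp
  ultimately have "m mod resq = n mod resq"
    using digit(3)[OF O(1)] lt by metis
  with div show ?case
    by (metis div_mult_mod_eq)
qed

lemma fracpart_surj:
  assumes "y \<in> L" shows "\<exists>m. pnorm (y - fracpart m) \<le> 1"
proof -
  have "unif ^ k * y \<in> \<O> \<Longrightarrow> y \<in> L \<Longrightarrow> \<exists>m. pnorm (y - fracpart m) \<le> 1" for k y
  proof (induction k arbitrary: y)
    case 0
    then show ?case
      by (intro exI[of _ 0]) (simp add: int_ring_iff)
  next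
    case (Suc k)
    from Suc.prems have "unif ^ k * (unif * y) \<in> \<O>" "unif * y \<in> L"
      using unif by (auto simp: mult_ac intro: mult_L)
    from Suc.IH[OF this] obtain m where m: "pnorm (unif * y - fracpart m) \<le> 1" ..
    then have "unif * y - fracpart m \<in> \<O>"
      using \<open>unif * y \<in> L\<close> fracpart_L by (auto simp: int_ring_iff diff_L)
    from digit(3)[OF this] obtain d
      where d: "d < resq" "pnorm (unif * y - fracpart m - digit d) \<le> pnorm unif"
      by auto
    \<comment> \<open>\<open>resq * m + d\<close> is \<open>m\<close> with \<open>d\<close> appended
      as lowest base-\<open>resq\<close> digit.\<close>
    have "unif * fracpart (resq * m + d) = fracpart m + digit d"
      using d(1) by (subst fracpart_step) auto
    then have "pnorm (unif * (y - fracpart (resq * m + d))) \<le> pnorm unif"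
      using d(2) by (simp add: algebra_simps)
    then show ?case
      using unif(2) by (intro exI[of _ "resq * m + d"]) (simp add: pnorm_mult)
  qed
  then show ?thesis
    using scale_into_int[OF assms] assms by blast
qed

definition pball :: "'a \<Rightarrow> nat \<Rightarrow> 'a set" where
  "pball a k = {y \<in> L. pnorm (y - a) \<le> pnorm unif ^ k}"

lemma pball_sub_L: "pball a k \<subseteq> L"
  by (auto simp: pball_def)

lemma pball_0: "pball 0 0 = \<O>"
  by (auto simp: pball_def int_ring_iff)

lemma pball_image:
  assumes "a \<in> L" shows "pball a k = (\<lambda>z. a + unif ^ k * z) ` \<O>"
proof (intro equalityI subsetI)
  fix y assume y: "y \<in> pball a k"
  then have "y - a \<in> L" "pnorm (y - a) \<le> pnorm unif ^ k"
    using assms by (auto simp: pball_def diff_L)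
  then have "(y - a) / unif ^ k \<in> \<O>"
    using unif(1,2) by (simp add: int_ring_iff pnorm_divide pnorm_power divide_L power_L)
  then show "y \<in> (\<lambda>z. a + unif ^ k * z) ` \<O>"
    by (intro image_eqI[of _ _ "(y - a) / unif ^ k"]) auto
next
  fix y assume "y \<in> (\<lambda>z. a + unif ^ k * z) ` \<O>"
  then obtain z where "y = a + unif ^ k * z" "z \<in> L" "pnorm z \<le> 1"
    by (auto simp: int_ring_iff)
  then show "y \<in> pball a k"
    using assms unif(1,2)
    by (simp add: pball_def pnorm_mult pnorm_power mult_left_le add_L mult_L power_L)
qed

lemma compact_pball:
  assumes "a \<in> L" shows "compact (pball a k)"
proof -
  have "pball a k = (\<lambda>z. a + z) ` (\<lambda>z. unif ^ k * z) ` \<O>"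
    by (simp add: pball_image[OF assms] image_image)
  then show ?thesis
    by (simp add: compact_translate compact_cmult_image compact_O)
qed

lemma pball_eq: "b \<in> pball a k \<Longrightarrow> pball b k = pball a k"
  using ball_cosets_eq[of b a "pnorm unif ^ k" L] by (simp add: pball_def)

lemma pball_mono: "j \<le> k \<Longrightarrow> pball a k \<subseteq> pball a j"
proof -
  assume "j \<le> k"
  then have "pnorm unif ^ k \<le> pnorm unif ^ j"
    using unif(2,3) by (intro power_decreasing) auto
  then show ?thesis
    by (auto simp: pball_def)
qed

lemma self_pball: "a \<in> L \<Longrightarrow> a \<in> pball a k"
  by (simp add: pball_def)

lemma translate_pball:
  assumes "a \<in> L" shows "(+) a ` pball b k = pball (a + b) k"
proof -
  have "y \<in> (+) a ` pball b k" if "y \<in> pball (a + b) k" for y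
    using that assms by (intro image_eqI[of _ _ "y - a"]) (auto simp: pball_def diff_L algebra_simps)
  then show ?thesis
    using assms by (auto simp: pball_def add_L)
qed

text \<open>Division by \<open>unif ^ k\<close> turns balls of this radius into cosets of
  \<open>\<O>\<close>, which \<open>fracpart\<close> labels without repetition.\<close>

lemma pball_index:
  assumes "a \<in> L"
  shows "\<exists>!m. pnorm (a - fracpart m * unif ^ k) \<le> pnorm unif ^ k"
proof -
  have eq: "pnorm (a - fracpart m * unif ^ k) \<le> pnorm unif ^ k \<longleftrightarrow> pnorm (a / unif ^ k - fracpart m) \<le> 1" for m
  proof -
    have "a - fracpart m * unif ^ k = unif ^ k * (a / unif ^ k - fracpart m)"
      by (simp add: algebra_simps)
    then have "pnorm (a - fracpart m * unif ^ k) = pnorm unif ^ k * pnorm (a / unif ^ k - fracpart m)"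
      by (simp add: pnorm_mult pnorm_power)
    then show ?thesis
      using unif(2) by simp
  qed
  have "a / unif ^ k \<in> L"
    using assms unif by (intro divide_L power_L)
  from fracpart_surj[OF this] obtain m where m: "pnorm (a / unif ^ k - fracpart m) \<le> 1" ..
  moreover have "n = m" if "pnorm (a / unif ^ k - fracpart n) \<le> 1" for n
    using pnorm_sub_le[OF m that] by (intro fracpart_inj) simp
  ultimately show ?thesis
    unfolding eq by blast
qed

text \<open>The tail of a convergent sequence lies in a single translate of the compact ball
  \<open>\<O>\<close>.\<close>

lemma closed_L: "closed L"
proof (unfold closed_sequential_limits, intro allI impI, elim conjE)
  fix f and l :: 'a assume f: "\<forall>n. f n \<in> L" "f \<longlonglongrightarrow> l"
  then have "(\<lambda>n. dist (f n) l) \<longlonglongrightarrow> 0"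
    by (simp add: tendsto_dist_iff[of f])
  then have "\<forall>\<^sub>F n in sequentially. dist (f n) l < 1"
    by (rule order_tendstoD(2)) simp
  then obtain N where N: "\<And>n. n \<ge> N \<Longrightarrow> pnorm (f n - l) \<le> 1"
    by (force simp: eventually_sequentially dist_eq)
  have "f (n + N) \<in> pball (f N) 0" for n
    using f N[of N] N[of "n + N"] pnorm_sub_le[of "f (n + N) - l" 1 "f N - l"] by (auto simp: pball_def)
  moreover have "(\<lambda>n. f (n + N)) \<longlonglongrightarrow> l"
    using f(2) by (rule LIMSEQ_ignore_initial_segment)
  moreover have "closed (pball (f N) 0)"
    using f by (intro compact_imp_closed compact_pball) auto
  ultimately have "l \<in> pball (f N) 0"
    unfolding closed_sequential_limits by (smt (verit))
  then show "l \<in> L"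
    by (simp add: pball_def)
qed

section \<open>Borel sets of a local field; existence and uniqueness of Haar measure\<close>

definition pballs :: "'a set set" where
  "pballs = insert {} {pball a k | a k. a \<in> L}"

lemma pballs_Pow: "pballs \<subseteq> Pow L"
  by (auto simp: pballs_def pball_def)

text \<open>Two balls are nested or disjoint, which is why \<open>pballs\<close> contains the empty
  set; the balls can then serve as a generator on which measures are compared.\<close>

lemma Int_stable_pballs: "Int_stable pballs"
proof (rule Int_stableI)
  have *: "pball a j \<inter> pball b k \<in> pballs" if ab: "a \<in> L" "b \<in> L" and jk: "j \<le> k" for a b j k
  proof (cases "pball a j \<inter> pball b k = {}")
    case False
    then obtain c where c: "c \<in> pball a j" "c \<in> pball b k"
      by auto
    then have "pball b k = pball c k" "pball a j = pball c j"
      by (simp_all add: pball_eq)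
    then have "pball a j \<inter> pball b k = pball b k"
      using pball_mono[OF jk, of c] by auto
    then show ?thesis
      using ab by (auto simp: pballs_def)
  qed (simp add: pballs_def)
  fix A B assume "A \<in> pballs" "B \<in> pballs"
  then consider "A = {} \<or> B = {}" | a j b k where "A = pball a j" "B = pball b k" "a \<in> L" "b \<in> L"
    by (auto simp: pballs_def)
  then show "A \<inter> B \<in> pballs"
  proof cases
    case 2
    show ?thesis
    proof (cases "j \<le> k")
      case True
      then show ?thesis
        using 2 *[of a b j k] by simp
    next
      case False
      then show ?thesis
        using 2 *[of b a k j] by (simp add: Int_commute)
    qed
  qed (auto simp: pballs_def)
qed

lemma sets_borel_L: "sets (restrict_space borel L) = sigma_sets L pballs"
proof
  have "sets (restrict_space borel L) = (\<inter>) L ` sigma_sets UNIV {S. open S}"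
    by (simp add: sets_restrict_space borel_def)
  also have "\<dots> = sigma_sets L ((\<inter>) L ` {S. open S})"
  proof (rule sigma_sets_Int)
    show "L \<in> sigma_sets UNIV {S. open S}"
      using borel_closed[OF closed_L] by (simp add: borel_def)
  qed simp
  also have "\<dots> \<subseteq> sigma_sets L pballs"
  proof (rule sigma_sets_mono)
    show "(\<inter>) L ` {S. open S} \<subseteq> sigma_sets L pballs"
    proof
      fix S' :: "'a set" assume "S' \<in> (\<inter>) L ` {S. open S}"
      then obtain S where S: "open S" and S': "S' = L \<inter> S"
        by auto
      \<comment> \<open>Pairs of natural numbers list all balls, up to the choice of centre, so an
        open set is a countable union of balls.\<close>
      let ?b = "\<lambda>z. pball (fracpart (fst z) * unif ^ snd z) (snd z)"
      have "L \<inter> S = (\<Union>z\<in>{z. ?b z \<subseteq> S}. ?b z)"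
      proof (intro equalityI subsetI)
        fix y assume y: "y \<in> L \<inter> S"
        then obtain e where e: "e > 0" "ball y e \<subseteq> S"
          using S by (auto simp: open_contains_ball)
        obtain k where k: "pnorm unif ^ k < e"
          using unif_power_small[OF e(1)] by auto
        obtain m where m: "pnorm (y - fracpart m * unif ^ k) \<le> pnorm unif ^ k"
          using pball_index y by blast
        then have yin: "y \<in> pball (fracpart m * unif ^ k) k"
          using y by (simp add: pball_def)
        have "pball (fracpart m * unif ^ k) k \<subseteq> ball y e"
          unfolding pball_eq[OF yin, symmetric] using k
          by (auto simp: pball_def dist_eq pnorm_diff_commute)
        then show "y \<in> (\<Union>z\<in>{z. ?b z \<subseteq> S}. ?b z)"
          using yin e by (intro UN_I[of "(m, k)"]) auto
      qed (use pball_sub_L in auto)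
      moreover have "(\<Union>z\<in>{z. ?b z \<subseteq> S}. ?b z) \<in> sigma_sets L pballs"
      proof (rule sigma_sets_UNION)
        show "countable (?b ` {z. ?b z \<subseteq> S})"
          by simp
        have "?b z \<in> pballs" for z
          unfolding pballs_def using fracpart_L unif by (auto intro!: mult_L power_L)
        then show "b \<in> sigma_sets L pballs" if "b \<in> ?b ` {z. ?b z \<subseteq> S}" for b
          using that by auto
      qed
      ultimately show "S' \<in> sigma_sets L pballs"
        by (simp add: S')
    qed
  qed
  finally show "sets (restrict_space borel L) \<subseteq> sigma_sets L pballs" .
next
  have "pballs \<subseteq> sets (restrict_space borel L)"
  proof
    fix A assume "A \<in> pballs"
    then have "A = {} \<or> (\<exists>a k. a \<in> L \<and> A = pball a k)"
      by (auto simp: pballs_def)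
    then have "A \<in> sets borel \<and> A \<subseteq> L"
      using borel_closed[OF compact_imp_closed[OF compact_pball]] pball_sub_L by blast
    then show "A \<in> sets (restrict_space borel L)"
      using borel_closed[OF closed_L] by (auto simp: sets_restrict_space_iff)
  qed
  then show "sigma_sets L pballs \<subseteq> sets (restrict_space borel L)"
    using sets.sigma_sets_subset[of pballs "restrict_space borel L"] by (simp add: space_restrict_space)
qed

lemma space_borel_L [simp]: "space (restrict_space borel L) = L"
  by (simp add: space_restrict_space)

lemma pball_sets: "a \<in> L \<Longrightarrow> pball a k \<in> sets (restrict_space borel L)"
  unfolding sets_borel_L by (auto simp: pballs_def)

lemma measurable_into_L:
  assumes "f \<in> space M \<rightarrow> L" "\<And>a k. a \<in> L \<Longrightarrow> f -` pball a k \<inter> space M \<in> sets M"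
  shows "f \<in> measurable M (restrict_space borel L)"
proof (rule measurable_sigma_sets[OF sets_borel_L pballs_Pow])
  fix A assume "A \<in> pballs"
  then show "f -` A \<inter> space M \<in> sets M"
    using assms(2) by (auto simp: pballs_def)
qed (use assms in auto)

text \<open>The countably many translates of \<open>\<O>\<close> by fractional parts cover
  \<open>L\<close> and provide the sigma-finiteness that uniqueness on a generator requires.\<close>

lemma measure_eqI_pballs:
  assumes "sets M = sets (restrict_space borel L)" "sets N = sets (restrict_space borel L)"
    and "\<And>a k. a \<in> L \<Longrightarrow> emeasure M (pball a k) = emeasure N (pball a k)"
    and "\<And>a k. a \<in> L \<Longrightarrow> emeasure M (pball a k) \<noteq> \<infinity>"
  shows "M = N"
proof (rule measure_eqI_generator_eq[OF Int_stable_pballs pballs_Pow])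
  fix X assume "X \<in> pballs"
  then show "emeasure M X = emeasure N X"
    using assms(3) by (auto simp: pballs_def)
next
  show "sets M = sigma_sets L pballs" "sets N = sigma_sets L pballs"
    using assms sets_borel_L by auto
  show "range (\<lambda>m. pball (fracpart m) 0) \<subseteq> pballs"
    by (auto simp: pballs_def intro: fracpart_L)
  show "(\<Union>m. pball (fracpart m) 0) = L"
    using fracpart_surj by (auto simp: pball_def)
  show "emeasure M (pball (fracpart i) 0) \<noteq> \<infinity>" for i
    using assms(4) fracpart_L by auto
qed

text \<open>The field element with the same digits as the real number \<open>t\<close>: the digit of
  \<open>t\<close> at place \<open>resq ^ (- j)\<close> becomes the digit at
  \<open>unif ^ (j - 1)\<close>. The number \<open>\<lfloor>t * resq ^ k\<rfloor>\<close> collects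
  the digits up to place \<open>k\<close>, and it labels a ball of level \<open>k\<close>.\<close>

definition haar_point :: "real \<Rightarrow> 'a" where
  "haar_point t = (SOME y. \<forall>k. y \<in> pball (fracpart (nat \<lfloor>t * real resq ^ k\<rfloor>) * unif ^ k) k)"

lemma floor_mult_div: 
  assumes "0 \<le> t" "0 < (q :: nat)"
  shows "nat \<lfloor>t * real q ^ Suc k\<rfloor> div q = nat \<lfloor>t * real q ^ k\<rfloor>"
proof -
  have "\<lfloor>t * real q ^ k\<rfloor> = \<lfloor>(t * real q ^ Suc k) / real q\<rfloor>"
    using assms by simp
  also have "\<dots> = \<lfloor>t * real q ^ Suc k\<rfloor> div int q"
    by (metis floor_divide_real_eq_div of_int_of_nat_eq of_nat_0_le_iff)
  finally show ?thesis
    using assms by (simp add: nat_div_distrib)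
qed

text \<open>Passing from level \<open>Suc k\<close> to \<open>k\<close> deletes the last digit,
  which moves the centre by at most \<open>pnorm unif ^ k\<close>. The balls are therefore nested
  and compact, so they have a common point.\<close>

lemma haar_point_exists:
  assumes "0 \<le> t"
  shows "\<exists>y. \<forall>k. y \<in> pball (fracpart (nat \<lfloor>t * real resq ^ k\<rfloor>) * unif ^ k) k"
proof -
  define c where "c k = fracpart (nat \<lfloor>t * real resq ^ k\<rfloor>) * unif ^ k" for k
  have cL: "c k \<in> L" for k
    unfolding c_def using fracpart_L unif by (intro mult_L power_L) auto
  have dec: "pball (c (Suc k)) (Suc k) \<subseteq> pball (c k) k" for k
  proof -
    let ?m = "nat \<lfloor>t * real resq ^ Suc k\<rfloor>"
    have "c (Suc k) = (unif * fracpart ?m) * unif ^ k"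
      by (simp add: c_def mult_ac)
    also have "\<dots> = c k + digit (?m mod resq) * unif ^ k"
      using resq_ge_2 assms by (simp add: fracpart_step floor_mult_div c_def algebra_simps del: power_Suc)
    finally have "pnorm (c (Suc k) - c k) = pnorm (digit (?m mod resq)) * pnorm unif ^ k"
      by (simp add: pnorm_mult pnorm_power)
    moreover have "pnorm (digit (?m mod resq)) \<le> 1"
      using digit(2)[of "?m mod resq"] resq_ge_2 by (simp add: int_ring_iff)
    ultimately have "pnorm (c (Suc k) - c k) \<le> pnorm unif ^ k"
      using unif(2) by (simp add: mult_left_le_one_le)
    then have "c (Suc k) \<in> pball (c k) k"
      using cL by (simp add: pball_def)
    from pball_eq[OF this] show ?thesis
      using pball_mono[of k "Suc k" "c (Suc k)"] by auto
  qed
  then have "decseq (\<lambda>k. pball (c k) k)"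
    by (rule decseq_SucI)
  then have mono: "pball (c k) k \<subseteq> pball (c j) j" if "j \<le> k" for j k
    using that by (auto simp: decseq_def)
  have "pball (c 0) 0 \<inter> (\<Inter>k\<in>UNIV. pball (c k) k) \<noteq> {}"
  proof (rule compact_imp_fip_image[OF compact_pball[OF cL]])
    fix I :: "nat set" assume "finite I"
    then obtain n where n: "\<And>i. i \<in> I \<Longrightarrow> i \<le> n"
      using finite_nat_set_iff_bounded_le by auto
    then have "c n \<in> pball (c 0) 0 \<inter> (\<Inter>k\<in>I. pball (c k) k)"
      using mono self_pball[OF cL[of n], of n] by blast
    then show "pball (c 0) 0 \<inter> (\<Inter>k\<in>I. pball (c k) k) \<noteq> {}"
      by blast
  qed (use cL compact_pball compact_imp_closed in blast)
  then show ?thesis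
    unfolding c_def by blast
qed

lemma haar_point:
  assumes "0 \<le> t"
  shows "haar_point t \<in> pball (fracpart (nat \<lfloor>t * real resq ^ k\<rfloor>) * unif ^ k) k"
  using someI_ex[OF haar_point_exists[OF assms]] unfolding haar_point_def by blast

text \<open>A ball of level \<open>k\<close> has one label \<open>m\<close>, and
  \<open>haar_point t\<close> lies in it exactly when
  \<open>\<lfloor>t * resq ^ k\<rfloor> = m\<close>. The interval found has length
  \<open>1 / resq ^ k\<close>, which becomes the mass of the ball.\<close>

lemma haar_point_vimage:
  assumes "a \<in> L"
  shows "\<exists>m. haar_point -` pball a k \<inter> {0..} = {real m / real resq ^ k ..< (real m + 1) / real resq ^ k}"
proof -
  obtain m where m: "pnorm (a - fracpart m * unif ^ k) \<le> pnorm unif ^ k"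
    "\<And>n. pnorm (a - fracpart n * unif ^ k) \<le> pnorm unif ^ k \<Longrightarrow> n = m"
    using pball_index[OF assms, of k] by blast
  have "haar_point t \<in> pball a k \<longleftrightarrow> nat \<lfloor>t * real resq ^ k\<rfloor> = m" if t: "0 \<le> t" for t
  proof -
    let ?n = "nat \<lfloor>t * real resq ^ k\<rfloor>"
    note h = haar_point[OF t, of k]
    have "haar_point t \<in> pball a k \<longleftrightarrow> pnorm (a - fracpart ?n * unif ^ k) \<le> pnorm unif ^ k"
    proof
      assume "haar_point t \<in> pball a k"
      then have "pball a k = pball (fracpart ?n * unif ^ k) k"
        using pball_eq[OF h] pball_eq[of "haar_point t" a k] by simp
      then show "pnorm (a - fracpart ?n * unif ^ k) \<le> pnorm unif ^ k"
        using self_pball[OF assms, of k] by (simp add: pball_def)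
    next
      assume "pnorm (a - fracpart ?n * unif ^ k) \<le> pnorm unif ^ k"
      then have "a \<in> pball (fracpart ?n * unif ^ k) k"
        using assms by (simp add: pball_def)
      from pball_eq[OF this] show "haar_point t \<in> pball a k"
        using h by simp
    qed
    then show ?thesis
      using m by blast
  qed
  moreover have "nat \<lfloor>t * real resq ^ k\<rfloor> = m \<longleftrightarrow>
      t \<in> {real m / real resq ^ k ..< (real m + 1) / real resq ^ k}" if "0 \<le> t" for t
  proof -
    have "nat \<lfloor>t * real resq ^ k\<rfloor> = m \<longleftrightarrow> \<lfloor>t * real resq ^ k\<rfloor> = int m"
      using that by (auto simp: nat_eq_iff)
    also have "\<dots> \<longleftrightarrow> real m \<le> t * real resq ^ k \<and> t * real resq ^ k < real m + 1"
      by (simp add: floor_eq_iff)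
    finally show ?thesis
      using resq_ge_2 by (auto simp: field_simps)
  qed
  moreover have "0 \<le> t" if "t \<in> {real m / real resq ^ k ..< (real m + 1) / real resq ^ k}" for t
    using that by (auto intro: order_trans[rotated])
  ultimately have "haar_point -` pball a k \<inter> {0..} = {real m / real resq ^ k ..< (real m + 1) / real resq ^ k}"
    unfolding set_eq_iff Int_iff atLeast_iff vimage_eq by blast
  then show ?thesis ..
qed

definition haar_model :: "'a measure" where
  "haar_model = distr (restrict_space lborel {0..}) (restrict_space borel L) haar_point"

lemma haar_point_measurable:
  "haar_point \<in> measurable (restrict_space lborel {0..}) (restrict_space borel L)"
proof (rule measurable_into_L)
  show "haar_point \<in> space (restrict_space lborel {0..}) \<rightarrow> L"
    using haar_point pball_sub_L by (force simp: space_restrict_space)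
  fix a :: 'a and k assume "a \<in> L"
  then obtain m where "haar_point -` pball a k \<inter> {0..} = {real m / real resq ^ k ..< (real m + 1) / real resq ^ k}"
    using haar_point_vimage by blast
  then show "haar_point -` pball a k \<inter> space (restrict_space lborel {0..}) \<in> sets (restrict_space lborel {0..})"
    by (auto simp: space_restrict_space sets_restrict_space_iff)
qed

lemma emeasure_haar_model:
  assumes "a \<in> L"
  shows "emeasure haar_model (pball a k) = ennreal (1 / real resq ^ k)"
proof -
  obtain m where m: "haar_point -` pball a k \<inter> {0..} = {real m / real resq ^ k ..< (real m + 1) / real resq ^ k}"
    using haar_point_vimage[OF assms] by blast
  have "emeasure haar_model (pball a k) = emeasure lborel (haar_point -` pball a k \<inter> {0..})"
    unfolding haar_model_def using haar_point_measurable pball_sets[OF assms]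
    by (subst emeasure_distr) (auto simp: space_restrict_space emeasure_restrict_space)
  then show ?thesis
    using resq_ge_2 by (simp add: m field_simps)
qed

lemma sets_haar_model: "sets haar_model = sets (restrict_space borel L)"
  and space_haar_model: "space haar_model = L"
  by (simp_all add: haar_model_def)

lemma translate_measurable:
  assumes "a \<in> L" "sets M = sets (restrict_space borel L)"
  shows "(\<lambda>y. y - a) \<in> measurable M (restrict_space borel L)"
proof (rule measurable_into_L)
  have sp: "space M = L"
    using sets_eq_imp_space_eq[OF assms(2)] by simp
  show "(\<lambda>y. y - a) \<in> space M \<rightarrow> L"
    using assms by (auto simp: sp diff_L)
  fix b k assume b: "b \<in> L"
  have "(\<lambda>y. y - a) -` pball b k \<inter> L = pball (a + b) k"
    using assms(1) by (auto simp: pball_def diff_L algebra_simps)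
  then show "(\<lambda>y. y - a) -` pball b k \<inter> space M \<in> sets M"
    using assms b by (simp add: sp pball_sets add_L)
qed

lemma translate_image:
  assumes "a \<in> L" "A \<subseteq> L" shows "(+) a ` A = (\<lambda>y. y - a) -` A \<inter> L"
proof -
  have "y \<in> (+) a ` A" if "y - a \<in> A" for y
    using that by (intro image_eqI[of _ _ "y - a"]) auto
  then show ?thesis
    using assms by (auto intro: add_L)
qed

text \<open>Translation permutes the balls of a given radius, which all have the same mass, and a
  measure is determined by its values on balls.\<close>

lemma haar_model_invariant:
  assumes "a \<in> L" "A \<in> sets haar_model"
  shows "emeasure haar_model ((+) a ` A) = emeasure haar_model A"
proof -
  let ?N = "distr haar_model (restrict_space borel L) (\<lambda>y. y - a)"
  note m = translate_measurable[OF assms(1) sets_haar_model]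
  have N: "emeasure ?N B = emeasure haar_model ((+) a ` B)" if "B \<in> sets haar_model" for B
  proof -
    have "B \<subseteq> L"
      using sets.sets_into_space[OF that] by (simp add: space_haar_model)
    then show ?thesis
      using that m by (simp add: emeasure_distr sets_haar_model space_haar_model translate_image[OF assms(1)])
  qed
  have "haar_model = ?N"
  proof (rule measure_eqI_pballs)
    fix b k assume b: "b \<in> L"
    then show "emeasure haar_model (pball b k) = emeasure ?N (pball b k)"
      using assms(1) by (subst N) (auto simp: translate_pball emeasure_haar_model add_L sets_haar_model pball_sets)
  qed (auto simp: sets_haar_model emeasure_haar_model)
  then show ?thesis
    using N[OF assms(2)] by simp
qed

definition is_haar :: "'a measure \<Rightarrow> bool" where
  "is_haar M \<longleftrightarrow> space M = L \<and> sets M = sets (restrict_space borel L) \<and>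
     (\<forall>a\<in>L. \<forall>A\<in>sets M. emeasure M ((+) a ` A) = emeasure M A) \<and>
     emeasure M (int_ring L) = 1"

lemma is_haar_model: "is_haar haar_model"
  unfolding is_haar_def
  using space_haar_model sets_haar_model haar_model_invariant emeasure_haar_model[of 0 0]
  by (simp add: pball_0 flip: \<O>_def)

lemma coset_O:
  assumes "a \<in> \<O>" shows "{y \<in> \<O>. pnorm (y - a) \<le> pnorm unif ^ k} = pball a k"
proof -
  have "y \<in> \<O>" if "y \<in> L" "pnorm (y - a) \<le> pnorm unif ^ k" for y
  proof -
    have "pnorm (y - a) \<le> 1"
      using that unif power_le_one[of "pnorm unif" k] by auto
    then show ?thesis
      using assms that pnorm_add_le[of "y - a" 1 a] by (auto simp: int_ring_iff)
  qed
  then show ?thesis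
    by (auto simp: pball_def int_ring_L)
qed

text \<open>Invariance makes the balls of one radius equally heavy, and \<open>\<O>\<close>, of mass
  \<open>1\<close>, is a disjoint union of finitely many of them. Their number depends on
  \<open>L\<close> only, so any two measures with these properties agree on balls.\<close>

lemma is_haar_pball:
  assumes "is_haar M" "a \<in> L"
  shows "emeasure M (pball a k) = emeasure M (pball 0 k)"
    "of_nat (card (ball_cosets \<O> (pnorm unif ^ k))) * emeasure M (pball 0 k) = 1"
proof -
  have eq: "emeasure M (pball a k) = emeasure M (pball 0 k)" if "a \<in> L" for a
    using assms(1) that pball_sets[OF zero_L, of k] translate_pball[OF that, of 0 k]
    unfolding is_haar_def by (metis add.right_neutral)
  then show "emeasure M (pball a k) = emeasure M (pball 0 k)"
    using assms(2) .
  let ?C = "ball_cosets \<O> (pnorm unif ^ k)"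
  have Cp: "\<exists>a. a \<in> L \<and> C = pball a k" if "C \<in> ?C" for C
    using that coset_O int_ring_L unfolding ball_cosets_def by blast
  have "1 = emeasure M (\<Union> ?C)"
    using assms(1) unif(2) by (simp add: Union_ball_cosets is_haar_def \<O>_def)
  also have "\<dots> = (\<Sum>C\<in>?C. emeasure M C)"
  proof (rule emeasure_Union_disjoint)
    show "finite ?C"
      using unif(2) by (intro finite_ball_cosets compact_O) simp
    show "?C \<subseteq> sets M"
      using Cp assms(1) pball_sets unfolding is_haar_def by blast
    show "disjoint ?C"
      by (rule disjoint_ball_cosets)
  qed
  also have "\<dots> = (\<Sum>C\<in>?C. emeasure M (pball 0 k))"
    using Cp eq by (intro sum.cong refl) metis
  finally show "of_nat (card ?C) * emeasure M (pball 0 k) = 1"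
    by simp
qed

lemma is_haar_unique:
  assumes "is_haar M" "is_haar N" shows "M = N"
proof (rule measure_eqI_pballs)
  show "sets M = sets (restrict_space borel L)" "sets N = sets (restrict_space borel L)"
    using assms by (auto simp: is_haar_def)
  fix a k assume a: "a \<in> L"
  let ?c = "of_nat (card (ball_cosets \<O> (pnorm unif ^ k))) :: ennreal"
  have MN: "?c * emeasure M (pball 0 k) = 1" "?c * emeasure N (pball 0 k) = 1"
    using is_haar_pball(2) assms zero_L by blast+
  then have c: "?c \<noteq> 0" "?c \<noteq> \<infinity>"
    by (metis mult_zero_left zero_neq_one, metis infinity_ennreal_def of_nat_less_top less_irrefl)
  have *: "X = 1 / ?c" if "?c * X = 1" for X
    using ennreal_mult_divide_eq[of ?c X] c that by (simp add: mult.commute)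
  have "emeasure M (pball 0 k) = 1 / ?c" "emeasure N (pball 0 k) = 1 / ?c"
    using MN by (auto intro: *)
  then show "emeasure M (pball a k) = emeasure N (pball a k)" "emeasure M (pball a k) \<noteq> \<infinity>"
    using is_haar_pball(1)[OF assms(1) a] is_haar_pball(1)[OF assms(2) a] c
    by (auto simp: ennreal_divide_eq_top_iff)
qed

lemma haar_eq_model: "haar L = haar_model"
proof -
  have "haar L = (THE M. is_haar M)"
    by (simp add: haar_def is_haar_def)
  also have "\<dots> = haar_model"
    using is_haar_model is_haar_unique by blast
  finally show ?thesis .
qed

lemma is_haar_haar: "is_haar (haar L)"
  using is_haar_model by (simp add: haar_eq_model)

lemma space_haar [simp]: "space (haar L) = L"
  and sets_haar: "sets (haar L) = sets (restrict_space borel L)"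
  and haar_invariant: "a \<in> L \<Longrightarrow> A \<in> sets (haar L) \<Longrightarrow> emeasure (haar L) ((+) a ` A) = emeasure (haar L) A"
  and emeasure_haar_O: "emeasure (haar L) \<O> = 1"
  using is_haar_haar by (auto simp: is_haar_def \<O>_def)

lemma emeasure_haar_pball: "a \<in> L \<Longrightarrow> emeasure (haar L) (pball a k) = ennreal (1 / real resq ^ k)"
  by (simp add: haar_eq_model emeasure_haar_model)

end

section \<open>Bases, degrees and linear spans\<close>

lemma is_basis_comb: "is_basis R M r b \<Longrightarrow> (\<And>i. i < r \<Longrightarrow> c i \<in> R) \<Longrightarrow> (\<Sum>i<r. c i * b i) \<in> M"
  by (simp add: is_basis_def)

text \<open>The \<open>\<exists>!\<close> in \<open>is_basis\<close> concerns extensional functions;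
  restricting both families to \<open>{..<r}\<close> turns it into equality of coefficients.\<close>

lemma is_basis_unique:
  assumes "is_basis R M r b" "\<And>i. i < r \<Longrightarrow> c i \<in> R" "\<And>i. i < r \<Longrightarrow> d i \<in> R"
    and eq: "(\<Sum>i<r. c i * b i) = (\<Sum>i<r. d i * b i)" and "i < r"
  shows "c i = d i"
proof -
  let ?y = "\<Sum>i<r. c i * b i"
  have "?y \<in> M"
    using assms by (intro is_basis_comb)
  then have ex: "\<exists>!c. c \<in> {..<r} \<rightarrow>\<^sub>E R \<and> ?y = (\<Sum>i<r. c i * b i)"
    using assms(1) by (simp add: is_basis_def)
  have "restrict c {..<r} = restrict d {..<r}"
  proof (rule ex1E[OF ex], rule trans)
    fix e assume e: "\<forall>c'. c' \<in> {..<r} \<rightarrow>\<^sub>E R \<and> ?y = (\<Sum>i<r. c' i * b i) \<longrightarrow> c' = e"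
    have c: "restrict c {..<r} \<in> {..<r} \<rightarrow>\<^sub>E R \<and> ?y = (\<Sum>i<r. restrict c {..<r} i * b i)"
      using assms(2) by auto
    have d: "restrict d {..<r} \<in> {..<r} \<rightarrow>\<^sub>E R \<and> ?y = (\<Sum>i<r. restrict d {..<r} i * b i)"
      using assms(3) eq by auto
    show "restrict c {..<r} = e" "e = restrict d {..<r}"
      using e[rule_format, OF c] e[rule_format, OF d] by simp_all
  qed
  then show ?thesis
    using \<open>i < r\<close> by (metis lessThan_iff restrict_apply')
qed

lemma is_basis_coeffs:
  assumes "is_basis R M r b" "y \<in> M"
  obtains c where "\<And>i. i < r \<Longrightarrow> c i \<in> R" "y = (\<Sum>i<r. c i * b i)"
proof -
  obtain c where "c \<in> {..<r} \<rightarrow>\<^sub>E R" "y = (\<Sum>i<r. c i * b i)"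
    using assms unfolding is_basis_def by blast
  then show thesis
    by (intro that[of c]) auto
qed

lemma is_basisI:
  assumes "\<And>c. (\<And>i. i < r \<Longrightarrow> c i \<in> R) \<Longrightarrow> (\<Sum>i<r. c i * b i) \<in> M"
    and "\<And>y. y \<in> M \<Longrightarrow> \<exists>c. (\<forall>i<r. c i \<in> R) \<and> y = (\<Sum>i<r. c i * b i)"
    and indep: "\<And>c. (\<And>i. i < r \<Longrightarrow> c i \<in> R) \<Longrightarrow> (\<Sum>i<r. c i * b i) = 0 \<Longrightarrow> (\<forall>i<r. c i = 0)"
    and diff: "\<And>x y. x \<in> R \<Longrightarrow> y \<in> R \<Longrightarrow> x - y \<in> R"
  shows "is_basis R M r b"
  unfolding is_basis_def
proof (intro conjI allI impI ballI)
  fix y assume "y \<in> M"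
  then obtain c where c: "\<forall>i<r. c i \<in> R" "y = (\<Sum>i<r. c i * b i)"
    using assms(2) by blast
  show "\<exists>!c. c \<in> {..<r} \<rightarrow>\<^sub>E R \<and> y = (\<Sum>i<r. c i * b i)"
  proof (rule ex1I[of _ "restrict c {..<r}"])
    fix d assume d: "d \<in> {..<r} \<rightarrow>\<^sub>E R \<and> y = (\<Sum>i<r. d i * b i)"
    have "\<forall>i<r. d i - c i = 0"
    proof (rule indep)
      show "d i - c i \<in> R" if "i < r" for i
        using d c that by (intro diff) auto
      show "(\<Sum>i<r. (d i - c i) * b i) = 0"
        using c(2) d by (simp add: left_diff_distrib sum_subtractf)
    qed
    then have *: "\<And>i. i < r \<Longrightarrow> d i = c i"
      by simp
    have "d i = restrict c {..<r} i" for i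
    proof (cases "i < r")
      case False
      then show ?thesis
        using d PiE_arb[of d "{..<r}" "\<lambda>_. R" i] by simp
    qed (simp add: *)
    then show "d = restrict c {..<r}"
      by blast
  next
    have "(\<Sum>i<r. restrict c {..<r} i * b i) = (\<Sum>i<r. c i * b i)"
      by (intro sum.cong) simp_all
    then show "restrict c {..<r} \<in> {..<r} \<rightarrow>\<^sub>E R \<and> y = (\<Sum>i<r. restrict c {..<r} i * b i)"
      using c by (simp add: restrict_PiE_iff)
  qed
qed (use assms(1) in auto)

text \<open>In characteristic zero the rank is the trace of the identity: if \<open>P\<close> and \<open>Q\<close> are the
  mutually inverse base changes then \<open>r = tr (P Q) = tr (Q P) = s\<close>.\<close>

lemma is_basis_rank_unique:
  fixes R :: "'a::{comm_ring_1, ring_char_0} set"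
  assumes b: "is_basis R M r b" and b': "is_basis R M s b'"
    and R: "0 \<in> R" "1 \<in> R" "\<And>x y. x \<in> R \<Longrightarrow> y \<in> R \<Longrightarrow> x + y \<in> R" "\<And>x y. x \<in> R \<Longrightarrow> y \<in> R \<Longrightarrow> x * y \<in> R"
  shows "r = s"
proof -
  have elt: "b i \<in> M" if "is_basis R M r b" "i < r" for r b i
  proof -
    have "(\<Sum>j<r. (if j = i then 1 else 0) * b j) \<in> M"
      using that R by (intro is_basis_comb[OF that(1)]) auto
    also have "(\<Sum>j<r. (if j = i then 1 else 0) * b j) = b i"
      using that(2) by (simp add: if_distrib[of "\<lambda>x. x * _"] cong: if_cong)
    finally show ?thesis .
  qed
  have ex: "\<exists>c. (\<forall>i<r. c i \<in> R) \<and> y = (\<Sum>i<r. c i * b i)" if "is_basis R M r b" "y \<in> M" for r b y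
    using is_basis_coeffs[OF that] by metis
  have "\<forall>j\<in>{..<s}. \<exists>c. (\<forall>i<r. c i \<in> R) \<and> b' j = (\<Sum>i<r. c i * b i)"
    using ex[OF b elt[OF b']] by auto
  then obtain P where P: "\<And>i j. j < s \<Longrightarrow> i < r \<Longrightarrow> P j i \<in> R" "\<And>j. j < s \<Longrightarrow> b' j = (\<Sum>i<r. P j i * b i)"
    by (metis lessThan_iff)
  have "\<forall>j\<in>{..<r}. \<exists>c. (\<forall>i<s. c i \<in> R) \<and> b j = (\<Sum>i<s. c i * b' i)"
    using ex[OF b' elt[OF b]] by auto
  then obtain Q where Q: "\<And>i j. j < r \<Longrightarrow> i < s \<Longrightarrow> Q j i \<in> R" "\<And>j. j < r \<Longrightarrow> b j = (\<Sum>i<s. Q j i * b' i)"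
    by (metis lessThan_iff)
  have sumR: "sum f A \<in> R" if "\<And>i. i \<in> A \<Longrightarrow> f i \<in> R" for f and A :: "nat set"
    using that by (induction A rule: infinite_finite_induct) (auto intro: R)
  have id: "(\<Sum>i<s. Q j i * P i j) = 1"
    if "is_basis R M r b" "\<And>i j. j < s \<Longrightarrow> i < r \<Longrightarrow> P j i \<in> R" "\<And>j. j < s \<Longrightarrow> b' j = (\<Sum>i<r. P j i * b i)"
    "\<And>i j. j < r \<Longrightarrow> i < s \<Longrightarrow> Q j i \<in> R" "\<And>j. j < r \<Longrightarrow> b j = (\<Sum>i<s. Q j i * b' i)"
    "j < r" for r s :: nat and b b' P Q j
  proof -
    have "(\<Sum>k<r. (if k = j then 1 else 0) * b k) = b j"
      using that(6) by (simp add: if_distrib[of "\<lambda>x. x * _"] cong: if_cong)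
    also have "\<dots> = (\<Sum>i<s. Q j i * b' i)"
      by (rule that(5)[OF that(6)])
    also have "\<dots> = (\<Sum>i<s. Q j i * (\<Sum>k<r. P i k * b k))"
      by (intro sum.cong refl) (simp only: lessThan_iff that(3))
    also have "\<dots> = (\<Sum>k<r. (\<Sum>i<s. Q j i * P i k) * b k)"
      unfolding sum_distrib_left sum_distrib_right by (subst sum.swap) (simp add: mult_ac)
    finally have eq: "(\<Sum>k<r. (if k = j then 1 else 0) * b k) = (\<Sum>k<r. (\<Sum>i<s. Q j i * P i k) * b k)" .
    have "(if j = j then 1 else 0) = (\<Sum>i<s. Q j i * P i j)"
    proof (rule is_basis_unique[OF that(1) _ _ eq that(6)])
      fix k assume k: "k < r"
      show "(if k = j then 1 else 0) \<in> R"
        by (simp add: R)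
      show "(\<Sum>i<s. Q j i * P i k) \<in> R"
      proof (rule sumR)
        fix i assume "i \<in> {..<s}"
        then show "Q j i * P i k \<in> R"
          using that(2,4,6) k by (intro R(4)) auto
      qed
    qed
    then show ?thesis by simp
  qed
  have "of_nat r = (\<Sum>j<r. \<Sum>i<s. Q j i * P i j)"
    using id[OF b P Q] by simp
  also have "\<dots> = (\<Sum>i<s. \<Sum>j<r. P i j * Q j i)"
    by (subst sum.swap) (simp add: mult_ac)
  also have "\<dots> = of_nat s"
    using id[OF b' Q P] by simp
  finally show ?thesis
    by simp
qed

lemma is_subfieldD:
  assumes "is_subfield F"
  shows "0 \<in> F" "1 \<in> F" "x \<in> F \<Longrightarrow> y \<in> F \<Longrightarrow> x + y \<in> F" "x \<in> F \<Longrightarrow> y \<in> F \<Longrightarrow> x * y \<in> F"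
    "x \<in> F \<Longrightarrow> - x \<in> F" "x \<in> F \<Longrightarrow> inverse x \<in> F" "x \<in> F \<Longrightarrow> y \<in> F \<Longrightarrow> x - y \<in> F"
  using assms unfolding is_subfield_def by (auto simp del: add_uminus_conv_diff simp flip: add_uminus_conv_diff)

lemma ext_degree_eq:
  fixes F :: "'a::field_char_0 set"
  assumes "is_subfield F" "is_basis F K r b"
  shows "ext_degree F K = r"
  unfolding ext_degree_def
proof (rule the_equality)
  show "\<exists>b. is_basis F K r b"
    using assms by blast
  fix s assume "\<exists>b. is_basis F K s b"
  then obtain b' where "is_basis F K s b'" ..
  from is_basis_rank_unique[OF this assms(2)] show "s = r"
    using is_subfieldD[OF assms(1)] by blast
qed

lemma finite_extension_basis:
  fixes F :: "'a::field_char_0 set"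
  assumes "finite_extension F K"
  obtains b where "is_basis F K (ext_degree F K) b"
  using assms ext_degree_eq unfolding finite_extension_def by metis

text \<open>Used with \<open>R\<close> a field, giving a subspace, and with \<open>R\<close> a ring
  of integers, giving a compact module. Indexing by an initial segment allows induction along a
  flag.\<close>

definition lincomb_set :: "'a::comm_ring_1 set \<Rightarrow> nat \<Rightarrow> (nat \<Rightarrow> 'a) \<Rightarrow> 'a set" where
  "lincomb_set R k v = {(\<Sum>i<k. c i * v i) | c. \<forall>i<k. c i \<in> R}"

lemma lincomb_setI: "(\<And>i. i < k \<Longrightarrow> c i \<in> R) \<Longrightarrow> (\<Sum>i<k. c i * v i) \<in> lincomb_set R k v"
  by (auto simp: lincomb_set_def)

lemma lincomb_set_0 [simp]: "lincomb_set R 0 v = {0}"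
  by (auto simp: lincomb_set_def)

lemma lincomb_set_Suc:
  "lincomb_set R (Suc k) v = {u + c * v k | u c. u \<in> lincomb_set R k v \<and> c \<in> R}"
proof (intro equalityI subsetI)
  fix y assume "y \<in> lincomb_set R (Suc k) v"
  then obtain c where "y = (\<Sum>i<k. c i * v i) + c k * v k" "\<forall>i<Suc k. c i \<in> R"
    by (auto simp: lincomb_set_def)
  then have "(\<Sum>i<k. c i * v i) \<in> lincomb_set R k v" "c k \<in> R" "y = (\<Sum>i<k. c i * v i) + c k * v k"
    by (auto intro: lincomb_setI)
  then show "y \<in> {u + c * v k | u c. u \<in> lincomb_set R k v \<and> c \<in> R}"
    by blast
next
  fix y assume "y \<in> {u + c * v k | u c. u \<in> lincomb_set R k v \<and> c \<in> R}"
  then obtain c d where *: "y = (\<Sum>i<k. c i * v i) + d * v k" "\<forall>i<k. c i \<in> R" "d \<in> R"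
    by (auto simp: lincomb_set_def)
  have "(\<Sum>i<Suc k. (c(k := d)) i * v i) \<in> lincomb_set R (Suc k) v"
    using * by (intro lincomb_setI) (auto simp: less_Suc_eq)
  also have "(\<Sum>i<Suc k. (c(k := d)) i * v i) = y"
    using * by simp
  finally show "y \<in> lincomb_set R (Suc k) v" .
qed

lemma lincomb_set_cong: "(\<And>i. i < k \<Longrightarrow> v i = w i) \<Longrightarrow> lincomb_set R k v = lincomb_set R k w"
  by (auto simp: lincomb_set_def)

lemma lincomb_set_add:
  assumes "\<And>x y. x \<in> R \<Longrightarrow> y \<in> R \<Longrightarrow> x + y \<in> R" "u \<in> lincomb_set R k v" "w \<in> lincomb_set R k v"
  shows "u + w \<in> lincomb_set R k v"
proof -
  obtain c d where "u = (\<Sum>i<k. c i * v i)" "w = (\<Sum>i<k. d i * v i)" "\<forall>i<k. c i \<in> R" "\<forall>i<k. d i \<in> R"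
    using assms by (auto simp: lincomb_set_def)
  then show ?thesis
    using assms(1) lincomb_setI[of k "\<lambda>i. c i + d i" R v] by (simp add: distrib_right sum.distrib)
qed

lemma lincomb_set_mult:
  assumes "\<And>x y. x \<in> R \<Longrightarrow> y \<in> R \<Longrightarrow> x * y \<in> R" "a \<in> R" "u \<in> lincomb_set R k v"
  shows "a * u \<in> lincomb_set R k v"
proof -
  obtain c where "u = (\<Sum>i<k. c i * v i)" "\<forall>i<k. c i \<in> R"
    using assms by (auto simp: lincomb_set_def)
  then show ?thesis
    using assms(1,2) lincomb_setI[of k "\<lambda>i. a * c i" R v] by (simp add: sum_distrib_left mult_ac)
qed

context valued_field
begin

lemma lincomb_set_add_L:
  "u \<in> lincomb_set L k v \<Longrightarrow> w \<in> lincomb_set L k v \<Longrightarrow> u + w \<in> lincomb_set L k v"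
  by (rule lincomb_set_add[of L]) (rule add_L)

lemma lincomb_set_mult_L:
  "a \<in> L \<Longrightarrow> u \<in> lincomb_set L k v \<Longrightarrow> a * u \<in> lincomb_set L k v"
  by (rule lincomb_set_mult[of L]) (rule mult_L)

lemma lincomb_set_diff_L:
  "u \<in> lincomb_set L k v \<Longrightarrow> w \<in> lincomb_set L k v \<Longrightarrow> u - w \<in> lincomb_set L k v"
  using lincomb_set_add_L[of u k v "- w"] lincomb_set_mult_L[of "-1" w k v] minus_L[OF one_L] by simp

lemma compact_lincomb_set:
  assumes "compact (A :: 'a set)" shows "compact (lincomb_set A k v)"
proof (induction k)
  case (Suc k)
  have "lincomb_set A (Suc k) v = {u + w | u w. u \<in> lincomb_set A k v \<and> w \<in> (\<lambda>c. v k * c) ` A}"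
    unfolding lincomb_set_Suc by (auto simp: mult.commute)
  then show ?case
    using compact_add_image[OF Suc compact_cmult_image[OF assms]] by simp
qed simp

text \<open>A convergent sequence in \<open>V\<close> eventually stays in one translate of the unit
  ball of \<open>V\<close>. Applied to the steps of the flag in
  \<open>integral_basis_flag\<close>.\<close>

lemma closed_if_unit_ball_compact:
  assumes c: "compact {y \<in> V. pnorm y \<le> 1}"
    and V: "\<And>x y :: 'a. x \<in> V \<Longrightarrow> y \<in> V \<Longrightarrow> x - y \<in> V" "\<And>x y. x \<in> V \<Longrightarrow> y \<in> V \<Longrightarrow> x + y \<in> V"
  shows "closed V"
proof (unfold closed_sequential_limits, intro allI impI, elim conjE)
  fix f and l :: 'a assume f: "\<forall>n. f n \<in> V" "f \<longlonglongrightarrow> l"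
  then have "(\<lambda>n. dist (f n) l) \<longlonglongrightarrow> 0"
    by (simp add: tendsto_dist_iff[of f])
  then have "\<forall>\<^sub>F n in sequentially. dist (f n) l < 1"
    by (rule order_tendstoD(2)) simp
  then obtain N where N: "\<And>n. n \<ge> N \<Longrightarrow> pnorm (f n - l) \<le> 1"
    by (force simp: eventually_sequentially dist_eq)
  have "- f N + f (n + N) \<in> {y \<in> V. pnorm y \<le> 1}" for n
    using f N[of N] N[of "n + N"] pnorm_sub_le[of "f (n + N) - l" 1 "f N - l"] V(1)[of "f (n + N)" "f N"]
    by auto
  moreover have "(\<lambda>n. - f N + f (n + N)) \<longlonglongrightarrow> - f N + l"
    by (intro tendsto_vf_add tendsto_const LIMSEQ_ignore_initial_segment f)
  ultimately have "- f N + l \<in> {y \<in> V. pnorm y \<le> 1}"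
    using compact_imp_closed[OF c] unfolding closed_sequential_limits by (metis (no_types, lifting))
  then show "l \<in> V"
    using V(2)[of "- f N + l" "f N"] f by simp
qed

end

section \<open>Integral bases and scaling of Haar measure\<close>

context local_field
begin

text \<open>Boundedness alone gives a maximum because values are discrete: after scaling by
  \<open>unif ^ N\<close> the nonzero values are powers of \<open>pnorm unif\<close> with natural
  exponents, and the least exponent is the largest value.\<close>

lemma max_norm_exists:
  assumes "S \<subseteq> L" "y \<in> S" "y \<noteq> 0" "\<And>z. z \<in> S \<Longrightarrow> pnorm z \<le> B"
  shows "\<exists>m\<in>S. m \<noteq> 0 \<and> (\<forall>z\<in>S. pnorm z \<le> pnorm m)"
proof -
  have B: "0 < B"
    using assms(4)[OF assms(2)] assms(3) pnorm_pos_iff[of y] by linarith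
  then obtain N where N: "pnorm unif ^ N < 1 / B"
    using unif_power_small[of "1 / B"] by auto
  have ex: "\<exists>j. pnorm (unif ^ N * z) = pnorm unif ^ j" if z: "z \<in> S" "z \<noteq> 0" for z
  proof (rule pnorm_int_cases)
    show "unif ^ N * z \<in> L" "unif ^ N * z \<noteq> 0"
      using z assms(1) unif by (auto intro: mult_L power_L)
    have "pnorm (unif ^ N * z) \<le> (1 / B) * B"
      unfolding pnorm_mult pnorm_power using N B assms(4)[OF z(1)] by (intro mult_mono) auto
    then show "pnorm (unif ^ N * z) \<le> 1"
      using B by simp
  qed
  define P where "P j \<longleftrightarrow> (\<exists>z\<in>S. z \<noteq> 0 \<and> pnorm (unif ^ N * z) = pnorm unif ^ j)" for j
  define j where "j = (LEAST j. P j)"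
  have "\<exists>j. P j"
    using ex[OF assms(2,3)] assms(2,3) by (auto simp: P_def)
  then have "P j"
    unfolding j_def by (metis LeastI)
  then obtain m where m: "m \<in> S" "m \<noteq> 0" "pnorm (unif ^ N * m) = pnorm unif ^ j"
    by (auto simp: P_def)
  have "pnorm z \<le> pnorm m" if z: "z \<in> S" for z
  proof (cases "z = 0")
    case False
    then obtain i where i: "pnorm (unif ^ N * z) = pnorm unif ^ i"
      using ex[OF z] by blast
    then have "P i"
      using z False by (auto simp: P_def)
    then have "j \<le> i"
      unfolding j_def by (rule Least_le)
    then have "pnorm unif ^ i \<le> pnorm unif ^ j"
      using unif(2,3) by (intro power_decreasing) auto
    then have "pnorm unif ^ N * pnorm z \<le> pnorm unif ^ N * pnorm m"
      using i m(3) by (simp add: pnorm_mult pnorm_power)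
    then show ?thesis
      using unif(2) by simp
  qed simp
  then show ?thesis
    using m by blast
qed

text \<open>The integral basis is built in triangular form along the flag spanned by a basis of
  the vector space. The unit ball of each step is compact, so the step is closed and the next
  coordinate of an integral vector is bounded; a vector whose last coordinate has maximal
  absolute value extends the integral basis.\<close>

lemma integral_basis_flag:
  assumes indep: "\<And>c. (\<And>i. i < r \<Longrightarrow> c i \<in> L) \<Longrightarrow> (\<Sum>i<r. c i * b i) = 0 \<Longrightarrow> (\<forall>i<r. c i = 0)"
    and "k \<le> r"
  shows "\<exists>v. (\<forall>i<k. v i \<in> lincomb_set L k b) \<and>
    {y \<in> lincomb_set L k b. pnorm y \<le> 1} = lincomb_set \<O> k v \<and>
    (\<forall>c. (\<forall>i<k. c i \<in> L) \<longrightarrow> (\<Sum>i<k. c i * v i) = 0 \<longrightarrow> (\<forall>i<k. c i = 0))"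
  using \<open>k \<le> r\<close>
proof (induction k)
  case 0
  show ?case by auto
next
  case (Suc k)
  then obtain v where v: "\<And>i. i < k \<Longrightarrow> v i \<in> lincomb_set L k b"
    "{y \<in> lincomb_set L k b. pnorm y \<le> 1} = lincomb_set \<O> k v"
    "\<And>c. (\<And>i. i < k \<Longrightarrow> c i \<in> L) \<Longrightarrow> (\<Sum>i<k. c i * v i) = 0 \<Longrightarrow> (\<forall>i<k. c i = 0)"
    by auto
  let ?V = "lincomb_set L k b"
  note addV = lincomb_set_add_L and multV = lincomb_set_mult_L
  have zeroV: "0 \<in> ?V"
    using lincomb_setI[of k "\<lambda>_. 0" L b] by simp
  have sumV: "(\<Sum>i<k. c i * v i) \<in> ?V" if "\<And>i. i < k \<Longrightarrow> c i \<in> L" for c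
  proof -
    have "(\<Sum>i\<in>I. c i * v i) \<in> ?V" if "I \<subseteq> {..<k}" for I
      using finite_subset[OF that finite_lessThan] that
    proof (induction I)
      case (insert i I)
      then show ?case
        using addV[OF multV[of "c i" "v i" k b]] v(1) \<open>\<And>i. i < k \<Longrightarrow> c i \<in> L\<close> by simp
    qed (simp add: zeroV)
    then show ?thesis by blast
  qed
  have clV: "closed ?V"
  proof (rule closed_if_unit_ball_compact)
    show "compact {y \<in> ?V. pnorm y \<le> 1}"
      unfolding v(2) by (rule compact_lincomb_set[OF compact_O])
  qed (auto intro: lincomb_set_diff_L addV)
  have bk: "b k \<notin> ?V"
  proof
    assume "b k \<in> ?V"
    then obtain c where c: "b k = (\<Sum>i<k. c i * b i)" "\<forall>i<k. c i \<in> L"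
      by (auto simp: lincomb_set_def)
    let ?c = "\<lambda>i. if i < k then c i else if i = k then -1 else 0"
    have "\<forall>i<r. ?c i = 0"
    proof (rule indep)
      show "?c i \<in> L" if "i < r" for i
        using c by (auto simp: minus_L)
      have "(\<Sum>i<r. ?c i * b i) = (\<Sum>i<Suc k. ?c i * b i)"
        using Suc.prems by (intro sum.mono_neutral_right) auto
      also have "\<dots> = (\<Sum>i<k. c i * b i) - b k"
        by simp
      finally show "(\<Sum>i<r. ?c i * b i) = 0"
        using c by simp
    qed
    then have "?c k = 0"
      using Suc.prems by (simp only: Suc_le_eq)
    then show False
      by simp
  qed
  then obtain \<delta> where \<delta>: "0 < \<delta>" "ball (b k) \<delta> \<subseteq> - ?V"
    using clV by (metis ComplI open_Compl open_contains_ball)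
  have far: "\<delta> \<le> pnorm (b k - u)" if "u \<in> ?V" for u
  proof (rule ccontr)
    assume "\<not> \<delta> \<le> pnorm (b k - u)"
    then have "u \<in> ball (b k) \<delta>"
      by (simp add: dist_eq)
    then show False
      using \<delta>(2) that by blast
  qed
  let ?C = "{c \<in> L. \<exists>u\<in>?V. pnorm (u + c * b k) \<le> 1}"
  have bound: "pnorm c \<le> 1 / \<delta>" if c: "c \<in> ?C" for c
  proof (cases "c = 0")
    case False
    obtain u where u: "u \<in> ?V" "pnorm (u + c * b k) \<le> 1" "c \<in> L"
      using c by blast
    have "- (1 / c) * u \<in> ?V"
      using u by (intro multV) (auto intro!: minus_L divide_L)
    from far[OF this] have "\<delta> * pnorm c \<le> pnorm (b k - (- (1 / c) * u)) * pnorm c"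
      by (intro mult_right_mono) auto
    also have "\<dots> = pnorm (u + c * b k)"
      unfolding pnorm_mult[symmetric] using False by (simp add: algebra_simps)
    finally show ?thesis
      using u(2) \<delta>(1) by (simp add: field_simps)
  qed (use \<delta> in simp)
  have "b k \<noteq> 0"
    using bk zeroV by auto
  then obtain N where "pnorm unif ^ N < 1 / pnorm (b k)"
    using unif_power_small[of "1 / pnorm (b k)"] by auto
  then have "pnorm (0 + unif ^ N * b k) \<le> 1"
    using \<open>b k \<noteq> 0\<close> by (simp add: pnorm_mult pnorm_power field_simps)
  then have "unif ^ N \<in> ?C"
    using zeroV unif(1) power_L by blast
  then have "\<exists>c0\<in>?C. c0 \<noteq> 0 \<and> (\<forall>c\<in>?C. pnorm c \<le> pnorm c0)"
    by (rule max_norm_exists[rotated]) (use bound in auto)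
  then obtain c0 u0 where c0: "c0 \<in> L" "c0 \<noteq> 0" "u0 \<in> ?V" "pnorm (u0 + c0 * b k) \<le> 1"
    "\<And>c. c \<in> ?C \<Longrightarrow> pnorm c \<le> pnorm c0"
    by blast
  define w where "w = u0 + c0 * b k"
  let ?v = "v(k := w)"
  have wV: "w \<in> lincomb_set L (Suc k) b"
    unfolding lincomb_set_Suc w_def using c0 by blast
  have sub: "?V \<subseteq> lincomb_set L (Suc k) b"
    unfolding lincomb_set_Suc
  proof
    fix u assume "u \<in> ?V"
    then have "u + 0 * b k \<in> {u + c * b k |u c. u \<in> ?V \<and> c \<in> L}"
      using zero_L by blast
    then show "u \<in> {u + c * b k |u c. u \<in> ?V \<and> c \<in> L}"
      by simp
  qed
  have lc: "lincomb_set \<O> (Suc k) ?v = {u + c * w | u c. u \<in> lincomb_set \<O> k v \<and> c \<in> \<O>}"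
    unfolding lincomb_set_Suc using lincomb_set_cong[of k ?v v \<O>] by simp
  show ?case
  proof (intro exI[of _ ?v] conjI allI impI equalityI subsetI)
    show "?v i \<in> lincomb_set L (Suc k) b" if "i < Suc k" for i
      using that v(1) wV sub by (auto simp: less_Suc_eq)
  next
    fix y assume "y \<in> {y \<in> lincomb_set L (Suc k) b. pnorm y \<le> 1}"
    then obtain u c where y: "y = u + c * b k" "u \<in> ?V" "c \<in> L" "pnorm y \<le> 1"
      unfolding lincomb_set_Suc by auto
    then have "c \<in> ?C"
      by blast
    then have a: "c / c0 \<in> \<O>"
      using c0 y(3) by (auto simp: int_ring_iff divide_L pnorm_divide)
    have "y - c / c0 * w = u - c / c0 * u0"
      using c0(2) by (simp add: y(1) w_def algebra_simps)
    moreover have "u - c / c0 * u0 \<in> ?V"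
      using y c0 by (intro lincomb_set_diff_L multV divide_L)
    moreover have "pnorm (y - c / c0 * w) \<le> 1"
      using a c0(4) y(4) pnorm_mult[of "c / c0" w]
      by (intro pnorm_sub_le) (auto simp: w_def int_ring_iff simp del: times_divide_eq_left intro: mult_le_one)
    ultimately have "y - c / c0 * w \<in> lincomb_set \<O> k v"
      using v(2) by auto
    moreover have "y = (y - c / c0 * w) + c / c0 * w"
      by simp
    ultimately show "y \<in> lincomb_set \<O> (Suc k) ?v"
      unfolding lc using a by blast
  next
    fix y assume "y \<in> lincomb_set \<O> (Suc k) ?v"
    then obtain u c where y: "y = u + c * w" "u \<in> lincomb_set \<O> k v" "c \<in> \<O>"
      unfolding lc by auto
    then have u: "u \<in> ?V" "pnorm u \<le> 1"
      using v(2) by auto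
    have "u + c * w \<in> lincomb_set L (Suc k) b"
      using sub u(1) wV y(3) int_ring_L lincomb_set_add_L lincomb_set_mult_L by blast
    moreover have "pnorm (u + c * w) \<le> 1"
      using u(2) y(3) c0(4) by (intro pnorm_add_le) (auto simp: pnorm_mult w_def int_ring_iff intro: mult_le_one)
    ultimately show "y \<in> {y \<in> lincomb_set L (Suc k) b. pnorm y \<le> 1}"
      using y by simp
  next
    fix c i assume c: "\<forall>i<Suc k. c i \<in> L" and eq: "(\<Sum>i<Suc k. c i * ?v i) = 0" and i: "i < Suc k"
    have "(\<Sum>i<Suc k. c i * ?v i) = (\<Sum>i<k. c i * v i) + c k * w"
      by simp
    then have eq': "(\<Sum>i<k. c i * v i) + c k * w = 0"
      using eq by simp
    have ck: "c k = 0"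
    proof (rule ccontr)
      assume "c k \<noteq> 0"
      then have "b k = - (1 / (c k * c0)) * ((\<Sum>i<k. c i * v i) + c k * u0)"
        using eq' c0(2) by (simp add: w_def field_simps) (simp add: algebra_simps eq_neg_iff_add_eq_0)
      also have "\<dots> \<in> ?V"
        using c c0 by (intro multV addV sumV) (auto intro!: minus_L divide_L mult_L)
      finally show False
        using bk by simp
    qed
    then have "(\<Sum>i<k. c i * v i) = 0"
      using eq' by simp
    then have "\<forall>i<k. c i = 0"
      using c by (intro v(3)) auto
    then show "c i = 0"
      using ck i by (cases "i = k") auto
  qed
qed

text \<open>Multiplication by \<open>a\<close> carries balls of level \<open>j\<close> to balls of
  level \<open>k + j\<close>, so the formula holds on balls; both sides are measures in
  \<open>A\<close>, hence it holds everywhere.\<close>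

lemma haar_scale_int:
  assumes a: "a \<in> L" "pnorm a = pnorm unif ^ k" and A: "A \<in> sets (haar L)"
  shows "(*) a ` A \<in> sets (haar L)" "emeasure (haar L) ((*) a ` A) = ennreal (1 / real resq ^ k) * emeasure (haar L) A"
proof -
  have a0: "a \<noteq> 0"
    using a(2) unif(2) by (metis less_irrefl pnorm_zero zero_less_power)
  have im: "(\<lambda>y. y / a) -` B \<inter> L = (*) a ` B" if "B \<subseteq> L" for B
  proof (intro equalityI subsetI)
    fix y assume "y \<in> (\<lambda>y. y / a) -` B \<inter> L"
    then show "y \<in> (*) a ` B"
      using a0 by (intro image_eqI[of _ _ "y / a"]) auto
  qed (use that a a0 in \<open>auto intro: mult_L\<close>)
  have ball: "(*) a ` pball b j = pball (a * b) (k + j)" if "b \<in> L" for b j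
  proof -
    have "y / a \<in> pball b j \<longleftrightarrow> y \<in> pball (a * b) (k + j)" if "y \<in> L" for y
    proof -
      have "y - a * b = a * (y / a - b)"
        using a0 by (simp add: algebra_simps)
      then have "pnorm (y - a * b) = pnorm unif ^ k * pnorm (y / a - b)"
        using a(2) by (simp add: pnorm_mult)
      then show ?thesis
        using that a(1) unif(2) by (simp add: pball_def divide_L power_add)
    qed
    then show ?thesis
      unfolding im[OF pball_sub_L, symmetric] using pball_sub_L by blast
  qed
  have m: "(\<lambda>y. y / a) \<in> measurable (haar L) (restrict_space borel L)"
    using im[OF pball_sub_L] ball a(1)
    by (intro measurable_into_L) (auto simp: divide_L sets_haar pball_sets mult_L)
  have AL: "A \<subseteq> L"
    using sets.sets_into_space[OF A] by simp
  show "(*) a ` A \<in> sets (haar L)"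
    using measurable_sets[OF m, of A] A by (simp add: im[OF AL] sets_haar)
  let ?N = "distr (haar L) (restrict_space borel L) (\<lambda>y. y / a)"
  have N: "emeasure ?N B = emeasure (haar L) ((*) a ` B)" if "B \<in> sets (haar L)" for B
    using that m sets.sets_into_space[OF that] by (simp add: emeasure_distr sets_haar im)
  have "?N = scale_measure (ennreal (1 / real resq ^ k)) (haar L)"
  proof (rule measure_eqI_pballs)
    fix b j assume b: "b \<in> L"
    have "emeasure ?N (pball b j) = ennreal (1 / real resq ^ (k + j))"
      using N[of "pball b j"] b a(1) by (simp add: ball sets_haar pball_sets emeasure_haar_pball mult_L)
    moreover have "emeasure (scale_measure (ennreal (1 / real resq ^ k)) (haar L)) (pball b j) =
        ennreal (1 / real resq ^ (k + j))"
      using b by (simp add: emeasure_haar_pball power_add ennreal_mult[symmetric])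
    ultimately show "emeasure ?N (pball b j) = emeasure (scale_measure (ennreal (1 / real resq ^ k)) (haar L)) (pball b j)"
      "emeasure ?N (pball b j) \<noteq> \<infinity>"
      by simp_all
  qed (auto simp: sets_haar)
  then show "emeasure (haar L) ((*) a ` A) = ennreal (1 / real resq ^ k) * emeasure (haar L) A"
    using N[OF A] by simp
qed

end

lemma ext_degree_pos:
  fixes F :: "'a::field_char_0 set"
  assumes "finite_extension F K"
  shows "0 < ext_degree F K"
proof (rule ccontr)
  assume "\<not> 0 < ext_degree F K"
  moreover obtain b where "is_basis F K (ext_degree F K) b"
    using finite_extension_basis[OF assms] .
  moreover have "1 \<in> K"
    using assms by (simp add: finite_extension_def is_subfield_def)
  ultimately show False
    using is_basis_coeffs[of F K "ext_degree F K" b 1] by auto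
qed

section \<open>Monic equations with integral coefficients\<close>

context valued_field
begin

lemma pnorm_le_1_if_monic:
  fixes y :: 'a
  assumes c: "\<And>i. i < n \<Longrightarrow> pnorm (c i) \<le> 1" and eq: "y ^ n = (\<Sum>i<n. c i * y ^ i)"
  shows "pnorm y \<le> 1"
proof (rule ccontr)
  assume "\<not> pnorm y \<le> 1"
  then have y: "1 < pnorm y" by simp
  have n: "n \<noteq> 0"
    using eq by (cases n) auto
  have "pnorm (\<Sum>i<n. c i * y ^ i) \<le> pnorm y ^ (n - 1)"
  proof (rule pnorm_sum_le)
    fix i assume "i \<in> {..<n}"
    then have "pnorm (c i) * pnorm y ^ i \<le> 1 * pnorm y ^ (n - 1)"
      using c y by (intro mult_mono power_increasing) auto
    then show "pnorm (c i * y ^ i) \<le> pnorm y ^ (n - 1)"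
      by (simp add: pnorm_mult pnorm_power)
  qed (use y in simp)
  also have "\<dots> < pnorm y ^ n"
    using y n by (intro power_strict_increasing) auto
  finally show False
    using eq by (metis less_irrefl pnorm_power)
qed

lemma coeffs_int_mult:
  "range (coeff p) \<subseteq> \<O> \<Longrightarrow> range (coeff q) \<subseteq> \<O> \<Longrightarrow> range (coeff (p * q)) \<subseteq> \<O>"
  by (auto simp: coeff_mult intro!: sum_int mult_int)

text \<open>By the Leibniz formula the characteristic polynomial is a signed sum of products of
  polynomials with integral coefficients.\<close>

lemma coeffs_int_char_poly:
  assumes A: "A \<in> carrier_mat n n" "\<And>i j. i < n \<Longrightarrow> j < n \<Longrightarrow> A $$ (i, j) \<in> \<O>"
  shows "coeff (char_poly A) k \<in> \<O>"
proof -
  let ?C = "char_poly_matrix A"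
  have C: "?C \<in> carrier_mat n n"
    using A by simp
  have entry: "range (coeff (?C $$ (i, j))) \<subseteq> \<O>" if "i < n" "j < n" for i j
    using A that unfolding char_poly_matrix_def
    by (auto simp: coeff_pCons minus_int split: nat.split intro!: add_int)
  have prod: "range (coeff (prod f I)) \<subseteq> \<O>" if "\<And>i. i \<in> I \<Longrightarrow> range (coeff (f i)) \<subseteq> \<O>" for f and I :: "nat set"
    using that
  proof (induction I rule: infinite_finite_induct)
    case (insert i I)
    then show ?case
      using coeffs_int_mult[of "f i" "prod f I"] by simp
  qed (auto simp: coeff_1)
  have summand: "coeff (signof p * (\<Prod>i = 0..<n. ?C $$ (i, p i))) k \<in> \<O>" if "p permutes {0..<n}" for p
  proof -
    have "range (coeff (\<Prod>i = 0..<n. ?C $$ (i, p i))) \<subseteq> \<O>"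
    proof (rule prod)
      fix i assume "i \<in> {0..<n}"
      then show "range (coeff (?C $$ (i, p i))) \<subseteq> \<O>"
        using permutes_in_image[OF that, of i] by (intro entry) auto
    qed
    then have "coeff (\<Prod>i = 0..<n. ?C $$ (i, p i)) k \<in> \<O>"
      by blast
    then show ?thesis
      by (cases p rule: sign_cases) (simp_all add: minus_int)
  qed
  have "coeff (char_poly A) k =
      (\<Sum>p | p permutes {0..<n}. coeff (signof p * (\<Prod>i = 0..<n. ?C $$ (i, p i))) k)"
    unfolding char_poly_def det_def'[OF C] by (simp add: coeff_sum)
  also have "\<dots> \<in> \<O>"
    using summand by (intro sum_int) auto
  finally show ?thesis .
qed

end

section \<open>Finite extensions of a local field\<close>

locale local_ext = F: local_field F for F :: "'a::{field_char_0, metric_space} set" +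
  fixes K :: "'a set"
  assumes ext: "finite_extension F K"
begin

sublocale K: valued_field K
  by unfold_locales
    (use ext F.dist_eq F.pnorm_mult F.pnorm_ultrametric in \<open>auto simp: finite_extension_def\<close>)

lemma F_K: "y \<in> F \<Longrightarrow> y \<in> K"
  using ext by (auto simp: finite_extension_def)

lemma FO_KO: "y \<in> F.\<O> \<Longrightarrow> y \<in> K.\<O>"
  using F_K by (auto simp: F.int_ring_iff K.int_ring_iff)

definition deg :: nat where "deg = ext_degree F K"

lemma deg_pos: "0 < deg"
  unfolding deg_def by (rule ext_degree_pos[OF ext])

lemma basis_length: "is_basis F K s b \<Longrightarrow> s = deg"
  using ext_degree_eq[OF F.subfield, of K s b] by (simp add: deg_def)

text \<open>The last step of the flag. One family serves as basis of \<open>K\<close> over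
  \<open>F\<close> and of the rings of integers: any \<open>y\<close> in \<open>K\<close> is scaled
  into the unit ball by a power of \<open>F.unif\<close>, expanded there, and the coordinates are
  divided back.\<close>

lemma integral_basis_exists:
  "\<exists>v. is_basis F K deg v \<and> is_basis F.\<O> K.\<O> deg v \<and> K.\<O> = lincomb_set F.\<O> deg v"
proof -
  obtain b where b: "is_basis F K deg b"
    using finite_extension_basis[OF ext] unfolding deg_def .
  have V: "lincomb_set F deg b = K"
    using is_basis_comb[OF b] is_basis_coeffs[OF b] unfolding lincomb_set_def by blast
  have indep: "\<forall>i<deg. c i = 0" if "\<And>i. i < deg \<Longrightarrow> c i \<in> F" "(\<Sum>i<deg. c i * b i) = 0" for c
  proof (intro allI impI)
    fix i assume "i < deg"
    with is_basis_unique[OF b, of c "\<lambda>_. 0" i] that show "c i = 0"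
      by simp
  qed
  have "\<exists>v. (\<forall>i<deg. v i \<in> lincomb_set F deg b) \<and>
    {y \<in> lincomb_set F deg b. pnorm y \<le> 1} = lincomb_set F.\<O> deg v \<and>
    (\<forall>c. (\<forall>i<deg. c i \<in> F) \<longrightarrow> (\<Sum>i<deg. c i * v i) = 0 \<longrightarrow> (\<forall>i<deg. c i = 0))"
    by (rule F.integral_basis_flag[where r = deg]) (use indep in auto)
  then obtain v where v: "\<forall>i<deg. v i \<in> K" "{y \<in> K. pnorm y \<le> 1} = lincomb_set F.\<O> deg v"
    "\<forall>c. (\<forall>i<deg. c i \<in> F) \<longrightarrow> (\<Sum>i<deg. c i * v i) = 0 \<longrightarrow> (\<forall>i<deg. c i = 0)"
    unfolding V by (elim exE conjE) (rule that)
  have O: "K.\<O> = lincomb_set F.\<O> deg v"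
    unfolding v(2)[symmetric] by (auto simp: K.int_ring_iff)
  have "is_basis F K deg v"
  proof (rule is_basisI)
    fix c assume "\<And>i. i < deg \<Longrightarrow> c i \<in> F"
    then show "(\<Sum>i<deg. c i * v i) \<in> K"
      using v(1) by (auto intro!: K.sum_L K.mult_L intro: F_K)
  next
    fix y assume y: "y \<in> K"
    have "\<exists>k. pnorm (F.unif ^ k * y) \<le> 1"
    proof (cases "y = 0")
      case False
      then obtain k where "pnorm F.unif ^ k < 1 / pnorm y"
        using F.unif_power_small[of "1 / pnorm y"] by auto
      then show ?thesis
        using False by (intro exI[of _ k]) (simp add: F.pnorm_mult F.pnorm_power field_simps)
    qed simp
    then obtain k where "pnorm (F.unif ^ k * y) \<le> 1" ..
    then have "F.unif ^ k * y \<in> K.\<O>"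
      using y F.unif(1) by (auto simp: K.int_ring_iff intro!: K.mult_L K.power_L intro: F_K)
    then obtain c where c: "F.unif ^ k * y = (\<Sum>i<deg. c i * v i)" "\<forall>i<deg. c i \<in> F.\<O>"
      unfolding O lincomb_set_def by auto
    show "\<exists>c. (\<forall>i<deg. c i \<in> F) \<and> y = (\<Sum>i<deg. c i * v i)"
    proof (intro exI[of _ "\<lambda>i. c i / F.unif ^ k"] conjI allI impI)
      show "y = (\<Sum>i<deg. c i / F.unif ^ k * v i)"
        using c(1) by (simp add: sum_divide_distrib[symmetric] field_simps)
    qed (use c F.unif(1) in \<open>auto intro!: F.divide_L F.power_L intro: F.int_ring_L\<close>)
  qed (use v(3) F.diff_L in auto)
  moreover have "is_basis F.\<O> K.\<O> deg v"
  proof (rule is_basisI)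
    fix c :: "nat \<Rightarrow> 'a" assume "\<And>i. i < deg \<Longrightarrow> c i \<in> F.\<O>" "(\<Sum>i<deg. c i * v i) = 0"
    then show "\<forall>i<deg. c i = 0"
      using v(3) F.int_ring_L by blast
  qed (auto simp: O lincomb_set_def intro: F.diff_int)
  ultimately show ?thesis
    using O by blast
qed

definition ibasis :: "nat \<Rightarrow> 'a" where
  "ibasis = (SOME v. is_basis F K deg v \<and> is_basis F.\<O> K.\<O> deg v \<and> K.\<O> = lincomb_set F.\<O> deg v)"

lemma ibasis: "is_basis F K deg ibasis" "is_basis F.\<O> K.\<O> deg ibasis"
    "K.\<O> = lincomb_set F.\<O> deg ibasis"
  using someI_ex[OF integral_basis_exists] unfolding ibasis_def[symmetric] by blast+

lemma ibasis_int:
  assumes "i < deg" shows "ibasis i \<in> K.\<O>"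
proof -
  have "(\<Sum>j<deg. (if j = i then 1 else 0) * ibasis j) \<in> K.\<O>"
    by (intro is_basis_comb[OF ibasis(2)]) auto
  then show ?thesis
    using assms by (simp add: if_distrib[of "\<lambda>x. x * _"] cong: if_cong)
qed

text \<open>The ring of integers of \<open>K\<close> consists of the combinations of an integral
  basis with coefficients in a compact set, hence it is compact.\<close>

sublocale K: local_field K
proof
  show "compact (int_ring K)"
    using F.compact_lincomb_set[OF F.compact_O] by (simp add: ibasis(3) flip: K.\<O>_def)
  show "\<exists>y\<in>K. 0 < pnorm y \<and> pnorm y < 1"
    using F.unif F_K by blast
qed

lemma ramification_exists: "\<exists>e. pnorm F.unif = pnorm K.unif ^ e"
  using K.pnorm_int_cases[of F.unif] F.unif F_K by force

definition ram :: nat where "ram = (SOME e. pnorm F.unif = pnorm K.unif ^ e)"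

lemma ram: "pnorm F.unif = pnorm K.unif ^ ram"
  using someI_ex[OF ramification_exists] by (simp add: ram_def)

lemma ram_pos: "0 < ram"
  using ram F.unif(3) by (cases "ram = 0") auto

text \<open>Both sides count \<open>\<O>\<^sub>K / unif \<O>\<^sub>K\<close>, for the uniformizer of \<open>F\<close>: the left-hand side with
  balls of \<open>K\<close>, the right-hand side with coordinates in an integral basis.\<close>

lemma resq_power: "K.resq ^ ram = F.resq ^ deg"
proof -
  let ?D = "{..<deg} \<rightarrow>\<^sub>E {..<F.resq}"
  let ?a = "\<lambda>d. \<Sum>i<deg. F.digit (d i) * ibasis i"
  have dO: "F.digit (d i) \<in> F.\<O>" if "d \<in> ?D" "i < deg" for d i
    using that by (intro F.digit(2)) auto
  have aO: "?a d \<in> K.\<O>" if "d \<in> ?D" for d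
    using dO[OF that] by (intro is_basis_comb[OF ibasis(2)])
  have "disjoint_family_on (\<lambda>d. K.pball (?a d) ram) ?D"
  proof (unfold disjoint_family_on_def, intro ballI impI, rule ccontr)
    fix d d' assume d: "d \<in> ?D" "d' \<in> ?D" "d \<noteq> d'" "K.pball (?a d) ram \<inter> K.pball (?a d') ram \<noteq> {}"
    from d(4) obtain y where "y \<in> K.pball (?a d) ram \<inter> K.pball (?a d') ram"
      by (metis ex_in_conv)
    then have "pnorm (y - ?a d) \<le> pnorm F.unif" "pnorm (y - ?a d') \<le> pnorm F.unif"
      by (simp_all add: K.pball_def ram)
    then have *: "pnorm (?a d - ?a d') \<le> pnorm F.unif"
      using F.pnorm_triangle_le[of "?a d" y "pnorm F.unif" "?a d'"] F.pnorm_diff_commute[of "?a d" y] by simp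
    have "(?a d - ?a d') / F.unif \<in> K.\<O>"
    proof -
      have "?a d - ?a d' \<in> K"
        by (intro K.diff_L K.int_ring_L aO d)
      then show ?thesis
        using * F.unif F_K by (auto simp: K.int_ring_iff K.divide_L F.pnorm_divide)
    qed
    then obtain c where c: "\<And>i. i < deg \<Longrightarrow> c i \<in> F.\<O>" "(?a d - ?a d') / F.unif = (\<Sum>i<deg. c i * ibasis i)"
      by (rule is_basis_coeffs[OF ibasis(2)]) (rule that)
    have "?a d - ?a d' = F.unif * (\<Sum>i<deg. c i * ibasis i)"
      using c(2) by (simp add: field_simps)
    then have eq: "(\<Sum>i<deg. (F.digit (d i) - F.digit (d' i)) * ibasis i) = (\<Sum>i<deg. (F.unif * c i) * ibasis i)"
      by (simp add: sum_distrib_left left_diff_distrib sum_subtractf mult.assoc)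
    have "d i = d' i" if i: "i < deg" for i
    proof -
      have "F.digit (d i) - F.digit (d' i) = F.unif * c i"
        by (rule is_basis_unique[OF ibasis(2) _ _ eq i])
          (use dO d c F.unif_int in \<open>auto intro: F.diff_int F.mult_int\<close>)
      then have "pnorm (F.digit (d i) - F.digit (d' i)) \<le> pnorm F.unif"
        using c(1)[OF i] F.unif(2) by (simp add: F.pnorm_mult F.int_ring_iff mult_left_le)
      moreover have "pnorm (F.digit (d i) - F.digit (d i)) \<le> pnorm F.unif"
        by simp
      moreover have "d i < F.resq" "d' i < F.resq"
        using d i by auto
      ultimately show ?thesis
        using F.digit(3)[OF dO[OF d(1) i]] by blast
    qed
    then have "d = d'"
      using d by (intro PiE_ext) auto
    then show False
      using d by simp
  qed
  moreover have "(\<Union>d\<in>?D. K.pball (?a d) ram) = K.\<O>"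
  proof (intro equalityI subsetI)
    fix y assume "y \<in> (\<Union>d\<in>?D. K.pball (?a d) ram)"
    then obtain d where d: "d \<in> ?D" "y \<in> K.pball (?a d) ram"
      by blast
    have "pnorm K.unif ^ ram \<le> 1"
      using ram F.unif(3) by simp
    then show "y \<in> K.\<O>"
      using d aO[OF d(1)] F.pnorm_add_le[of "y - ?a d" 1 "?a d"] by (auto simp: K.pball_def K.int_ring_iff)
  next
    fix y assume "y \<in> K.\<O>"
    then obtain c where c: "\<And>i. i < deg \<Longrightarrow> c i \<in> F.\<O>" "y = (\<Sum>i<deg. c i * ibasis i)"
      by (rule is_basis_coeffs[OF ibasis(2)]) (rule that)
    have "\<forall>i\<in>{..<deg}. \<exists>d. d < F.resq \<and> pnorm (c i - F.digit d) \<le> pnorm F.unif"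
      using F.digit(3) c(1) by blast
    then obtain d where d: "\<And>i. i < deg \<Longrightarrow> d i < F.resq" "\<And>i. i < deg \<Longrightarrow> pnorm (c i - F.digit (d i)) \<le> pnorm F.unif"
      by (metis lessThan_iff)
    define d' where "d' = restrict d {..<deg}"
    have d': "d' \<in> ?D" "?a d' = ?a d"
      using d(1) by (auto simp: d'_def)
    have "y - ?a d' = (\<Sum>i<deg. (c i - F.digit (d i)) * ibasis i)"
      unfolding d' by (simp add: c(2) left_diff_distrib sum_subtractf)
    also have "pnorm \<dots> \<le> pnorm F.unif"
    proof (rule F.pnorm_sum_le)
      fix i assume "i \<in> {..<deg}"
      then show "pnorm ((c i - F.digit (d i)) * ibasis i) \<le> pnorm F.unif"
        using d(2)[of i] ibasis_int[of i] mult_mono[of "pnorm (c i - F.digit (d i))" "pnorm F.unif" "pnorm (ibasis i)" 1]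
        by (simp add: F.pnorm_mult K.int_ring_iff)
    qed simp
    finally have "y \<in> K.pball (?a d') ram"
      using \<open>y \<in> K.\<O>\<close> by (simp add: K.pball_def ram K.int_ring_iff)
    then show "y \<in> (\<Union>d\<in>?D. K.pball (?a d) ram)"
      using d' by blast
  qed
  moreover have fin: "finite ?D"
    by (intro finite_PiE) auto
  ultimately have "(\<Sum>d\<in>?D. emeasure (haar K) (K.pball (?a d) ram)) = emeasure (haar K) K.\<O>"
    using aO K.pball_sets K.int_ring_L by (subst sum_emeasure) (auto simp: K.sets_haar)
  moreover have "(\<Sum>d\<in>?D. emeasure (haar K) (K.pball (?a d) ram)) = (\<Sum>d\<in>?D. ennreal (1 / real K.resq ^ ram))"
    using aO K.int_ring_L by (intro sum.cong refl K.emeasure_haar_pball) blast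
  moreover have "(\<Sum>d\<in>?D. ennreal (1 / real K.resq ^ ram)) = ennreal (real (card ?D) * (1 / real K.resq ^ ram))"
    by (simp only: sum_constant ennreal_of_nat_eq_real_of_nat ennreal_mult' of_nat_0_le_iff)
  ultimately have "ennreal (real (card ?D) * (1 / real K.resq ^ ram)) = 1"
    using K.emeasure_haar_O by metis
  then have "real (card ?D) * (1 / real K.resq ^ ram) = 1"
    by (simp only: ennreal_eq_1)
  then have "real (F.resq ^ deg) = real (K.resq ^ ram)"
    using K.resq_ge_2 by (simp add: card_PiE field_simps)
  then show ?thesis
    using of_nat_eq_iff by metis
qed

text \<open>\<open>x\<close> is an eigenvalue of the matrix of multiplication by \<open>x\<close> in
  the integral basis, the basis itself being the eigenvector. The characteristic polynomial of that
  matrix is monic of degree exactly \<open>deg\<close> with coefficients in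
  \<open>F.\<O>\<close>.\<close>

lemma integral_equation:
  assumes x: "x \<in> K.\<O>"
  shows "\<exists>c. (\<forall>i<deg. c i \<in> F.\<O>) \<and> x ^ deg = (\<Sum>i<deg. c i * x ^ i)"
proof -
  have "\<exists>c. (\<forall>i<deg. c i \<in> F.\<O>) \<and> x * ibasis j = (\<Sum>i<deg. c i * ibasis i)" if "j < deg" for j
    using is_basis_coeffs[OF ibasis(2) K.mult_int[OF x ibasis_int[OF that]]] by metis
  then obtain A where A: "\<And>i j. j < deg \<Longrightarrow> i < deg \<Longrightarrow> A j i \<in> F.\<O>"
    "\<And>j. j < deg \<Longrightarrow> x * ibasis j = (\<Sum>i<deg. A j i * ibasis i)"
    by metis
  define M where "M = mat deg deg (\<lambda>(j, i). A j i)"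
  define u where "u = vec deg ibasis"
  have M: "M \<in> carrier_mat deg deg"
    by (simp add: M_def)
  have "u \<noteq> 0\<^sub>v deg"
  proof
    assume u0: "u = 0\<^sub>v deg"
    have z: "ibasis i = 0" if "i < deg" for i
      using arg_cong[OF u0, of "\<lambda>w. w $ i"] that by (simp add: u_def)
    have "(\<Sum>i<deg. 1 * ibasis i) = (\<Sum>i<deg. 0 * ibasis i)"
      by (intro sum.cong) (auto simp: z)
    from is_basis_unique[OF ibasis(1) _ _ this deg_pos] show False
      by simp
  qed
  moreover have "M *\<^sub>v u = x \<cdot>\<^sub>v u"
  proof (rule eq_vecI)
    fix j assume "j < dim_vec (x \<cdot>\<^sub>v u)"
    then have j: "j < deg"
      by (simp add: u_def)
    then show "(M *\<^sub>v u) $ j = (x \<cdot>\<^sub>v u) $ j"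
      by (simp add: M_def u_def scalar_prod_def A(2) atLeast0LessThan)
  qed (simp add: M_def u_def)
  ultimately have "eigenvalue M x"
    unfolding eigenvalue_def eigenvector_def by (intro exI[of _ u]) (simp add: M_def u_def)
  then have root: "poly (char_poly M) x = 0"
    using eigenvalue_root_char_poly[OF M] by simp
  let ?p = "char_poly M"
  have deg: "degree ?p = deg" "coeff ?p deg = 1"
    using degree_monic_char_poly[OF M] by auto
  have "(\<Sum>i\<le>deg. coeff ?p i * x ^ i) = 0"
    using root unfolding poly_altdef deg .
  then have "x ^ deg = (\<Sum>i<deg. - coeff ?p i * x ^ i)"
    using deg(2) by (simp add: lessThan_Suc_atMost[symmetric] sum_negf eq_neg_iff_add_eq_0 add.commute)
  moreover have "- coeff ?p i \<in> F.\<O>" for i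
    by (intro F.minus_int F.coeffs_int_char_poly[OF M]) (auto simp: M_def A(1))
  ultimately show ?thesis
    by (intro exI[of _ "\<lambda>i. - coeff ?p i"]) auto
qed

end

text \<open>With this normalization \<open>pnorm a\<close> is the factor by which multiplication by
  \<open>a\<close> scales Haar measure on \<open>F\<close>, and \<open>pnorm a ^ deg\<close> is the
  factor on \<open>K\<close>.\<close>

locale normalized_ext = local_ext +
  assumes normalized: "pnorm F.unif = 1 / real F.resq"
begin

text \<open>Both sides have the same power with exponent \<open>ram\<close>:
  \<open>pnorm K.unif ^ ram\<close> is \<open>1 / F.resq\<close>, and
  \<open>F.resq ^ deg = K.resq ^ ram\<close>. The root may be taken because \<open>ram\<close> is
  positive.\<close>

lemma normalized_K: "pnorm K.unif ^ deg = 1 / real K.resq"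
proof -
  have "(pnorm K.unif ^ deg) ^ ram = (pnorm K.unif ^ ram) ^ deg"
    by (simp flip: power_mult add: mult.commute)
  also have "\<dots> = 1 / real (F.resq ^ deg)"
    by (simp add: ram[symmetric] normalized power_divide)
  also have "\<dots> = (1 / real K.resq) ^ ram"
    by (simp add: resq_power[symmetric] power_divide)
  finally show ?thesis
    by (rule power_eq_imp_eq_base) (use ram_pos in auto)
qed

lemma haar_scale:
  assumes a: "a \<in> K" "a \<noteq> 0" and A: "A \<in> sets (haar K)"
  shows "(*) a ` A \<in> sets (haar K)"
    "emeasure (haar K) ((*) a ` A) = ennreal (pnorm a ^ deg) * emeasure (haar K) A"
proof -
  have int: "(*) a ` A \<in> sets (haar K) \<and>
      emeasure (haar K) ((*) a ` A) = ennreal (pnorm a ^ deg) * emeasure (haar K) A"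
    if a: "a \<in> K" "a \<noteq> 0" "pnorm a \<le> 1" and A: "A \<in> sets (haar K)" for a A
  proof -
    obtain k where k: "pnorm a = pnorm K.unif ^ k"
      using K.pnorm_int_cases[OF a] ..
    have "pnorm a ^ deg = (pnorm K.unif ^ deg) ^ k"
      unfolding k by (simp flip: power_mult add: mult.commute)
    then show ?thesis
      using K.haar_scale_int[OF a(1) k A] by (simp add: normalized_K power_divide)
  qed
  consider "pnorm a \<le> 1" | "pnorm (inverse a) \<le> 1"
    using F.pnorm_inverse[of a] by (metis inverse_le_1_iff linear)
  then have "(*) a ` A \<in> sets (haar K) \<and>
      emeasure (haar K) ((*) a ` A) = ennreal (pnorm a ^ deg) * emeasure (haar K) A"
  proof cases
    \<comment> \<open>For \<open>pnorm a > 1\<close> the integral case is applied to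
      \<open>inverse a\<close> and the set \<open>a A\<close>, and the factor is moved to the other
      side. Measurability of \<open>a A\<close> has to be shown beforehand.\<close>
    case 2
    let ?k = "\<lambda>a. ennreal (pnorm a ^ deg)"
    obtain k where k: "pnorm (inverse a) = pnorm K.unif ^ k"
      using K.pnorm_int_cases[of "inverse a"] 2 a by (auto simp: K.inverse_L)
    have AK: "A \<subseteq> K"
      using sets.sets_into_space[OF A] by simp
    have im: "(*) a ` A = (\<lambda>y. inverse a * y) -` A \<inter> K"
    proof (intro equalityI subsetI)
      fix y assume "y \<in> (\<lambda>y. inverse a * y) -` A \<inter> K"
      then show "y \<in> (*) a ` A"
        using a(2) by (intro image_eqI[of _ _ "inverse a * y"]) auto
    qed (use AK a in \<open>auto intro: K.mult_L simp flip: mult.assoc\<close>)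
    have "(\<lambda>y. inverse a * y) \<in> measurable (haar K) (restrict_space borel K)"
    proof (rule K.measurable_into_L)
      show "(\<lambda>y. inverse a * y) \<in> space (haar K) \<rightarrow> K"
        using a by (auto intro!: K.mult_L K.inverse_L)
      fix b j assume b: "b \<in> K"
      have "(\<lambda>y. inverse a * y) -` K.pball b j \<inter> space (haar K) = {y. pnorm (y - a * b) \<le> pnorm a * pnorm K.unif ^ j} \<inter> K"
      proof -
        have "inverse a * y \<in> K.pball b j \<longleftrightarrow> pnorm (y - a * b) \<le> pnorm a * pnorm K.unif ^ j" if "y \<in> K" for y
        proof -
          have "y - a * b = a * (inverse a * y - b)"
            using a(2) by (simp add: algebra_simps)
          then have "pnorm (y - a * b) = pnorm a * pnorm (inverse a * y - b)"
            by (simp add: F.pnorm_mult)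
          then show ?thesis
            using that a by (simp add: K.pball_def K.mult_L K.inverse_L)
        qed
        then show ?thesis by auto
      qed
      also have "\<dots> \<in> sets (haar K)"
        using borel_closed[OF F.closed_pnorm_le] borel_closed[OF K.closed_L]
        by (auto simp: K.sets_haar sets_restrict_space_iff)
      finally show "(\<lambda>y. inverse a * y) -` K.pball b j \<inter> space (haar K) \<in> sets (haar K)" .
    qed
    then have S: "(*) a ` A \<in> sets (haar K)"
      using measurable_sets[of "\<lambda>y. inverse a * y" "haar K" "restrict_space borel K" A] A
      by (simp add: im K.sets_haar)
    have "(*) (inverse a) ` (*) a ` A = A"
      using a(2) by (simp add: image_image mult.assoc[symmetric])
    then have "emeasure (haar K) A = ?k (inverse a) * emeasure (haar K) ((*) a ` A)"
      using int[of "inverse a", OF _ _ 2 S] a by (simp add: K.inverse_L)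
    then have "?k a * emeasure (haar K) A = (?k a * ?k (inverse a)) * emeasure (haar K) ((*) a ` A)"
      by (simp add: mult.assoc)
    also have "?k a * ?k (inverse a) = 1"
      using a(2) by (simp add: F.pnorm_inverse ennreal_mult[symmetric] power_inverse)
    finally show ?thesis
      using S by simp
  qed (use int a A in blast)
  then show "(*) a ` A \<in> sets (haar K)"
    "emeasure (haar K) ((*) a ` A) = ennreal (pnorm a ^ deg) * emeasure (haar K) A"
    by auto
qed

end

section \<open>The field of p-adic numbers and the normalization of F\<close>

context padic_setting
begin

sublocale Q: valued_field "closure \<rat> :: 'a set"
  by unfold_locales
    (use dist_eq pnorm_mult pnorm_ultrametric finite_F in \<open>auto simp: finite_extension_def\<close>)

lemma pnorm_p_bounds: "0 < pnorm (of_nat p :: 'a)" "pnorm (of_nat p :: 'a) < 1"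
  using ext_degree_pos[OF finite_F] prime_gt_1_nat[OF prime_p]
  by (auto simp: pnorm_p field_simps intro: one_less_power)

text \<open>In a Bezout relation \<open>u p + w a = 1\<close> the first term has absolute value
  below \<open>1\<close>, so the second cannot; integers having absolute value at most
  \<open>1\<close>, this forces the value \<open>1\<close> for \<open>a\<close>.\<close>

lemma pnorm_of_int_coprime:
  assumes "\<not> int p dvd a" shows "pnorm (of_int a :: 'a) = 1"
proof -
  have "coprime (int p) a"
    using assms prime_p by (intro prime_imp_coprime) auto
  then obtain u w where "u * int p + w * a = 1"
    using bezout_int[of "int p" a] by (auto simp: coprime_iff_gcd_eq_1)
  then have "of_int u * of_nat p + of_int w * of_int a = (1 :: 'a)"
    by (metis of_int_1 of_int_add of_int_mult of_int_of_nat_eq)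
  moreover have "pnorm (of_int u * of_nat p :: 'a) < 1"
  proof -
    have "pnorm (of_int u :: 'a) * pnorm (of_nat p :: 'a) \<le> pnorm (of_nat p :: 'a)"
      using Q.pnorm_of_int_le_1[of u] by (intro mult_left_le_one_le) auto
    then show ?thesis
      using pnorm_p_bounds(2) unfolding pnorm_mult by simp
  qed
  ultimately have "\<not> pnorm (of_int w * of_int a :: 'a) < 1"
    using Q.pnorm_add_less[of "of_int u * of_nat p" 1 "of_int w * of_int a"] by auto
  then have "1 \<le> pnorm (of_int w :: 'a) * pnorm (of_int a :: 'a)"
    by (simp add: pnorm_mult)
  also have "\<dots> \<le> pnorm (of_int a :: 'a)"
    using Q.pnorm_of_int_le_1[of w] by (intro mult_left_le_one_le) auto
  finally show ?thesis
    using Q.pnorm_of_int_le_1[of a] by simp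
qed

text \<open>A rational \<open>s = a / b\<close> close to \<open>y\<close> also has absolute value at
  most \<open>1\<close>, so in lowest terms \<open>b\<close> is prime to \<open>p\<close>; then
  \<open>a / b\<close> is congruent to an integer modulo \<open>p ^ N\<close>.\<close>

lemma approx_by_nat:
  fixes y :: 'a
  assumes y: "y \<in> closure \<rat>" "pnorm y \<le> 1"
  shows "\<exists>m < p ^ N. pnorm (y - of_nat m) \<le> pnorm (of_nat p :: 'a) ^ N"
proof -
  let ?e = "pnorm (of_nat p :: 'a) ^ N"
  have "0 < ?e" "?e \<le> 1"
    using pnorm_p_bounds by (auto intro: power_le_one)
  then obtain s where s: "s \<in> \<rat>" "pnorm (y - s) \<le> ?e"
    using y(1) closure_approachable[of y \<rat>] by (metis dist_eq dist_commute less_imp_le)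
  have s1: "pnorm s \<le> 1"
    using Q.pnorm_sub_le[of y 1 "y - s"] y(2) s(2) \<open>?e \<le> 1\<close> by simp
  obtain q where "s = of_rat q"
    using s(1) by (auto elim: Rats_cases)
  obtain a b where ab: "quotient_of q = (a, b)"
    by (cases "quotient_of q") auto
  have b0: "b > 0" "coprime a b"
    using quotient_of_denom_pos[OF ab] quotient_of_coprime[OF ab] by auto
  have s_eq: "s = of_int a / of_int b"
    using \<open>s = of_rat q\<close> quotient_of_div[OF ab] by (simp add: of_rat_divide)
  have "\<not> int p dvd b"
  proof
    assume pb: "int p dvd b"
    have "\<not> int p dvd a"
    proof
      assume "int p dvd a"
      then have "is_unit (int p)"
        using coprime_common_divisor[OF b0(2)] pb by blast
      then show False
        using prime_gt_1_nat[OF prime_p] by simp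
    qed
    then have "pnorm (of_int a :: 'a) = 1"
      by (rule pnorm_of_int_coprime)
    moreover have "pnorm (of_int b :: 'a) < 1"
    proof -
      obtain c where "b = int p * c"
        using pb by auto
      then have "pnorm (of_int b :: 'a) = pnorm (of_int c :: 'a) * pnorm (of_nat p :: 'a)"
        by (simp add: pnorm_mult)
      also have "\<dots> \<le> pnorm (of_nat p :: 'a)"
        using Q.pnorm_of_int_le_1[of c] by (intro mult_left_le_one_le) auto
      finally show ?thesis
        using pnorm_p_bounds by linarith
    qed
    ultimately show False
      using s1 b0(1) by (simp add: s_eq Q.pnorm_divide field_simps)
  qed
  then have b1: "pnorm (of_int b :: 'a) = 1" and "coprime (int p) b"
    using prime_p by (auto intro!: pnorm_of_int_coprime prime_imp_coprime)
  then have cop: "coprime b (int p ^ N)"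
    by (simp add: coprime_commute)
  obtain u w where uw: "u * b + w * int p ^ N = 1"
    using bezout_int[of b "int p ^ N"] cop by (auto simp: coprime_iff_gcd_eq_1)
  \<comment> \<open>\<open>u\<close> inverts \<open>b\<close> modulo \<open>p ^ N\<close>, so
    \<open>m\<close> represents the residue class of \<open>a / b\<close>.\<close>
  define m where "m = (a * u) mod int p ^ N"
  have pN: "0 < int p ^ N"
    using prime_gt_0_nat[OF prime_p] by simp
  have m: "0 \<le> m" "m < int p ^ N"
    using pN by (auto simp: m_def)
  obtain t where t: "a * u - m = int p ^ N * t"
    unfolding m_def by (metis dvd_def dvd_minus_mod)
  have eq1: "s - of_int m = of_nat p ^ N * (of_int (a * w) / of_int b + of_int t)"
  proof -
    have "of_int b * (s - of_int m) = (of_int (a - b * m) :: 'a)"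
      using b0(1) by (simp add: s_eq algebra_simps)
    also have "a - b * m = int p ^ N * (a * w + b * t)"
    proof -
      have "a - b * m = a * (u * b + w * int p ^ N) - b * m"
        using uw by simp
      also have "\<dots> = b * (a * u - m) + a * w * int p ^ N"
        by (simp add: algebra_simps)
      finally show ?thesis
        using t by (simp add: algebra_simps)
    qed
    finally show ?thesis
      using b0(1) by (simp add: field_simps)
  qed
  have "pnorm (of_int (a * w) / of_int b + of_int t :: 'a) \<le> 1"
    using b1 Q.pnorm_of_int_le_1 by (intro Q.pnorm_add_le) (auto simp: Q.pnorm_divide simp del: of_int_mult)
  then have "pnorm (s - of_int m) \<le> ?e"
    unfolding eq1 pnorm_mult Q.pnorm_power using pnorm_p_bounds by (intro mult_left_le) auto
  moreover have "of_int m = (of_nat (nat m) :: 'a)"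
    using m(1) by (metis int_nat_eq of_int_of_nat_eq)
  ultimately have "pnorm (y - of_nat (nat m)) \<le> ?e"
    using s(2) Q.pnorm_triangle_le by metis
  moreover have "nat m < p ^ N"
    using m by (metis nat_less_iff of_nat_power)
  ultimately show ?thesis
    by blast
qed

text \<open>Compact means complete and totally bounded; by \<open>approx_by_nat\<close> the natural
  numbers below \<open>p ^ N\<close> form a finite net.\<close>

sublocale Q: local_field "closure \<rat> :: 'a set"
proof
  show "\<exists>y\<in>closure \<rat>. 0 < pnorm (y :: 'a) \<and> pnorm y < 1"
    using pnorm_p_bounds closure_subset by (intro bexI[of _ "of_nat p"]) (auto intro: subsetD[OF closure_subset])
  have int: "int_ring (closure \<rat>) = closure \<rat> \<inter> {y :: 'a. pnorm (y - 0) \<le> 1}"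
    by (auto simp: int_ring_def)
  show "compact (int_ring (closure \<rat>) :: 'a set)"
    unfolding compact_eq_totally_bounded
  proof (intro conjI allI impI)
    show "complete (int_ring (closure \<rat>) :: 'a set)"
      unfolding int by (rule complete_Int_closed[OF complete_Qp Q.closed_pnorm_le])
    fix e :: real assume "0 < e"
    then obtain N where N: "pnorm (of_nat p :: 'a) ^ N < e"
      using real_arch_pow_inv[OF _ pnorm_p_bounds(2)] by blast
    have "int_ring (closure \<rat>) \<subseteq> (\<Union>y\<in>of_nat ` {..<p ^ N}. ball (y :: 'a) e)"
    proof
      fix y :: 'a assume "y \<in> int_ring (closure \<rat>)"
      then obtain m where "m < p ^ N" "pnorm (y - of_nat m) \<le> pnorm (of_nat p :: 'a) ^ N"
        using approx_by_nat by (auto simp: int_ring_def)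
      then show "y \<in> (\<Union>y\<in>of_nat ` {..<p ^ N}. ball (y :: 'a) e)"
        using N by (intro UN_I[of "of_nat m"]) (auto simp: dist_eq Q.pnorm_diff_commute[of _ y])
    qed
    then show "\<exists>k. finite k \<and> int_ring (closure \<rat>) \<subseteq> (\<Union>y\<in>k. ball (y :: 'a) e)"
      by blast
  qed
qed

lemma pnorm_of_nat_less_p:
  assumes "m < p" "pnorm (of_nat m :: 'a) < 1" shows "m = 0"
proof (rule ccontr)
  assume "m \<noteq> 0"
  then have "\<not> int p dvd int m"
    using assms(1) by (auto dest: dvd_imp_le)
  from pnorm_of_int_coprime[OF this] show False
    using assms(2) by simp
qed

lemma Qp_unif: "pnorm Q.unif = pnorm (of_nat p :: 'a)"
proof (rule antisym)
  obtain m where m: "m < p ^ 1" "pnorm (Q.unif - of_nat m) \<le> pnorm (of_nat p :: 'a) ^ 1"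
    using approx_by_nat[of Q.unif 1] Q.unif by auto
  then have "pnorm (Q.unif - of_nat m) < 1"
    using pnorm_p_bounds by simp
  from Q.pnorm_sub_less[OF Q.unif(3) this] have "m = 0"
    using m(1) by (intro pnorm_of_nat_less_p) auto
  then show "pnorm Q.unif \<le> pnorm (of_nat p :: 'a)"
    using m by simp
  show "pnorm (of_nat p :: 'a) \<le> pnorm Q.unif"
    using pnorm_p_bounds by (intro Q.unif(4) Q.of_nat_L)
qed

text \<open>The balls of level \<open>1\<close> around \<open>0, ..., p - 1\<close> partition the
  integers; comparing total masses gives \<open>p * (1 / resq) = 1\<close>.\<close>

lemma Qp_resq: "Q.resq = p"
proof -
  have "disjoint_family_on (\<lambda>m. Q.pball (of_nat m) 1) {..<p}"
  proof (unfold disjoint_family_on_def, intro ballI impI, rule ccontr)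
    have *: "m = n" if mn: "m \<le> n" "n < p" "Q.pball (of_nat m) 1 \<inter> Q.pball (of_nat n) 1 \<noteq> {}" for m n
    proof -
      obtain y :: 'a where y: "pnorm (y - of_nat m) \<le> pnorm Q.unif" "pnorm (y - of_nat n) \<le> pnorm Q.unif"
        using mn(3) by (auto simp: Q.pball_def)
      have "pnorm (of_nat n - of_nat m :: 'a) < 1"
        using Q.pnorm_sub_le[OF y] Q.unif(3) by (simp add: algebra_simps)
      then have "n - m = 0"
        using mn by (intro pnorm_of_nat_less_p) (auto simp: of_nat_diff)
      then show ?thesis
        using mn by simp
    qed
    fix m n assume "m \<in> {..<p}" "n \<in> {..<p}" "m \<noteq> n" "Q.pball (of_nat m) 1 \<inter> Q.pball (of_nat n) 1 \<noteq> {}"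
    then show False
      using *[of m n] *[of n m] by (cases "m \<le> n") (auto simp: Int_commute)
  qed
  moreover have "(\<Union>m\<in>{..<p}. Q.pball (of_nat m) 1) = Q.\<O>"
  proof (intro equalityI subsetI)
    fix y assume "y \<in> (\<Union>m\<in>{..<p}. Q.pball (of_nat m) 1)"
    then obtain m where "pnorm (y - of_nat m) \<le> pnorm Q.unif" "y \<in> closure \<rat>"
      by (auto simp: Q.pball_def)
    then have "pnorm (y - of_nat m) \<le> 1" "y \<in> closure \<rat>"
      using Q.unif(3) by auto
    then show "y \<in> Q.\<O>"
      using Q.pnorm_add_le[of "y - of_nat m" 1 "of_nat m"] Q.pnorm_of_nat_le_1[of m] by (simp add: Q.int_ring_iff)
  next
    fix y assume "y \<in> Q.\<O>"
    then show "y \<in> (\<Union>m\<in>{..<p}. Q.pball (of_nat m) 1)"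
      using approx_by_nat[of y 1] by (auto simp: Q.int_ring_iff Q.pball_def Qp_unif)
  qed
  ultimately have "(\<Sum>m<p. emeasure (haar (closure \<rat>)) (Q.pball (of_nat m :: 'a) 1)) = 1"
    using Q.emeasure_haar_O Q.pball_sets[OF Q.of_nat_L]
    by (subst sum_emeasure) (auto simp: Q.sets_haar)
  moreover have "(\<Sum>m<p. emeasure (haar (closure \<rat>)) (Q.pball (of_nat m :: 'a) 1)) = (\<Sum>m<p. ennreal (1 / real Q.resq))"
    using Q.emeasure_haar_pball[OF Q.of_nat_L, of _ 1] by (intro sum.cong) auto
  moreover have "(\<Sum>m<p. ennreal (1 / real Q.resq)) = ennreal (real p * (1 / real Q.resq))"
    by (simp only: sum_constant card_lessThan ennreal_of_nat_eq_real_of_nat ennreal_mult' of_nat_0_le_iff)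
  ultimately have "ennreal (real p * (1 / real Q.resq)) = 1"
    by metis
  then have "real p * (1 / real Q.resq) = 1"
    by (simp only: ennreal_eq_1)
  then show ?thesis
    using Q.resq_ge_2 by (simp add: field_simps)
qed

sublocale QF: local_ext "closure \<rat> :: 'a set" F
  by unfold_locales (rule finite_F)

text \<open>The prescribed value at \<open>p\<close> is \<open>p\<close> to the power
  \<open>- [F : closure \<rat>]\<close>, which by \<open>resq_power\<close> equals
  \<open>(1 / q) ^ e\<close> with \<open>q\<close> the residue cardinality and \<open>e\<close> the
  ramification index of \<open>F\<close>. The \<open>p\<close>-adic numbers themselves are
  normalized in this sense only when that degree is \<open>1\<close>.\<close>

lemma F_normalized: "pnorm QF.K.unif = 1 / real QF.K.resq"
proof -
  have "pnorm QF.K.unif ^ QF.ram = pnorm (of_nat p :: 'a)"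
    using QF.ram Qp_unif by simp
  also have "\<dots> = 1 / real (p ^ QF.deg)"
    by (simp add: pnorm_p QF.deg_def)
  also have "\<dots> = (1 / real QF.K.resq) ^ QF.ram"
    using QF.resq_power by (simp add: Qp_resq power_divide flip: of_nat_power)
  finally show ?thesis
    by (rule power_eq_imp_eq_base) (use QF.ram_pos in auto)
qed

end

lemma (in padic_setting) normalized_extI:
  "finite_extension F K \<Longrightarrow> normalized_ext F K"
  by unfold_locales (use F_normalized QF.K.compact_int in auto)

section \<open>Values of polynomials of bounded degree\<close>

definition is_subring :: "'a::comm_ring_1 set \<Rightarrow> bool" where
  "is_subring R \<longleftrightarrow> 0 \<in> R \<and> 1 \<in> R \<and> (\<forall>x\<in>R. \<forall>y\<in>R. x + y \<in> R \<and> x * y \<in> R \<and> x - y \<in> R)"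

lemma is_subringD:
  assumes "is_subring R"
  shows "0 \<in> R" "1 \<in> R" "x \<in> R \<Longrightarrow> y \<in> R \<Longrightarrow> x + y \<in> R" "x \<in> R \<Longrightarrow> y \<in> R \<Longrightarrow> x * y \<in> R"
    "x \<in> R \<Longrightarrow> y \<in> R \<Longrightarrow> x - y \<in> R"
  using assms by (auto simp: is_subring_def)

lemma is_subring_sum: "is_subring R \<Longrightarrow> (\<And>i. i \<in> I \<Longrightarrow> f i \<in> R) \<Longrightarrow> sum f I \<in> R"
  by (induction I rule: infinite_finite_induct) (auto intro: is_subringD)

definition polys_over :: "'a::comm_ring_1 set \<Rightarrow> 'a poly set" where
  "polys_over R = {P. range (coeff P) \<subseteq> R}"

lemma polys_over_iff: "P \<in> polys_over R \<longleftrightarrow> (\<forall>i. coeff P i \<in> R)"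
  by (auto simp: polys_over_def)

lemma is_subring_polys_over: "is_subring R \<Longrightarrow> is_subring (polys_over R)"
  by (auto simp: is_subring_def[of "polys_over R"] polys_over_iff coeff_1 coeff_mult
      intro!: is_subring_sum intro: is_subringD)

lemma polys_over_power: "is_subring R \<Longrightarrow> P \<in> polys_over R \<Longrightarrow> P ^ k \<in> polys_over R"
  by (induction k) (auto intro: is_subringD is_subring_polys_over)

lemma polys_over_smult: "is_subring R \<Longrightarrow> P \<in> polys_over R \<Longrightarrow> c \<in> R \<Longrightarrow> smult c P \<in> polys_over R"
  by (auto simp: polys_over_iff intro: is_subringD)

text \<open>For \<open>R = \<O>\<close> this is the group \<open>W\<^sub>m(x)\<close> of the
  overview. Taking \<open>R\<close> to be the field itself yields \<open>F[x]\<close> once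
  \<open>m\<close> is large, so the same lemmas serve both.\<close>

definition poly_values :: "'a::comm_ring_1 set \<Rightarrow> nat \<Rightarrow> 'a \<Rightarrow> 'a set" where
  "poly_values R m x = {poly P x | P. P \<in> polys_over R \<and> degree P \<le> m}"

lemma poly_poly_of: "poly (poly_of m c) x = (\<Sum>i\<le>m. c i * x ^ i)"
  by (simp add: poly_of_def poly_sum poly_monom)

lemma poly_values_eq_lincomb_set:
  assumes "0 \<in> R"
  shows "poly_values R m x = lincomb_set R (Suc m) (\<lambda>i. x ^ i)"
proof (intro equalityI subsetI)
  fix y assume "y \<in> poly_values R m x"
  then obtain P where P: "y = poly P x" "P \<in> polys_over R" "degree P \<le> m"
    by (auto simp: poly_values_def)
  have "y = (\<Sum>i<Suc m. coeff P i * x ^ i)"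
    unfolding P(1) poly_altdef using P(3)
    by (intro sum.mono_neutral_left) (auto simp: coeff_eq_0)
  then show "y \<in> lincomb_set R (Suc m) (\<lambda>i. x ^ i)"
    using P(2) by (simp only: polys_over_iff lincomb_setI)
next
  fix y assume "y \<in> lincomb_set R (Suc m) (\<lambda>i. x ^ i)"
  then obtain c where c: "\<forall>i<Suc m. c i \<in> R" "y = (\<Sum>i<Suc m. c i * x ^ i)"
    by (auto simp: lincomb_set_def)
  have "coeff (poly_of m c) k = (if k \<le> m then c k else 0)" for k
    by (simp add: poly_of_def coeff_sum if_distrib cong: if_cong)
  then have "poly_of m c \<in> polys_over R"
    using c(1) assms by (auto simp: polys_over_iff)
  moreover have "degree (poly_of m c) \<le> m"
    unfolding poly_of_def by (intro degree_sum_le) (auto intro: order_trans[OF degree_monom_le])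
  moreover have "y = poly (poly_of m c) x"
    by (simp add: c(2) poly_poly_of lessThan_Suc_atMost)
  ultimately show "y \<in> poly_values R m x"
    by (auto simp: poly_values_def)
qed

lemma poly_values_mono: "m \<le> n \<Longrightarrow> poly_values R m x \<subseteq> poly_values R n x"
  by (fastforce simp: poly_values_def)

lemma adjoin_eq: "adjoin R x = (\<Union>m. poly_values R m x)"
  by (force simp: adjoin_def poly_values_def polys_over_def)

lemma add_subgroup_poly_values:
  assumes "is_subring R" shows "add_subgroup (poly_values R m x)"
  unfolding add_subgroup_def
proof (intro conjI ballI)
  note R = is_subringD[OF is_subring_polys_over[OF assms]]
  have "poly 0 x \<in> poly_values R m x"
    unfolding poly_values_def using R(1) by (intro CollectI exI[of _ 0]) auto
  then show "0 \<in> poly_values R m x"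
    by simp
  fix y z assume "y \<in> poly_values R m x" "z \<in> poly_values R m x"
  then obtain P Q where "y = poly P x" "z = poly Q x" "P \<in> polys_over R" "Q \<in> polys_over R"
    "degree P \<le> m" "degree Q \<le> m"
    by (auto simp: poly_values_def)
  then show "y - z \<in> poly_values R m x"
    using R(5) unfolding poly_values_def
    by (intro CollectI exI[of _ "P - Q"]) (auto intro: degree_diff_le)
qed

lemma poly_values_scale:
  assumes "is_subring R" "c \<in> R" "y \<in> poly_values R m x"
  shows "c * y \<in> poly_values R m x"
proof -
  obtain P where "y = poly P x" "P \<in> polys_over R" "degree P \<le> m"
    using assms by (auto simp: poly_values_def)
  then show ?thesis
    using polys_over_smult[OF assms(1)] assms(2) degree_smult_le[of c P] unfolding poly_values_def
    by (intro CollectI exI[of _ "smult c P"]) auto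
qed

lemma poly_values_monom: "is_subring R \<Longrightarrow> c \<in> R \<Longrightarrow> i \<le> m \<Longrightarrow> c * x ^ i \<in> poly_values R m x"
  unfolding poly_values_def
  by (intro CollectI exI[of _ "monom c i"])
    (auto simp: poly_monom polys_over_iff is_subringD intro: order_trans[OF degree_monom_le])

text \<open>Multiplying an expansion of \<open>x ^ n\<close> by \<open>x\<close> produces a single
  power beyond \<open>x ^ s\<close>, namely \<open>x ^ Suc s\<close>, and the hypothesis rewrites
  it. Hence all powers lie in the group of degree \<open>s\<close>.\<close>

lemma poly_values_stable:
  assumes R: "is_subring R" and x: "x ^ Suc s \<in> poly_values R s x"
  shows "poly_values R m x \<subseteq> poly_values R s x"
proof -
  note W = add_subgroupD[OF add_subgroup_poly_values[OF R, of s x]]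
  have sumW: "sum f I \<in> poly_values R s x" if "\<And>i. i \<in> I \<Longrightarrow> f i \<in> poly_values R s x" for f and I :: "nat set"
    using that by (induction I rule: infinite_finite_induct) (auto intro: W)
  have pow: "x ^ n \<in> poly_values R s x" for n
  proof (induction n)
    case 0
    show ?case
      using poly_values_monom[OF R, of 1 0 s x] is_subringD[OF R] by simp
  next
    case (Suc n)
    then obtain c where c: "\<forall>i<Suc s. c i \<in> R" "x ^ n = (\<Sum>i<Suc s. c i * x ^ i)"
      unfolding poly_values_eq_lincomb_set[OF is_subringD(1)[OF R]] lincomb_set_def by auto
    have "x ^ Suc n = (\<Sum>i<Suc s. c i * x ^ Suc i)"
      by (simp only: power_Suc c(2) sum_distrib_left mult_ac)
    also have "\<dots> \<in> poly_values R s x"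
    proof (rule sumW)
      fix i assume "i \<in> {..<Suc s}"
      then show "c i * x ^ Suc i \<in> poly_values R s x"
        using c(1) x poly_values_scale[OF R] poly_values_monom[OF R, of "c i" "Suc i" s x]
        by (cases "i = s") auto
    qed
    finally show ?case .
  qed
  show ?thesis
  proof
    fix y assume "y \<in> poly_values R m x"
    then obtain c where c: "\<forall>i<Suc m. c i \<in> R" "y = (\<Sum>i<Suc m. c i * x ^ i)"
      unfolding poly_values_eq_lincomb_set[OF is_subringD(1)[OF R]] lincomb_set_def by auto
    show "y \<in> poly_values R s x"
      unfolding c(2) using c(1) by (intro sumW poly_values_scale[OF R] pow) auto
  qed
qed

lemma adjoin_stable:
  assumes "is_subring R" "x ^ Suc s \<in> poly_values R s x"
  shows "adjoin R x = poly_values R s x"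
  unfolding adjoin_eq using poly_values_stable[OF assms] by blast

text \<open>The factor \<open>(c x + d) ^ m\<close> clears denominators: the result is the
  homogenization of the polynomial in degree \<open>m\<close>, evaluated at the linear forms
  \<open>a x + b\<close> and \<open>c x + d\<close>, hence again of degree at most \<open>m\<close>
  in \<open>x\<close>.\<close>

lemma moebius_poly_values:
  fixes x :: "'a::field"
  assumes R: "is_subring R" and abcd: "a \<in> R" "b \<in> R" "c \<in> R" "d \<in> R" and nz: "c * x + d \<noteq> 0"
    and u: "u \<in> poly_values R m ((a * x + b) / (c * x + d))"
  shows "(c * x + d) ^ m * u \<in> poly_values R m x"
proof -
  note PR = is_subring_polys_over[OF R]
  obtain e where e: "\<forall>i<Suc m. e i \<in> R" "u = (\<Sum>i<Suc m. e i * ((a * x + b) / (c * x + d)) ^ i)"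
    using u unfolding poly_values_eq_lincomb_set[OF is_subringD(1)[OF R]] lincomb_set_def by auto
  let ?P = "\<lambda>i. smult (e i) ([:b, a:] ^ i * [:d, c:] ^ (m - i))"
  have "(c * x + d) ^ m * u = (\<Sum>i<Suc m. e i * (a * x + b) ^ i * (c * x + d) ^ (m - i))"
    unfolding e(2) sum_distrib_left
  proof (intro sum.cong refl)
    fix i assume "i \<in> {..<Suc m}"
    then have "(c * x + d) ^ m = (c * x + d) ^ i * (c * x + d) ^ (m - i)"
      by (simp flip: power_add)
    then show "(c * x + d) ^ m * (e i * ((a * x + b) / (c * x + d)) ^ i) = e i * (a * x + b) ^ i * (c * x + d) ^ (m - i)"
      using nz by (simp add: power_divide)
  qed
  also have "\<dots> = poly (\<Sum>i<Suc m. ?P i) x"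
    by (simp add: poly_sum algebra_simps del: sum.lessThan_Suc)
  also have "\<dots> \<in> poly_values R m x"
  proof -
    have lin: "[:b, a:] \<in> polys_over R" "[:d, c:] \<in> polys_over R"
      using abcd is_subringD(1)[OF R] by (auto simp: polys_over_iff coeff_pCons split: nat.split)
    have "(\<Sum>i<Suc m. ?P i) \<in> polys_over R"
      using e(1) lin
      by (intro is_subring_sum[OF PR] polys_over_smult[OF R] is_subringD(4)[OF PR] polys_over_power[OF R]) auto
    moreover have "degree (\<Sum>i<Suc m. ?P i) \<le> m"
    proof (rule degree_sum_le)
      fix i assume i: "i \<in> {..<Suc m}"
      have "degree ([:b, a:] ^ i) \<le> i" "degree ([:d, c:] ^ (m - i)) \<le> m - i"
        using degree_power_le[of "[:b, a:]" i] degree_power_le[of "[:d, c:]" "m - i"]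
        by (auto intro: order_trans split: if_splits)
      then have "degree ([:b, a:] ^ i * [:d, c:] ^ (m - i)) \<le> i + (m - i)"
        using degree_mult_le[of "[:b, a:] ^ i" "[:d, c:] ^ (m - i)"] by linarith
      then show "degree (?P i) \<le> m"
        using i degree_smult_le[of "e i" "[:b, a:] ^ i * [:d, c:] ^ (m - i)"] by auto
    qed simp
    ultimately show ?thesis
      unfolding poly_values_def by blast
  qed
  finally show ?thesis .
qed

section \<open>Indices of subgroups expressed through Haar measure\<close>

lemma quot_class_eq:
  assumes B: "add_subgroup B" "B \<subseteq> A" and A: "add_subgroup A" and a: "a \<in> A"
  shows "{(u, v). u \<in> A \<and> v \<in> A \<and> u - v \<in> B} `` {a} = (+) a ` B"
proof (intro equalityI subsetI)
  fix y assume "y \<in> {(u, v). u \<in> A \<and> v \<in> A \<and> u - v \<in> B} `` {a}"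
  then have "a - y \<in> B"
    by auto
  then have "y - a \<in> B"
    using add_subgroupD(3)[OF B(1), of "a - y"] by simp
  then show "y \<in> (+) a ` B"
    by (intro image_eqI[of _ _ "y - a"]) auto
next
  fix y assume "y \<in> (+) a ` B"
  then show "y \<in> {(u, v). u \<in> A \<and> v \<in> A \<and> u - v \<in> B} `` {a}"
    using a B add_subgroupD(4)[OF A a] add_subgroupD(3)[OF B(1)] by auto
qed

context valued_field
begin

lemma is_subring_L: "is_subring L"
  by (simp add: is_subring_def add_L mult_L diff_L)

lemma is_subring_O: "is_subring \<O>"
  by (simp add: is_subring_def add_int mult_int diff_int)

lemma poly_values_L: "R \<subseteq> L \<Longrightarrow> x \<in> L \<Longrightarrow> poly_values R m x \<subseteq> L"
  by (auto simp: poly_values_def polys_over_iff poly_altdef intro!: sum_L mult_L power_L)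

lemma compact_poly_values: "compact R \<Longrightarrow> (0 :: 'a) \<in> R \<Longrightarrow> compact (poly_values R m x)"
  by (simp add: poly_values_eq_lincomb_set compact_lincomb_set)

end

context local_field
begin

lemma sets_haarI: "A \<subseteq> L \<Longrightarrow> A \<in> sets borel \<Longrightarrow> A \<in> sets (haar L)"
  using borel_closed[OF closed_L] by (simp add: sets_haar sets_restrict_space_iff)

lemma compact_sets_haar: "A \<subseteq> L \<Longrightarrow> compact A \<Longrightarrow> A \<in> sets (haar L)"
  by (rule sets_haarI) (auto intro: borel_closed compact_imp_closed)

lemma O_sets_haar: "\<O> \<in> sets (haar L)"
  using int_ring_L by (auto intro: compact_sets_haar compact_O)

text \<open>A power of \<open>unif\<close> moves a bounded set into \<open>\<O>\<close>, of mass
  \<open>1\<close>, and scales its measure by a positive factor.\<close>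

lemma emeasure_haar_bounded:
  assumes "A \<in> sets (haar L)" "\<And>y. y \<in> A \<Longrightarrow> pnorm y \<le> B"
  shows "emeasure (haar L) A < \<infinity>"
proof -
  have B0: "0 < \<bar>B\<bar> + 1"
    by simp
  then obtain k where k: "pnorm unif ^ k < 1 / (\<bar>B\<bar> + 1)"
    using unif_power_small[of "1 / (\<bar>B\<bar> + 1)"] by auto
  have AL: "A \<subseteq> L"
    using sets.sets_into_space[OF assms(1)] by simp
  have "(*) (unif ^ k) ` A \<subseteq> \<O>"
  proof
    fix z assume "z \<in> (*) (unif ^ k) ` A"
    then obtain y where y: "z = unif ^ k * y" "y \<in> A"
      by auto
    have "pnorm z \<le> (1 / (\<bar>B\<bar> + 1)) * (\<bar>B\<bar> + 1)"
      unfolding y pnorm_mult pnorm_power using k assms(2)[OF y(2)] by (intro mult_mono) auto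
    then have "pnorm z \<le> 1"
      using B0 by simp
    then show "z \<in> \<O>"
      using y AL unif(1) by (auto simp: int_ring_iff intro!: mult_L power_L)
  qed
  then have "emeasure (haar L) ((*) (unif ^ k) ` A) \<le> 1"
    using emeasure_mono[OF _ O_sets_haar] emeasure_haar_O by fastforce
  then have "ennreal (1 / real resq ^ k) * emeasure (haar L) A \<le> 1"
    using haar_scale_int(2)[of "unif ^ k" k A] assms(1) unif(1) by (simp add: power_L pnorm_power)
  moreover have "0 < 1 / real resq ^ k"
    using resq_ge_2 by simp
  ultimately show ?thesis
    using ennreal_mult_eq_top_iff[of "ennreal (1 / real resq ^ k)" "emeasure (haar L) A"]
    by (auto simp: top_unique less_top)
qed

lemma emeasure_haar_eq_measure:
  "A \<in> sets (haar L) \<Longrightarrow> (\<And>y. y \<in> A \<Longrightarrow> pnorm y \<le> B) \<Longrightarrow> emeasure (haar L) A = ennreal (measure (haar L) A)"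
  using emeasure_haar_bounded[of A B] by (intro emeasure_eq_ennreal_measure) auto

text \<open>Used in two ways: as an exact count when the translates fill \<open>\<O>\<close>, and
  with \<open>measure_haar_subset_O\<close> as a bound on how many disjoint translates fit.\<close>

lemma measure_haar_sum_translates:
  assumes B: "B \<in> sets (haar L)" "B \<subseteq> \<O>" and C: "finite C" "disjoint C"
    and tr: "\<And>A. A \<in> C \<Longrightarrow> \<exists>a\<in>\<O>. A = (+) a ` B"
  shows "measure (haar L) (\<Union> C) = real (card C) * measure (haar L) B" "\<Union> C \<in> sets (haar L)" "\<Union> C \<subseteq> \<O>"
proof -
  have A: "A \<in> sets (haar L) \<and> A \<subseteq> \<O> \<and> emeasure (haar L) A = emeasure (haar L) B" if "A \<in> C" for A
  proof -
    from tr[OF \<open>A \<in> C\<close>] obtain a where a: "a \<in> \<O>" "A = (+) a ` B"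
      by blast
    have "(\<lambda>y. y - a) -` B \<inter> space (haar L) \<in> sets (haar L)"
      using translate_measurable[OF int_ring_L[OF a(1)] sets_haar] B(1)
      by (rule_tac measurable_sets) (auto simp: sets_haar)
    moreover have "B \<subseteq> L"
      using B(2) int_ring_L by blast
    moreover have "(+) a ` B \<subseteq> \<O>"
      using a(1) B(2) by (auto intro: add_int)
    ultimately show ?thesis
      using a(2) translate_image[OF int_ring_L[OF a(1)], of B] haar_invariant[OF int_ring_L[OF a(1)] B(1)]
      by simp
  qed
  then show "\<Union> C \<subseteq> \<O>"
    by blast
  show "\<Union> C \<in> sets (haar L)"
    using A C by blast
  have "emeasure (haar L) (\<Union> C) = (\<Sum>A\<in>C. emeasure (haar L) A)"
    using A C by (intro emeasure_Union_disjoint) auto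
  also have "\<dots> = of_nat (card C) * emeasure (haar L) B"
    using A by simp
  finally show "measure (haar L) (\<Union> C) = real (card C) * measure (haar L) B"
    by (simp add: measure_def enn2real_mult)
qed

lemma measure_haar_O: "measure (haar L) \<O> = 1"
  by (simp add: measure_def emeasure_haar_O)

lemma measure_haar_subset_O:
  assumes "A \<in> sets (haar L)" "A \<subseteq> \<O>" shows "measure (haar L) A \<le> 1"
proof -
  have "emeasure (haar L) A \<le> 1"
    using emeasure_mono[OF assms(2) O_sets_haar] emeasure_haar_O by simp
  then show ?thesis
    using enn2real_mono[of _ 1] by (simp add: measure_def)
qed

lemma quot_card_haar:
  assumes B: "add_subgroup B" "B \<subseteq> \<O>" "B \<in> sets (haar L)" and pos: "0 < measure (haar L) B"
  shows "real (quot_card \<O> B) * measure (haar L) B = 1"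
proof -
  let ?r = "{(u, v). u \<in> \<O> \<and> v \<in> \<O> \<and> u - v \<in> B}"
  let ?C = "\<O> // ?r"
  have eq: "equiv \<O> ?r"
  proof (rule equivI)
    show "refl_on \<O> ?r" "?r \<subseteq> \<O> \<times> \<O>"
      using add_subgroupD(1)[OF B(1)] by (auto simp: refl_on_def)
    show "sym ?r"
      using add_subgroupD(3)[OF B(1)] by (auto intro!: symI) (metis minus_diff_eq)
    show "trans ?r"
    proof (rule transI)
      fix u v w assume "(u, v) \<in> ?r" "(v, w) \<in> ?r"
      then show "(u, w) \<in> ?r"
        using add_subgroupD(4)[OF B(1), of "u - v" "v - w"] by auto
    qed
  qed
  have tr: "\<exists>a\<in>\<O>. A = (+) a ` B" if "A \<in> ?C" for A
    using that quot_class_eq[OF B(1,2) add_subgroup_O] by (auto simp: quotient_def)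
  have disj: "disjoint ?C"
    using quotient_disj[OF eq] by (auto simp: disjoint_def)
  note sum = measure_haar_sum_translates[OF B(3,2)]
  \<comment> \<open>\<open>quot_card\<close> would be \<open>0\<close> for an infinite quotient.
    More than \<open>1 / measure (haar L) B\<close> disjoint cosets would have total mass above
    \<open>1\<close>.\<close>
  have fin: "finite ?C"
  proof (rule ccontr)
    assume "infinite ?C"
    then obtain D where D: "D \<subseteq> ?C" "finite D" "card D = Suc (nat \<lfloor>1 / measure (haar L) B\<rfloor>)"
      using infinite_arbitrarily_large by blast
    have "disjoint D"
      using disj D(1) unfolding disjoint_def by blast
    note sumD = sum[OF D(2) this tr[OF subsetD[OF D(1)]]]
    then have "real (card D) * measure (haar L) B \<le> 1"
      using measure_haar_subset_O[of "\<Union> D"] by simp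
    then have "real (card D) \<le> 1 / measure (haar L) B"
      using pos by (simp add: field_simps)
    moreover have "1 / measure (haar L) B < real (card D)"
      unfolding D(3) by linarith
    ultimately show False
      by linarith
  qed
  have "\<Union> ?C = \<O>"
    by (rule Union_quotient[OF eq])
  then show ?thesis
    using sum(1)[OF fin disj tr] measure_haar_O by (simp add: quot_card_def)
qed

text \<open>By discreteness of values the maximal ideal is the ball \<open>pball 0 1\<close>, whose
  mass is \<open>1 / resq\<close>.\<close>

lemma residue_card_eq: "residue_card L = resq"
proof -
  have eq: "{x \<in> L. pnorm x < 1} = pball 0 1"
    using unif by (auto simp: pball_def)
  have pb: "measure (haar L) (pball 0 1) = 1 / real resq"
    using emeasure_haar_pball[OF zero_L, of 1] by (simp add: measure_def)
  have "real (quot_card \<O> (pball 0 1)) * measure (haar L) (pball 0 1) = 1"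
  proof (rule quot_card_haar)
    show "add_subgroup (pball 0 1)"
      by (auto simp: add_subgroup_def pball_def diff_L pnorm_sub_le)
    show "pball 0 1 \<subseteq> \<O>"
      using pball_mono[of 0 1 0] by (simp add: pball_0)
    show "pball 0 1 \<in> sets (haar L)"
      by (simp add: sets_haar pball_sets)
    show "0 < measure (haar L) (pball 0 1)"
      unfolding pb using resq_ge_2 by simp
  qed
  then show ?thesis
    unfolding pb using resq_ge_2 by (simp add: residue_card_def eq field_simps flip: \<O>_def)
qed

end

section \<open>The lattice of values of degree below the degree of the extension\<close>

context local_ext
begin

lemma scale_F_into_KO:
  assumes "y \<in> K" shows "\<exists>k. F.unif ^ k * y \<in> K.\<O>"
proof -
  have "\<exists>k. pnorm (F.unif ^ k * y) \<le> 1"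
  proof (cases "y = 0")
    case False
    then obtain k where "pnorm F.unif ^ k < 1 / pnorm y"
      using F.unif_power_small[of "1 / pnorm y"] by auto
    then show ?thesis
      using False by (intro exI[of _ k]) (simp add: F.pnorm_mult F.pnorm_power field_simps)
  qed simp
  then show ?thesis
    using assms F.unif(1) by (auto simp: K.int_ring_iff intro!: K.mult_L K.power_L intro: F_K)
qed

text \<open>A power of \<open>F.unif\<close> makes \<open>x\<close> integral; the integral equation
  of the multiple is then divided by the scaling factor.\<close>

lemma power_deg_F:
  assumes x: "x \<in> K" shows "x ^ deg \<in> poly_values F (deg - 1) x"
proof -
  obtain k where k: "F.unif ^ k * x \<in> K.\<O>"
    using scale_F_into_KO[OF x] ..
  let ?w = "F.unif ^ k"
  obtain c where c: "\<forall>i<deg. c i \<in> F.\<O>" "(?w * x) ^ deg = (\<Sum>i<deg. c i * (?w * x) ^ i)"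
    using integral_equation[OF k] by blast
  have "x ^ deg = (?w * x) ^ deg / ?w ^ deg"
    by (simp add: power_mult_distrib)
  also have "\<dots> = (\<Sum>i<deg. (c i * ?w ^ i / ?w ^ deg) * x ^ i)"
    unfolding c(2) by (simp add: sum_divide_distrib power_mult_distrib mult_ac)
  also have "\<dots> \<in> lincomb_set F deg (\<lambda>i. x ^ i)"
    using c(1) F.unif(1)
    by (intro lincomb_setI F.divide_L F.mult_L F.power_L) (auto simp: F.int_ring_iff)
  finally show ?thesis
    using deg_pos by (simp add: poly_values_eq_lincomb_set)
qed

lemma adjoin_F: "x \<in> K \<Longrightarrow> adjoin F x = poly_values F (deg - 1) x"
  using power_deg_F[of x] deg_pos by (intro adjoin_stable F.is_subring_L) simp

lemma power_deg_int:
  assumes x: "x \<in> K.\<O>" shows "x ^ deg \<in> poly_values F.\<O> (deg - 1) x"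
  using integral_equation[OF x] deg_pos
  by (auto simp: poly_values_eq_lincomb_set intro!: lincomb_setI)

lemma poly_values_int: 
  assumes "x \<in> K.\<O>" "deg - 1 \<le> m"
  shows "poly_values F.\<O> m x = poly_values F.\<O> (deg - 1) x"
  using poly_values_stable[OF F.is_subring_O, of x "deg - 1" m] power_deg_int[OF assms(1)] deg_pos
    poly_values_mono[OF assms(2), of "F.\<O>" x] by (intro equalityI) simp_all

lemma adjoin_int: "x \<in> K.\<O> \<Longrightarrow> adjoin F.\<O> x = poly_values F.\<O> (deg - 1) x"
  using power_deg_int[of x] deg_pos by (intro adjoin_stable F.is_subring_O) simp

text \<open>Below the first power of \<open>x\<close> that depends on its predecessors, the powers form a basis
  of \<open>F[x]\<close>; so if \<open>F[x] = K\<close> that first power is \<open>x ^ deg\<close>.\<close>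

lemma powers_basis:
  assumes x: "x \<in> K" and gen: "adjoin F x = K"
  shows "is_basis F K deg (\<lambda>i. x ^ i)"
proof -
  define s where "s = (LEAST s. x ^ s \<in> lincomb_set F s (\<lambda>i. x ^ i))"
  have "x ^ deg \<in> lincomb_set F deg (\<lambda>i. x ^ i)"
    using power_deg_F[OF x] deg_pos by (simp add: poly_values_eq_lincomb_set)
  then have s: "x ^ s \<in> lincomb_set F s (\<lambda>i. x ^ i)"
    unfolding s_def by (rule LeastI)
  have min: "x ^ t \<notin> lincomb_set F t (\<lambda>i. x ^ i)" if "t < s" for t
    using that not_less_Least unfolding s_def by blast
  have "s \<noteq> 0"
    using s by (cases "s = 0") auto
  then obtain s' where s': "s = Suc s'"
    by (cases s) auto
  have K: "lincomb_set F s (\<lambda>i. x ^ i) = K"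
    using adjoin_stable[OF F.is_subring_L, of x s'] s gen by (simp add: s' poly_values_eq_lincomb_set)
  have "is_basis F K s (\<lambda>i. x ^ i)"
  proof (rule is_basisI)
    fix c assume c: "\<And>i. i < s \<Longrightarrow> c i \<in> F" "(\<Sum>i<s. c i * x ^ i) = 0"
    show "\<forall>i<s. c i = 0"
    proof (rule ccontr)
      assume "\<not> (\<forall>i<s. c i = 0)"
      then have ne: "{i. i < s \<and> c i \<noteq> 0} \<noteq> {}"
        by auto
      define j where "j = Max {i. i < s \<and> c i \<noteq> 0}"
      have j: "j < s" "c j \<noteq> 0"
        using Max_in[OF _ ne] by (auto simp: j_def)
      have above: "c i = 0" if "j < i" "i < s" for i
        using Max_ge[of "{i. i < s \<and> c i \<noteq> 0}" i] that unfolding j_def by fastforce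
      have "(\<Sum>i<s. c i * x ^ i) = (\<Sum>i<Suc j. c i * x ^ i)"
        using j(1) above by (intro sum.mono_neutral_right) auto
      then have "c j * x ^ j = - (\<Sum>i<j. c i * x ^ i)"
        using c(2) by (simp add: eq_neg_iff_add_eq_0 add.commute)
      then have "x ^ j = (\<Sum>i<j. (- c i / c j) * x ^ i)"
        using j(2) by (simp add: sum_negf sum_divide_distrib[symmetric] field_simps)
      also have "\<dots> \<in> lincomb_set F j (\<lambda>i. x ^ i)"
        using c(1) j(1) by (intro lincomb_setI F.divide_L F.minus_L) auto
      finally show False
        using min[OF j(1)] by simp
    qed
  qed (use K in \<open>auto simp: lincomb_set_def intro: F.diff_L\<close>)
  then show ?thesis
    using basis_length by blast
qed

text \<open>The powers of \<open>x\<close> below \<open>deg\<close> are independent over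
  \<open>F\<close>. The lemma feeds \<open>mean_power_less\<close>: each raise of the degree up to
  \<open>deg - 1\<close> adds genuinely new values.\<close>

lemma power_notin_poly_values:
  assumes x: "x \<in> K" "adjoin F x = K" and m: "Suc m < deg" and c: "c \<in> F" "c \<noteq> 0"
  shows "c * x ^ Suc m \<notin> poly_values F.\<O> m x"
proof
  assume "c * x ^ Suc m \<in> poly_values F.\<O> m x"
  then obtain d where d: "\<forall>i<Suc m. d i \<in> F.\<O>" "c * x ^ Suc m = (\<Sum>i<Suc m. d i * x ^ i)"
    by (auto simp: poly_values_eq_lincomb_set lincomb_set_def)
  let ?c = "\<lambda>i. if i = Suc m then c else 0" and ?d = "\<lambda>i. if i < Suc m then d i else 0"
  have "(\<Sum>i<deg. ?c i * x ^ i) = c * x ^ Suc m"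
    using m by (simp add: if_distrib[of "\<lambda>y. y * _"] cong: if_cong del: power_Suc)
  also have "\<dots> = (\<Sum>i<deg. ?d i * x ^ i)"
    unfolding d(2) using m by (intro sum.mono_neutral_cong_left) auto
  finally have "?c (Suc m) = ?d (Suc m)"
    using d(1) c(1) m by (intro is_basis_unique[OF powers_basis[OF x], of ?c ?d]) (auto simp: F.int_ring_iff)
  then show False
    using c by simp
qed

text \<open>The order \<open>\<O>\<^sub>F[x]\<close> when \<open>x\<close> is integral.\<close>

definition lat :: "'a \<Rightarrow> 'a set" where
  "lat x = poly_values F.\<O> (deg - 1) x"

lemma lat_K: "x \<in> K \<Longrightarrow> lat x \<subseteq> K"
  unfolding lat_def by (rule K.poly_values_L) (auto intro: F_K F.int_ring_L)

lemma compact_PV: "compact (poly_values F.\<O> m x)"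
  by (rule F.compact_poly_values[OF F.compact_O F.zero_int])

lemma add_subgroup_PV: "add_subgroup (poly_values F.\<O> m x)"
  by (rule add_subgroup_poly_values[OF F.is_subring_O])

lemma lat_sets: "x \<in> K \<Longrightarrow> lat x \<in> sets (haar K)"
  unfolding lat_def using lat_K compact_PV by (intro K.compact_sets_haar) (auto simp: lat_def)

text \<open>The powers of \<open>x\<close> form a basis of \<open>K\<close>, so a common power of
  \<open>F.unif\<close> clears the denominators of all vectors of the integral basis; that multiple
  of \<open>K.\<O>\<close> lies in \<open>lat x\<close>.\<close>

lemma lat_open:
  assumes x: "x \<in> K" "adjoin F x = K"
  shows "\<exists>N. \<forall>y\<in>K. pnorm y \<le> pnorm F.unif ^ N \<longrightarrow> y \<in> lat x"
proof -
  note W = add_subgroupD[OF add_subgroup_PV[of "deg - 1" x], folded lat_def]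
  have scale: "c * y \<in> lat x" if "c \<in> F.\<O>" "y \<in> lat x" for c y
    using that poly_values_scale[OF F.is_subring_O] by (simp add: lat_def)
  have ex: "\<exists>N. F.unif ^ N * y \<in> lat x" if "y \<in> K" for y
  proof -
    obtain c where c: "\<And>i. i < deg \<Longrightarrow> c i \<in> F" "y = (\<Sum>i<deg. c i * x ^ i)"
      by (rule is_basis_coeffs[OF powers_basis[OF x] \<open>y \<in> K\<close>]) (rule that)
    have "\<forall>i\<in>{..<deg}. \<exists>k. F.unif ^ k * c i \<in> F.\<O>"
      using F.scale_into_int c(1) by blast
    then obtain k where k: "\<And>i. i < deg \<Longrightarrow> F.unif ^ k i * c i \<in> F.\<O>"
      by (metis lessThan_iff)
    define N where "N = Max (k ` {..<deg})"
    have N: "F.unif ^ N * c i \<in> F.\<O>" if "i < deg" for i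
    proof -
      have "k i \<le> N"
        unfolding N_def using that by (intro Max_ge) auto
      then have "F.unif ^ N * c i = F.unif ^ (N - k i) * (F.unif ^ k i * c i)"
        by (simp add: mult.assoc[symmetric] power_add[symmetric])
      then show ?thesis
        using k[OF that] F.mult_int F.power_int[OF F.unif_int] by metis
    qed
    have "F.unif ^ N * y = (\<Sum>i<deg. (F.unif ^ N * c i) * x ^ i)"
      by (simp add: c(2) sum_distrib_left mult.assoc)
    also have "\<dots> \<in> lat x"
      using N deg_pos by (auto simp: lat_def poly_values_eq_lincomb_set intro!: lincomb_setI)
    finally show ?thesis ..
  qed
  have "\<forall>j\<in>{..<deg}. \<exists>N. F.unif ^ N * ibasis j \<in> lat x"
    using ex ibasis_int K.int_ring_L by blast
  then obtain k where k: "\<And>j. j < deg \<Longrightarrow> F.unif ^ k j * ibasis j \<in> lat x"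
    by (metis lessThan_iff)
  define N where "N = Max (k ` {..<deg})"
  have N: "F.unif ^ N * ibasis j \<in> lat x" if "j < deg" for j
  proof -
    have "k j \<le> N"
      unfolding N_def using that by (intro Max_ge) auto
    then have "F.unif ^ N * ibasis j = F.unif ^ (N - k j) * (F.unif ^ k j * ibasis j)"
      by (simp add: mult.assoc[symmetric] power_add[symmetric])
    then show ?thesis
      using scale[OF F.power_int[OF F.unif_int] k[OF that]] by metis
  qed
  have sumW: "sum f I \<in> lat x" if "\<And>i. i \<in> I \<Longrightarrow> f i \<in> lat x" for f and I :: "nat set"
    using that by (induction I rule: infinite_finite_induct) (auto intro: W)
  show ?thesis
  proof (intro exI[of _ N] ballI impI)
    fix y assume y: "y \<in> K" "pnorm y \<le> pnorm F.unif ^ N"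
    then have "y / F.unif ^ N \<in> K.\<O>"
      using F.unif(1,2) by (simp add: K.int_ring_iff F.pnorm_divide F.pnorm_power K.divide_L K.power_L F_K)
    then obtain d where d: "\<And>i. i < deg \<Longrightarrow> d i \<in> F.\<O>" "y / F.unif ^ N = (\<Sum>i<deg. d i * ibasis i)"
      by (rule is_basis_coeffs[OF ibasis(2)]) (rule that)
    have "y = F.unif ^ N * (\<Sum>i<deg. d i * ibasis i)"
      using d(2) by (simp add: field_simps)
    also have "\<dots> = (\<Sum>i<deg. d i * (F.unif ^ N * ibasis i))"
      by (simp add: sum_distrib_left mult_ac)
    also have "\<dots> \<in> lat x"
      using d(1) N by (auto intro!: sumW intro: scale)
    finally show "y \<in> lat x" .
  qed
qed

lemma lat_bounded: "\<exists>B. \<forall>y\<in>lat x. pnorm y \<le> B"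
  using compact_imp_bounded[OF compact_PV[of "deg - 1" x]]
  unfolding lat_def bounded_any_center[of _ 0] by (auto simp: F.dist_eq F.pnorm_diff_commute)

lemma emeasure_lat: "x \<in> K \<Longrightarrow> emeasure (haar K) (lat x) = ennreal (measure (haar K) (lat x))"
  using lat_bounded[of x] K.emeasure_haar_eq_measure lat_sets by blast

lemma lat_pos:
  assumes x: "x \<in> K" "adjoin F x = K"
  shows "0 < measure (haar K) (lat x)"
proof -
  obtain N where N: "\<And>y. y \<in> K \<Longrightarrow> pnorm y \<le> pnorm F.unif ^ N \<Longrightarrow> y \<in> lat x"
    using lat_open[OF x] by blast
  have "K.pball 0 (ram * N) \<subseteq> lat x"
    using N by (auto simp: K.pball_def ram power_mult)
  then have "emeasure (haar K) (K.pball 0 (ram * N)) \<le> emeasure (haar K) (lat x)"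
    by (rule emeasure_mono[OF _ lat_sets[OF x(1)]])
  moreover have "0 < emeasure (haar K) (K.pball 0 (ram * N))"
    using K.resq_ge_2 by (simp add: K.emeasure_haar_pball)
  ultimately have "0 < emeasure (haar K) (lat x)"
    by simp
  then show ?thesis
    unfolding emeasure_lat[OF x(1)] by simp
qed

text \<open>Infinitely many disjoint translates of a scaled copy of \<open>lat x\<close> fit into \<open>\<O>\<^sub>K\<close>.\<close>

lemma lat_null:
  assumes x: "x \<in> K" and ngen: "adjoin F x \<noteq> K"
  shows "measure (haar K) (lat x) = 0"
proof -
  let ?V = "adjoin F x"
  have V_eq: "?V = poly_values F (deg - 1) x"
    by (rule adjoin_F[OF x])
  note V = add_subgroupD[OF add_subgroup_poly_values[OF F.is_subring_L, of "deg - 1" x], folded V_eq]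
  have scaleV: "c * y \<in> ?V" if "c \<in> F" "y \<in> ?V" for c y
    using that poly_values_scale[OF F.is_subring_L] by (simp add: V_eq)
  have "?V \<subseteq> K"
    unfolding V_eq using x by (intro K.poly_values_L) (auto intro: F_K)
  then obtain y0 where y0: "y0 \<in> K" "y0 \<notin> ?V"
    using ngen by blast
  obtain k where k: "F.unif ^ k * y0 \<in> K.\<O>"
    using scale_F_into_KO[OF y0(1)] ..
  define y where "y = F.unif ^ k * y0"
  have yV: "c * y \<notin> ?V" if "c \<in> F" "c \<noteq> 0" for c
  proof
    assume "c * y \<in> ?V"
    then have "(inverse (c * F.unif ^ k)) * (c * y) \<in> ?V"
      by (rule scaleV[rotated]) (use that F.unif(1) in \<open>auto intro!: F.inverse_L F.mult_L F.power_L\<close>)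
    moreover have "inverse (c * F.unif ^ k) * (c * y) = y0"
      using that(2) by (simp add: y_def field_simps)
    ultimately show False
      using y0(2) by simp
  qed
  have lat_V: "lat x \<subseteq> ?V"
    unfolding lat_def V_eq poly_values_def polys_over_def using F.int_ring_L by blast
  obtain B where B: "\<And>z. z \<in> lat x \<Longrightarrow> pnorm z \<le> B"
    using lat_bounded by blast
  have B0: "0 < \<bar>B\<bar> + 1"
    by simp
  then obtain N where N: "pnorm F.unif ^ N < 1 / (\<bar>B\<bar> + 1)"
    using F.unif_power_small[of "1 / (\<bar>B\<bar> + 1)"] by auto
  define T where "T = (*) (F.unif ^ N) ` lat x"
  have uN: "F.unif ^ N \<in> K" "pnorm (F.unif ^ N) = pnorm K.unif ^ (ram * N)"
    using F.unif(1) by (auto intro: F_K F.power_L simp: F.pnorm_power ram power_mult)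
  have TO: "T \<subseteq> K.\<O>"
  proof
    fix z assume "z \<in> T"
    then obtain w where w: "z = F.unif ^ N * w" "w \<in> lat x"
      by (auto simp: T_def)
    have "pnorm z \<le> (1 / (\<bar>B\<bar> + 1)) * (\<bar>B\<bar> + 1)"
      unfolding w F.pnorm_mult F.pnorm_power using N B[OF w(2)] by (intro mult_mono) auto
    then have "pnorm z \<le> 1"
      using B0 by simp
    then show "z \<in> K.\<O>"
      using w lat_K[OF x] uN by (auto simp: K.int_ring_iff intro!: K.mult_L)
  qed
  have Ts: "T \<in> sets (haar K)"
    "emeasure (haar K) T = ennreal (1 / real K.resq ^ (ram * N)) * emeasure (haar K) (lat x)"
    unfolding T_def using K.haar_scale_int[OF uN lat_sets[OF x]] by auto
  have TV: "u \<in> ?V" if "u \<in> T" for u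
    using that lat_V F.unif(1) by (auto simp: T_def intro!: scaleV F.power_L)
  have "real n * measure (haar K) T \<le> 1" for n
  proof -
    define C where "C = (\<lambda>j. (+) (F.unif ^ j * y) ` T) ` {..<n}"
    have key: "i = j" if "(F.unif ^ i * y) + u = F.unif ^ j * y + w" "u \<in> T" "w \<in> T" for i j u w
    proof -
      have "(F.unif ^ i - F.unif ^ j) * y = w - u"
        using that(1) by (simp add: algebra_simps)
      then have "(F.unif ^ i - F.unif ^ j) * y \<in> ?V"
        using V(2) TV that by metis
      then have eq: "F.unif ^ i = F.unif ^ j"
        using yV[of "F.unif ^ i - F.unif ^ j"] F.unif(1) by (auto intro: F.diff_L F.power_L)
      then have "pnorm F.unif ^ i = pnorm F.unif ^ j"
        by (metis F.pnorm_power)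
      then show ?thesis
        using F.unif(2,3) by (metis power_strict_decreasing linorder_neqE_nat less_irrefl)
    qed
    have T0: "0 \<in> T"
      using add_subgroupD(1)[OF add_subgroup_PV[of "deg - 1" x]] by (force simp: T_def lat_def)
    have inj: "inj_on (\<lambda>j. (+) (F.unif ^ j * y) ` T) {..<n}"
    proof (rule inj_onI)
      fix i j assume "(+) (F.unif ^ i * y) ` T = (+) (F.unif ^ j * y) ` T"
      then have "F.unif ^ i * y + 0 \<in> (+) (F.unif ^ j * y) ` T"
        using T0 by (metis imageI)
      then obtain w where "F.unif ^ i * y + 0 = F.unif ^ j * y + w" "w \<in> T"
        by blast
      then show "i = j"
        using key T0 by blast
    qed
    have "disjoint C"
      unfolding C_def disjoint_def using key by blast
    moreover have "\<exists>a\<in>K.\<O>. A = (+) a ` T" if A: "A \<in> C" for A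
    proof -
      obtain j where "A = (+) (F.unif ^ j * y) ` T"
        using A by (auto simp: C_def)
      moreover have "F.unif ^ j * y \<in> K.\<O>"
        using k FO_KO[OF F.power_int[OF F.unif_int]] by (auto simp: y_def intro: K.mult_int)
      ultimately show ?thesis
        by blast
    qed
    ultimately have "real (card C) * measure (haar K) T \<le> 1"
      using K.measure_haar_sum_translates[OF Ts(1) TO, of C] K.measure_haar_subset_O[of "\<Union> C"]
      by (simp add: C_def)
    then show ?thesis
      using card_image[OF inj] by (simp add: C_def)
  qed
  then have "measure (haar K) T = 0"
    using reals_Archimedean3[of "measure (haar K) T"] by (smt (verit) measure_nonneg)
  moreover have "measure (haar K) T = 1 / real K.resq ^ (ram * N) * measure (haar K) (lat x)"
    unfolding measure_def Ts(2) by (simp add: enn2real_mult)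
  ultimately show ?thesis
    using K.resq_ge_2 by simp
qed

lemma lat_index:
  assumes x: "x \<in> K.\<O>" "adjoin F x = K"
  shows "measure (haar K) (lat x) = 1 / real (quot_card (int_ring K) (adjoin (int_ring F) x))"
proof -
  have "lat x \<subseteq> K.\<O>"
    using x(1) by (auto simp: lat_def poly_values_def polys_over_iff poly_altdef
        intro!: K.sum_int K.mult_int K.power_int intro: FO_KO)
  then have "real (quot_card K.\<O> (lat x)) * measure (haar K) (lat x) = 1"
    using x by (intro K.quot_card_haar lat_sets lat_pos)
      (auto simp: lat_def K.int_ring_L intro: add_subgroup_PV)
  moreover have "adjoin (int_ring F) x = lat x"
    using adjoin_int[OF x(1)] by (simp add: lat_def F.\<O>_def)
  ultimately show ?thesis
    by (simp add: K.\<O>_def) (metis nonzero_eq_divide_eq mult.commute mult_zero_left zero_neq_one)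
qed

end

section \<open>Laws that are uniform on a compact group\<close>

lemma nonpos_levels:
  fixes f :: "'b \<Rightarrow> real"
  shows "{w \<in> A. f w \<le> 0} = (\<Inter>n. {w \<in> A. f w \<le> 1 / real (Suc n)})"
proof (intro equalityI subsetI)
  fix w assume w: "w \<in> (\<Inter>n. {w \<in> A. f w \<le> 1 / real (Suc n)})"
  then have "f w \<le> 1 / real (Suc n)" for n
    by blast
  then have le: "f w \<le> inverse (real (Suc n))" for n
    by (simp only: inverse_eq_divide)
  have "f w \<le> 0"
  proof (rule ccontr)
    assume "\<not> f w \<le> 0"
    then have "0 < f w"
      by simp
    then obtain n where "inverse (real (Suc n)) < f w"
      using reals_Archimedean by blast
    then show False
      using le[of n] by linarith
  qed
  then show "w \<in> {w \<in> A. f w \<le> 0}"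
    using w by blast
next
  fix w assume w: "w \<in> {w \<in> A. f w \<le> 0}"
  then have "f w \<le> 0"
    by simp
  then have "f w \<le> 1 / real (Suc n)" for n
    by (rule order_trans) simp
  then show "w \<in> (\<Inter>n. {w \<in> A. f w \<le> 1 / real (Suc n)})"
    using w by blast
qed

lemma measure_nonpos_level_LIMSEQ:
  fixes f :: "'b \<Rightarrow> real"
  assumes "finite_measure M" "f \<in> borel_measurable M"
  shows "(\<lambda>n. measure M {w \<in> space M. f w \<le> 1 / real (Suc n)}) \<longlonglongrightarrow> measure M {w \<in> space M. f w \<le> 0}"
proof -
  interpret finite_measure M by fact
  note assms(2)[measurable]
  show ?thesis
    unfolding nonpos_levels
  proof (rule finite_Lim_measure_decseq)
    show "decseq (\<lambda>n. {w \<in> space M. f w \<le> 1 / real (Suc n)})"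
    proof (rule decseq_SucI, rule subsetI)
      fix n w assume "w \<in> {w \<in> space M. f w \<le> 1 / real (Suc (Suc n))}"
      moreover have "1 / real (Suc (Suc n)) \<le> 1 / real (Suc n)"
        by (simp add: field_simps)
      ultimately show "w \<in> {w \<in> space M. f w \<le> 1 / real (Suc n)}"
        by auto
    qed
    have "{w \<in> space M. f w \<le> 1 / real (Suc n)} \<in> sets M" for n
      by measurable
    then show "range (\<lambda>n. {w \<in> space M. f w \<le> 1 / real (Suc n)}) \<subseteq> sets M"
      by blast
  qed
qed

text \<open>Only balls of positive radius are open and under control; the level \<open>0\<close> is
  reached as a countable intersection and negative levels are empty.\<close>

lemma borel_measurable_nonneg_levels:
  fixes f :: "'b \<Rightarrow> real"
  assumes nn: "\<And>w. w \<in> space M \<Longrightarrow> 0 \<le> f w"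
    and lev: "\<And>s. 0 < s \<Longrightarrow> {w \<in> space M. f w \<le> s} \<in> sets M"
  shows "f \<in> borel_measurable M"
  unfolding borel_measurable_iff_le
proof
  fix a :: real
  consider "0 < a" | "a < 0" | "a = 0" by linarith
  then show "{w \<in> space M. f w \<le> a} \<in> sets M"
  proof cases
    case 2
    then have "\<not> f w \<le> a" if "w \<in> space M" for w
      using nn[OF that] by linarith
    then have "{w \<in> space M. f w \<le> a} = {}"
      by blast
    then show ?thesis by (metis sets.empty_sets)
  next
    case 3
    show ?thesis
      unfolding 3 nonpos_levels using lev by (intro sets.countable_INT) auto
  qed (rule lev)
qed

text \<open>The law of \<open>f\<close> gives the same mass to all balls of a given radius centred in \<open>W\<close>; for
  \<open>W\<close> a compact group this determines the law of \<open>pnorm f\<close>.\<close>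

definition uniform_on :: "'a::{ab_group_add, metric_space} set \<Rightarrow> 'b measure \<Rightarrow> ('b \<Rightarrow> 'a) \<Rightarrow> bool" where
  "uniform_on W M f \<longleftrightarrow> f \<in> space M \<rightarrow> W \<and> (\<forall>a\<in>W. \<forall>s>0.
     {w \<in> space M. pnorm (f w - a) \<le> s} \<in> sets M \<and>
     measure M {w \<in> space M. pnorm (f w - a) \<le> s} = measure M {w \<in> space M. pnorm (f w) \<le> s})"

context valued_field
begin

lemma uniform_on_measurable:
  assumes "uniform_on (W :: 'a set) M f" "add_subgroup W"
  shows "(\<lambda>w. pnorm (f w)) \<in> borel_measurable M"
proof (rule borel_measurable_nonneg_levels)
  fix s :: real assume "0 < s"
  then have "{w \<in> space M. pnorm (f w - 0) \<le> s} \<in> sets M"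
    using assms add_subgroupD(1)[OF assms(2)] unfolding uniform_on_def by blast
  then show "{w \<in> space M. pnorm (f w) \<le> s} \<in> sets M"
    by simp
qed simp

text \<open>The space splits into the preimages of the cosets of a ball, all of the same mass. Their
  number depends only on \<open>W\<close> and \<open>s\<close>, so the law of \<open>pnorm f\<close>
  does as well, up to total mass.\<close>

lemma uniform_on_level:
  assumes u: "uniform_on (W :: 'a set) M f" and W: "compact W" and fin: "finite_measure M" and s: "0 < s"
  shows "real (card (ball_cosets W s)) * measure M {w \<in> space M. pnorm (f w) \<le> s} = measure M (space M)"
proof -
  interpret finite_measure M by fact
  let ?p = "\<lambda>C. f -` C \<inter> space M"
  have fW: "f w \<in> W" if "w \<in> space M" for w
    using u that by (auto simp: uniform_on_def)
  have C: "?p C \<in> sets M \<and> measure M (?p C) = measure M {w \<in> space M. pnorm (f w) \<le> s}"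
    if C': "C \<in> ball_cosets W s" for C
  proof -
    from C' obtain a where a: "a \<in> W" "C = {y \<in> W. pnorm (y - a) \<le> s}"
      unfolding ball_cosets_def by blast
    then have "?p C = {w \<in> space M. pnorm (f w - a) \<le> s}"
      using fW by auto
    then show ?thesis
      using u a(1) s by (simp add: uniform_on_def)
  qed
  have "measure M (space M) = measure M (\<Union>C\<in>ball_cosets W s. ?p C)"
  proof -
    have "(\<Union>C\<in>ball_cosets W s. ?p C) = f -` \<Union> (ball_cosets W s) \<inter> space M"
      by blast
    also have "\<dots> = space M"
      using fW s by (auto simp: Union_ball_cosets)
    finally show ?thesis by simp
  qed
  also have "\<dots> = (\<Sum>C\<in>ball_cosets W s. measure M (?p C))"
  proof (rule finite_measure_finite_Union)
    show "finite (ball_cosets W s)"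
      by (rule finite_ball_cosets[OF W s])
    show "disjoint_family_on ?p (ball_cosets W s)"
      using disjoint_ball_cosets[of W s] unfolding disjoint_family_on_def disjoint_def by blast
  qed (use C in blast)
  also have "\<dots> = real (card (ball_cosets W s)) * measure M {w \<in> space M. pnorm (f w) \<le> s}"
    using C by simp
  finally show ?thesis by simp
qed

text \<open>Equality of the level masses for positive radii passes to radius \<open>0\<close> by
  continuity from above; the distribution functions then agree, hence so do the laws and all
  moments.\<close>

lemma uniform_on_expectation:
  assumes u: "uniform_on (W :: 'a set) M f" "uniform_on W N g" and W: "compact W" "add_subgroup W"
    and fin: "finite_measure M" "finite_measure N"
  shows "measure N (space N) * (\<integral>w. pnorm (f w) ^ r \<partial>M) = measure M (space M) * (\<integral>w. pnorm (g w) ^ r \<partial>N)"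
proof -
  interpret M: finite_measure M by fact
  interpret N: finite_measure N by fact
  define X where "X = (\<lambda>w. pnorm (f w))"
  define Y where "Y = (\<lambda>w. pnorm (g w))"
  have mX[measurable]: "X \<in> borel_measurable M" and mY[measurable]: "Y \<in> borel_measurable N"
    unfolding X_def Y_def using u W(2) uniform_on_measurable by auto
  have pos: "measure N (space N) * measure M {w \<in> space M. X w \<le> s} = measure M (space M) * measure N {w \<in> space N. Y w \<le> s}"
    if "0 < s" for s
  proof -
    let ?c = "real (card (ball_cosets W s))"
    have e: "?c * measure M {w \<in> space M. X w \<le> s} = measure M (space M)"
      "?c * measure N {w \<in> space N. Y w \<le> s} = measure N (space N)"
      unfolding X_def Y_def
      by (rule uniform_on_level[OF u(1) W(1) fin(1) that], rule uniform_on_level[OF u(2) W(1) fin(2) that])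
    have "measure N (space N) * measure M {w \<in> space M. X w \<le> s} =
        (?c * measure N {w \<in> space N. Y w \<le> s}) * measure M {w \<in> space M. X w \<le> s}"
      by (simp only: e)
    also have "\<dots> = (?c * measure M {w \<in> space M. X w \<le> s}) * measure N {w \<in> space N. Y w \<le> s}"
      by (simp only: mult_ac)
    finally show ?thesis
      by (simp only: e)
  qed
  have levels: "measure N (space N) * measure M {w \<in> space M. X w \<le> s} = measure M (space M) * measure N {w \<in> space N. Y w \<le> s}" for s
  proof -
    consider "0 < s" | "s < 0" | "s = 0" by linarith
    then show ?thesis
    proof cases
      case 2
      have "\<not> X w \<le> s" for w
        using 2 pnorm_nonneg[of "f w"] unfolding X_def by linarith
      moreover have "\<not> Y v \<le> s" for v
        using 2 pnorm_nonneg[of "g v"] unfolding Y_def by linarith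
      ultimately show ?thesis by simp
    next
      case 3
      have lim1: "(\<lambda>n. measure N (space N) * measure M {w \<in> space M. X w \<le> 1 / real (Suc n)}) \<longlonglongrightarrow>
          measure N (space N) * measure M {w \<in> space M. X w \<le> 0}"
        by (intro tendsto_mult_left measure_nonpos_level_LIMSEQ fin mX)
      have lim2: "(\<lambda>n. measure M (space M) * measure N {w \<in> space N. Y w \<le> 1 / real (Suc n)}) \<longlonglongrightarrow>
          measure M (space M) * measure N {w \<in> space N. Y w \<le> 0}"
        by (intro tendsto_mult_left measure_nonpos_level_LIMSEQ fin mY)
      have eq: "measure N (space N) * measure M {w \<in> space M. X w \<le> 1 / real (Suc n)} =
          measure M (space M) * measure N {w \<in> space N. Y w \<le> 1 / real (Suc n)}" for n
        by (rule pos) simp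
      show ?thesis
        unfolding 3 by (rule LIMSEQ_unique[OF lim1[unfolded eq] lim2])
    qed (rule pos)
  qed
  \<comment> \<open>Each law is scaled by the total mass of the other. This equalizes total masses
    without dividing, so a zero measure is covered as well.\<close>
  let ?A = "scale_measure (ennreal (measure N (space N))) (distr M borel X)"
  let ?B = "scale_measure (ennreal (measure M (space M))) (distr N borel Y)"
  have fA: "finite_borel_measure ?A"
  proof (intro finite_borel_measure.intro finite_measureI finite_borel_measure_axioms.intro)
    show "emeasure ?A (space ?A) \<noteq> \<infinity>"
      by (simp add: space_scale_measure emeasure_distr ennreal_mult_eq_top_iff M.emeasure_finite)
  qed simp
  have fB: "finite_borel_measure ?B"
  proof (intro finite_borel_measure.intro finite_measureI finite_borel_measure_axioms.intro)
    show "emeasure ?B (space ?B) \<noteq> \<infinity>"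
      by (simp add: space_scale_measure emeasure_distr ennreal_mult_eq_top_iff N.emeasure_finite)
  qed simp
  have "?A = ?B"
  proof (rule cdf_unique'[OF fA fB], rule ext)
    fix s :: real
    have "X -` {..s} \<inter> space M = {w \<in> space M. X w \<le> s}" "Y -` {..s} \<inter> space N = {w \<in> space N. Y w \<le> s}"
      by auto
    then show "cdf ?A s = cdf ?B s"
      using levels[of s]
      by (simp add: cdf_def measure_def emeasure_distr enn2real_mult)
  qed
  then have "(\<integral>\<^sup>+ y. ennreal (y ^ r) \<partial>?A) = (\<integral>\<^sup>+ y. ennreal (y ^ r) \<partial>?B)"
    by simp
  then have "ennreal (measure N (space N)) * (\<integral>\<^sup>+ w. ennreal (X w ^ r) \<partial>M) = ennreal (measure M (space M)) * (\<integral>\<^sup>+ w. ennreal (Y w ^ r) \<partial>N)"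
    by (simp add: nn_integral_scale_measure nn_integral_distr)
  then have "enn2real (ennreal (measure N (space N)) * (\<integral>\<^sup>+ w. ennreal (X w ^ r) \<partial>M)) = enn2real (ennreal (measure M (space M)) * (\<integral>\<^sup>+ w. ennreal (Y w ^ r) \<partial>N))"
    by simp
  then have "measure N (space N) * (\<integral>w. X w ^ r \<partial>M) = measure M (space M) * (\<integral>w. Y w ^ r \<partial>N)"
    by (subst (1 2) integral_eq_nn_integral) (auto simp: enn2real_mult X_def Y_def
        intro!: borel_measurable_power mX[unfolded X_def] mY[unfolded Y_def])
  then show ?thesis
    by (simp add: X_def Y_def)
qed

lemma uniform_on_cmult:
  assumes u: "uniform_on W M f" and c: "(c :: 'a) \<noteq> 0"
  shows "uniform_on ((*) c ` W) M (\<lambda>w. c * f w)"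
proof -
  have eq: "pnorm (c * f w - c * a) \<le> s \<longleftrightarrow> pnorm (f w - a) \<le> s / pnorm c" for w a s
  proof -
    have "pnorm (c * f w - c * a) = pnorm (f w - a) * pnorm c"
      by (simp add: right_diff_distrib[symmetric] pnorm_mult)
    then show ?thesis
      using c by (simp add: pos_le_divide_eq)
  qed
  have eq0: "pnorm (c * f w) \<le> s \<longleftrightarrow> pnorm (f w) \<le> s / pnorm c" for w s
    using eq[of w 0 s] by simp
  show ?thesis
    using u c unfolding uniform_on_def by (auto simp: eq eq0)
qed

end

section \<open>Random polynomials with integral coefficients\<close>

context local_field
begin

definition oM :: "'a measure" where "oM = restrict_space (haar L) (int_ring L)"

lemma space_oM [simp]: "space oM = \<O>"
  using int_ring_L by (auto simp: oM_def space_restrict_space simp flip: \<O>_def)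

lemma sets_oM: "A \<in> sets oM \<longleftrightarrow> A \<subseteq> \<O> \<and> A \<in> sets (haar L)"
  unfolding oM_def using O_sets_haar int_ring_L
  by (subst sets_restrict_space_iff) (auto simp flip: \<O>_def simp: Int_absorb2 subset_iff)

lemma emeasure_oM: "A \<subseteq> \<O> \<Longrightarrow> emeasure oM A = emeasure (haar L) A"
  unfolding oM_def using O_sets_haar int_ring_L
  by (subst emeasure_restrict_space) (auto simp flip: \<O>_def simp: Int_absorb2 subset_iff)

lemma prob_space_oM: "prob_space oM"
  by standard (simp add: emeasure_oM emeasure_haar_O)

lemma Omega_eq: "Omega L m = PiM {..m} (\<lambda>_. oM)"
  by (simp add: Omega_def oM_def)

lemma space_Omega: "space (Omega L m) = {..m} \<rightarrow>\<^sub>E \<O>"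
  by (simp add: Omega_eq space_PiM)

lemma finite_product_prob_space_oM: "finite_product_prob_space (\<lambda>_. oM) {..m::nat}"
proof -
  interpret prob_space oM by (rule prob_space_oM)
  show ?thesis
    by unfold_locales auto
qed

lemma prob_space_Omega: "prob_space (Omega L m)"
proof -
  interpret finite_product_prob_space "\<lambda>_. oM" "{..m}" by (rule finite_product_prob_space_oM)
  show ?thesis
    unfolding Omega_eq by unfold_locales
qed

lemma pball_sets_oM:
  assumes "a \<in> \<O>" shows "pball a k \<in> sets oM"
proof -
  have "pball a k \<subseteq> \<O>"
    unfolding coset_O[OF assms, symmetric] by blast
  then show ?thesis
    using assms by (simp add: sets_oM sets_haar pball_sets int_ring_L)
qed

text \<open>Events that depend only on the coefficients modulo a power of the uniformizer are finite
  unions of boxes.\<close>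

lemma Omega_sets_locally_constant:
  assumes loc: "\<And>c c'. c \<in> space (Omega L m) \<Longrightarrow> c' \<in> space (Omega L m) \<Longrightarrow>
      (\<And>i. i \<le> m \<Longrightarrow> pnorm (c i - c' i) \<le> pnorm unif ^ k) \<Longrightarrow> P c \<Longrightarrow> P c'"
  shows "{c \<in> space (Omega L m). P c} \<in> sets (Omega L m)"
proof -
  let ?B = "ball_cosets \<O> (pnorm unif ^ k)"
  define \<D> where "\<D> = {D \<in> {..m} \<rightarrow>\<^sub>E ?B. \<exists>c\<in>{..m} \<rightarrow>\<^sub>E \<O>. P c \<and> (\<forall>i\<le>m. c i \<in> D i)}"
  have \<D>I: "D \<in> \<D>" if "D \<in> {..m} \<rightarrow>\<^sub>E ?B" "c \<in> {..m} \<rightarrow>\<^sub>E \<O>" "P c" "\<And>i. i \<le> m \<Longrightarrow> c i \<in> D i" for D c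
    unfolding \<D>_def using that by blast
  have B: "C \<in> sets oM \<and> C \<subseteq> \<O>" if C: "C \<in> ?B" for C
  proof -
    from C obtain a where "a \<in> \<O>" "C = pball a k"
      using coset_O unfolding ball_cosets_def by blast
    then show ?thesis
      using pball_sets_oM[of a k] by (auto simp: sets_oM)
  qed
  have near: "pnorm (y - z) \<le> pnorm unif ^ k" if C: "C \<in> ?B" "y \<in> C" "z \<in> C" for C y z
  proof -
    from C obtain a where "pnorm (y - a) \<le> pnorm unif ^ k" "pnorm (z - a) \<le> pnorm unif ^ k"
      unfolding ball_cosets_def by blast
    then show ?thesis
      using pnorm_sub_le[of "y - a" _ "z - a"] by simp
  qed
  have "{c \<in> space (Omega L m). P c} = (\<Union>D\<in>\<D>. PiE {..m} D)"
  proof (intro equalityI subsetI)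
    fix c assume c: "c \<in> {c \<in> space (Omega L m). P c}"
    define D where "D = (\<lambda>i\<in>{..m}. {y \<in> \<O>. pnorm (y - c i) \<le> pnorm unif ^ k})"
    have ci: "c i \<in> \<O>" if "i \<le> m" for i
      using c that by (auto simp: space_Omega)
    have "D \<in> {..m} \<rightarrow>\<^sub>E ?B"
      using ci by (auto simp: D_def ball_cosets_def)
    moreover have "c i \<in> D i" if "i \<le> m" for i
      using ci that unif(2) by (simp add: D_def)
    moreover have "c \<in> {..m} \<rightarrow>\<^sub>E \<O>" "P c"
      using c by (auto simp: space_Omega)
    ultimately have "D \<in> \<D>" "c \<in> PiE {..m} D"
      using \<D>I[of D c] by (auto simp: PiE_iff)
    then show "c \<in> (\<Union>D\<in>\<D>. PiE {..m} D)"
      by blast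
  next
    fix c assume "c \<in> (\<Union>D\<in>\<D>. PiE {..m} D)"
    then obtain D where "D \<in> \<D>" "c \<in> PiE {..m} D"
      by blast
    then obtain c0 where D: "D \<in> {..m} \<rightarrow>\<^sub>E ?B" "c \<in> PiE {..m} D" "c0 \<in> {..m} \<rightarrow>\<^sub>E \<O>" "P c0" "\<forall>i\<le>m. c0 i \<in> D i"
      unfolding \<D>_def by blast
    have "c i \<in> \<O>" if "i \<le> m" for i
    proof -
      have "D i \<in> ?B" "c i \<in> D i"
        using D(1,2) that by (auto simp: PiE_iff)
      then show ?thesis
        using B by blast
    qed
    then have "c \<in> {..m} \<rightarrow>\<^sub>E \<O>"
      using D(2) by (simp add: PiE_iff)
    moreover have "pnorm (c0 i - c i) \<le> pnorm unif ^ k" if "i \<le> m" for i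
      using D(1,2,5) that by (intro near[of "D i"]) (auto simp: PiE_iff)
    ultimately show "c \<in> {c \<in> space (Omega L m). P c}"
      using loc[of c0 c] D(3,4) by (simp add: space_Omega)
  qed
  also have "\<dots> \<in> sets (Omega L m)"
  proof (rule sets.finite_UN)
    have "finite ({..m} \<rightarrow>\<^sub>E ?B)"
      using unif(2) by (intro finite_PiE finite_ball_cosets compact_O) auto
    then show "finite \<D>"
      unfolding \<D>_def by simp
    show "PiE {..m} D \<in> sets (Omega L m)" if "D \<in> \<D>" for D
      unfolding Omega_eq using that B unfolding \<D>_def by (intro sets_PiM_I_finite) (auto simp: PiE_iff)
  qed
  finally show ?thesis .
qed

lemma translate_oM:
  assumes "a \<in> \<O>"
  shows "(\<lambda>y. y + a) \<in> measurable oM oM" "\<And>A. A \<in> sets oM \<Longrightarrow> emeasure oM ((\<lambda>y. y + a) -` A \<inter> \<O>) = emeasure oM A"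
proof -
  have im: "(\<lambda>y. y + a) -` A \<inter> \<O> = (+) (- a) ` A" if "A \<subseteq> \<O>" for A
  proof (intro equalityI subsetI)
    fix y assume "y \<in> (\<lambda>y. y + a) -` A \<inter> \<O>"
    then show "y \<in> (+) (- a) ` A"
      by (intro image_eqI[of _ _ "y + a"]) auto
  qed (use that assms add_int[OF minus_int[OF assms]] in auto)
  have tr: "(+) (- a) ` A \<in> sets oM" if A: "A \<in> sets oM" for A
  proof -
    have AO: "A \<subseteq> \<O>" "A \<in> sets (haar L)"
      using A by (auto simp: sets_oM)
    have "(+) (- a) ` A = (\<lambda>y. y - - a) -` A \<inter> space (haar L)"
      using translate_image[of "- a" A] AO(1) assms int_ring_L minus_int by auto
    also have "\<dots> \<in> sets (haar L)"
      using translate_measurable[OF int_ring_L[OF minus_int[OF assms]] sets_haar] AO(2)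
      by (rule measurable_sets[OF _ iffD1[OF arg_cong2[where f = "(\<in>)", OF refl sets_haar]]])
    finally show ?thesis
      using AO(1) assms add_int[OF minus_int[OF assms]] by (auto simp: sets_oM)
  qed
  show "(\<lambda>y. y + a) \<in> measurable oM oM"
  proof (rule measurableI)
    show "y + a \<in> space oM" if "y \<in> space oM" for y
      using that assms by (auto intro: add_int)
    show "(\<lambda>y. y + a) -` A \<inter> space oM \<in> sets oM" if "A \<in> sets oM" for A
      using tr[OF that] im[of A] that by (simp add: sets_oM)
  qed
  show "emeasure oM ((\<lambda>y. y + a) -` A \<inter> \<O>) = emeasure oM A" if "A \<in> sets oM" for A
    using that im[of A] tr[OF that] haar_invariant[OF int_ring_L[OF minus_int[OF assms]], of A]
    by (auto simp: sets_oM emeasure_oM)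
qed

lemma Omega_translate:
  assumes R: "R \<in> space (Omega L m)"
  defines "t \<equiv> \<lambda>c. \<lambda>i\<in>{..m}. c i + R i"
  shows "t \<in> measurable (Omega L m) (Omega L m)" "distr (Omega L m) (Omega L m) t = Omega L m"
proof -
  interpret finite_product_prob_space "\<lambda>_. oM" "{..m}" by (rule finite_product_prob_space_oM)
  have Ri: "R i \<in> \<O>" if "i \<le> m" for i
    using R that by (auto simp: space_Omega)
  show t: "t \<in> measurable (Omega L m) (Omega L m)"
    unfolding t_def Omega_eq
  proof (rule measurable_restrict)
    fix i assume "i \<in> {..m}"
    then show "(\<lambda>c. c i + R i) \<in> measurable (PiM {..m} (\<lambda>_. oM)) oM"
      using measurable_compose[OF measurable_component_singleton[of i "{..m}" "\<lambda>_. oM"] translate_oM(1)[OF Ri[of i]]]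
      by simp
  qed
  show "distr (Omega L m) (Omega L m) t = Omega L m"
    unfolding Omega_eq
  proof (rule PiM_eqI)
    fix A assume A: "\<And>i. i \<in> {..m} \<Longrightarrow> A i \<in> sets oM"
    let ?B = "\<lambda>i. (\<lambda>y. y + R i) -` A i \<inter> \<O>"
    have B: "?B i \<in> sets oM" if "i \<in> {..m}" for i
      using measurable_sets[OF translate_oM(1) A[OF that]] Ri that by simp
    have "t -` PiE {..m} A \<inter> space (PiM {..m} (\<lambda>_. oM)) = PiE {..m} ?B"
      by (auto simp: t_def space_PiM PiE_iff)
    then have "emeasure (distr (PiM {..m} (\<lambda>_. oM)) (PiM {..m} (\<lambda>_. oM)) t) (PiE {..m} A) = emeasure (PiM {..m} (\<lambda>_. oM)) (PiE {..m} ?B)"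
      using t A unfolding Omega_eq by (subst emeasure_distr) (auto intro!: sets_PiM_I_finite)
    also have "\<dots> = (\<Prod>i\<in>{..m}. emeasure oM (?B i))"
      using B by (intro emeasure_PiM) auto
    also have "\<dots> = (\<Prod>i\<in>{..m}. emeasure oM (A i))"
      using A Ri translate_oM(2) by (intro prod.cong) auto
    finally show "emeasure (distr (PiM {..m} (\<lambda>_. oM)) (PiM {..m} (\<lambda>_. oM)) t) (PiE {..m} A) = (\<Prod>i\<in>{..m}. emeasure oM (A i))" .
  qed auto
qed

lemma poly_values_image: "poly_values \<O> m x = (\<lambda>c. poly (poly_of m c) x) ` space (Omega L m)"
proof (intro equalityI subsetI)
  fix y assume "y \<in> poly_values \<O> m x"
  then obtain c where c: "\<forall>i<Suc m. c i \<in> \<O>" "y = (\<Sum>i<Suc m. c i * x ^ i)"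
    by (auto simp: poly_values_eq_lincomb_set lincomb_set_def)
  then show "y \<in> (\<lambda>c. poly (poly_of m c) x) ` space (Omega L m)"
    by (intro image_eqI[of _ _ "restrict c {..m}"]) (auto simp: space_Omega poly_poly_of lessThan_Suc_atMost
        simp del: sum.lessThan_Suc)
next
  fix y assume "y \<in> (\<lambda>c. poly (poly_of m c) x) ` space (Omega L m)"
  then show "y \<in> poly_values \<O> m x"
    unfolding poly_values_eq_lincomb_set[OF zero_int] lincomb_set_def
    by (auto simp: space_Omega poly_poly_of lessThan_Suc_atMost[symmetric] simp del: sum.lessThan_Suc)
qed

text \<open>The powers of \<open>x\<close> up to \<open>m\<close> are bounded by a constant, so a
  small change of the coefficients changes the value little, uniformly in them. Events given by
  balls are therefore locally constant in the coefficients.\<close>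

lemma poly_of_close:
  fixes x :: 'a
  assumes "0 < s"
  shows "\<exists>k. \<forall>(c :: nat \<Rightarrow> 'a) c'. (\<forall>i\<le>m. pnorm (c i - c' i) \<le> pnorm unif ^ k) \<longrightarrow>
    pnorm (poly (poly_of m c) x - poly (poly_of m c') x) \<le> s"
proof -
  define B where "B = (max 1 (pnorm x)) ^ m"
  have B0: "0 < B"
    by (simp add: B_def)
  have B: "pnorm x ^ i \<le> B" if "i \<le> m" for i
  proof -
    have "pnorm x ^ i \<le> (max 1 (pnorm x)) ^ i"
      by (intro power_mono) auto
    also have "\<dots> \<le> B"
      unfolding B_def using that by (intro power_increasing) auto
    finally show "pnorm x ^ i \<le> B" .
  qed
  obtain k where k: "pnorm unif ^ k < s / B"
    using unif_power_small[of "s / B"] assms B0 by auto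
  show ?thesis
  proof (intro exI[of _ k] allI impI)
    fix c c' :: "nat \<Rightarrow> 'a" assume c: "\<forall>i\<le>m. pnorm (c i - c' i) \<le> pnorm unif ^ k"
    have "poly (poly_of m c) x - poly (poly_of m c') x = (\<Sum>i\<le>m. (c i - c' i) * x ^ i)"
      by (simp add: poly_poly_of left_diff_distrib sum_subtractf)
    also have "pnorm \<dots> \<le> s"
    proof (rule pnorm_sum_le)
      fix i assume i: "i \<in> {..m}"
      have "pnorm (c i - c' i) * pnorm x ^ i \<le> (s / B) * B"
        using c i k B B0 assms by (intro mult_mono) (auto intro: order_trans[OF _ less_imp_le])
      then show "pnorm ((c i - c' i) * x ^ i) \<le> s"
        using B0 by (simp add: pnorm_mult pnorm_power)
    qed (use assms in simp)
    finally show "pnorm (poly (poly_of m c) x - poly (poly_of m c') x) \<le> s" .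
  qed
qed

lemma ball_event_sets:
  fixes x a :: 'a
  assumes "0 < s"
  shows "{c \<in> space (Omega L m). pnorm (poly (poly_of m c) x - a) \<le> s} \<in> sets (Omega L m)"
proof -
  obtain k where k: "\<And>c c'. (\<forall>i\<le>m. pnorm (c i - c' i) \<le> pnorm unif ^ k) \<Longrightarrow>
      pnorm (poly (poly_of m c) x - poly (poly_of m c') x) \<le> s"
    using poly_of_close[OF assms] by blast
  show ?thesis
  proof (rule Omega_sets_locally_constant)
    fix c c' :: "nat \<Rightarrow> 'a" assume "\<And>i. i \<le> m \<Longrightarrow> pnorm (c i - c' i) \<le> pnorm unif ^ k"
      and "pnorm (poly (poly_of m c) x - a) \<le> s"
    then show "pnorm (poly (poly_of m c') x - a) \<le> s"
      using k[of c c'] pnorm_triangle_le[of "poly (poly_of m c') x" "poly (poly_of m c) x" s a]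
      by (simp add: pnorm_diff_commute)
  qed
qed

lemma pnorm_poly_measurable:
  "(\<lambda>c. pnorm (poly (poly_of m c) x - a :: 'a)) \<in> borel_measurable (Omega L m)"
  by (rule borel_measurable_nonneg_levels) (auto intro: ball_event_sets)

lemma poly_of_translate:
  "poly (poly_of m (\<lambda>i\<in>{..m}. c i + R i)) x = poly (poly_of m c) x + poly (poly_of m R) x"
  by (simp add: poly_poly_of distrib_right sum.distrib)

text \<open>A point \<open>a\<close> of the group is the value of some coefficient vector
  \<open>R\<close>; adding \<open>R\<close> preserves the product measure and shifts the value by
  \<open>a\<close>.\<close>

lemma uniform_on_poly_values: "uniform_on (poly_values \<O> m x) (Omega L m) (\<lambda>c. poly (poly_of m c) x)"
  unfolding uniform_on_def
proof (intro conjI ballI allI impI)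
  show "(\<lambda>c. poly (poly_of m c) x) \<in> space (Omega L m) \<rightarrow> poly_values \<O> m x"
    unfolding poly_values_image by blast
  fix a s assume "a \<in> poly_values \<O> m x" and s: "(0::real) < s"
  then obtain R where R: "R \<in> space (Omega L m)" "a = poly (poly_of m R) x"
    unfolding poly_values_image by blast
  show S: "{c \<in> space (Omega L m). pnorm (poly (poly_of m c) x - a) \<le> s} \<in> sets (Omega L m)"
    by (rule ball_event_sets[OF s])
  let ?t = "\<lambda>c. \<lambda>i\<in>{..m}. c i + R i"
  note t = Omega_translate[OF R(1)]
  have "?t -` {c \<in> space (Omega L m). pnorm (poly (poly_of m c) x - a) \<le> s} \<inter> space (Omega L m) =
      {c \<in> space (Omega L m). pnorm (poly (poly_of m c) x) \<le> s}"
    using measurable_space[OF t(1)] by (auto simp: poly_of_translate R(2))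
  then show "measure (Omega L m) {c \<in> space (Omega L m). pnorm (poly (poly_of m c) x - a) \<le> s} =
      measure (Omega L m) {c \<in> space (Omega L m). pnorm (poly (poly_of m c) x) \<le> s}"
    using measure_distr[OF t(1) S] unfolding t(2) by simp
qed

definition mean_power :: "nat \<Rightarrow> nat \<Rightarrow> 'a \<Rightarrow> real" where
  "mean_power r m x = (\<integral>c. pnorm (poly (poly_of m c) x) ^ r \<partial>Omega L m)"

text \<open>Allows \<open>mean_power\<close> to be computed with any uniform source: polynomials of
  another degree, polynomials in a homographic image of \<open>x\<close>, or Haar measure on the
  lattice.\<close>

lemma mean_power_unique:
  assumes "uniform_on (poly_values \<O> m x) M f" "finite_measure M"
  shows "(\<integral>w. pnorm (f w) ^ r \<partial>M) = measure M (space M) * mean_power r m x"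
proof -
  interpret prob_space "Omega L m" by (rule prob_space_Omega)
  have "measure (Omega L m) (space (Omega L m)) * (\<integral>w. pnorm (f w) ^ r \<partial>M) = measure M (space M) * mean_power r m x"
    unfolding mean_power_def
  proof (rule uniform_on_expectation[OF assms(1) uniform_on_poly_values])
    show "compact (poly_values \<O> m x)"
      by (rule compact_poly_values[OF compact_O zero_int])
    show "add_subgroup (poly_values \<O> m x)"
      by (rule add_subgroup_poly_values[OF is_subring_O])
  qed (rule assms, unfold_locales)
  then show ?thesis
    by (simp add: prob_space)
qed

lemma uniform_on_restrict_haar:
  assumes W: "W \<subseteq> L" "add_subgroup W" "W \<in> sets (haar L)"
  shows "uniform_on W (restrict_space (haar L) W) (\<lambda>t. t)"
  unfolding uniform_on_def
proof (intro conjI ballI allI impI)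
  have sp: "space (restrict_space (haar L) W) = W"
    using W by (auto simp: space_restrict_space)
  show "(\<lambda>t. t) \<in> space (restrict_space (haar L) W) \<rightarrow> W"
    using sp by simp
  have meas: "{t \<in> W. pnorm (t - a) \<le> s} \<in> sets (haar L)" for a s
  proof -
    have "{t \<in> W. pnorm (t - a) \<le> s} = W \<inter> ({t. pnorm (t - a) \<le> s} \<inter> L)"
      using W by auto
    also have "\<dots> \<in> sets (haar L)"
      using W(3) borel_closed[OF closed_pnorm_le] borel_closed[OF closed_L]
      by (intro sets.Int W sets_haarI) auto
    finally show ?thesis .
  qed
  fix a s assume a: "a \<in> W" and s: "(0::real) < s"
  show "{w \<in> space (restrict_space (haar L) W). pnorm (w - a) \<le> s} \<in> sets (restrict_space (haar L) W)"
    using meas W by (subst sets_restrict_space_iff) (auto simp: sp Int_absorb2)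
  have "{t \<in> W. pnorm (t - a) \<le> s} = (+) a ` {t \<in> W. pnorm t \<le> s}"
  proof (intro equalityI subsetI)
    fix t assume "t \<in> {t \<in> W. pnorm (t - a) \<le> s}"
    then show "t \<in> (+) a ` {t \<in> W. pnorm t \<le> s}"
      using a add_subgroupD[OF W(2)] by (intro image_eqI[of _ _ "t - a"]) auto
  qed (use a add_subgroupD[OF W(2)] in auto)
  moreover have "emeasure (haar L) ((+) a ` {t \<in> W. pnorm t \<le> s}) = emeasure (haar L) {t \<in> W. pnorm t \<le> s}"
    using meas[of 0 s] a W(1) by (intro haar_invariant) auto
  ultimately have "measure (haar L) {t \<in> W. pnorm (t - a) \<le> s} = measure (haar L) {t \<in> W. pnorm t \<le> s}"
    by (simp add: measure_def)
  then show "measure (restrict_space (haar L) W) {w \<in> space (restrict_space (haar L) W). pnorm (w - a) \<le> s} =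
      measure (restrict_space (haar L) W) {w \<in> space (restrict_space (haar L) W). pnorm w \<le> s}"
    using W by (simp add: sp measure_restrict_space Int_absorb2)
qed

end

section \<open>Growth of the mean with the degree\<close>

context local_field
begin

definition mean_shift :: "nat \<Rightarrow> nat \<Rightarrow> 'a \<Rightarrow> 'a \<Rightarrow> real" where
  "mean_shift r m x a = (\<integral>c. pnorm (poly (poly_of m c) x + a) ^ r \<partial>Omega L m)"

lemma pnorm_shift_measurable:
  "(\<lambda>c. pnorm (poly (poly_of m c) x + a :: 'a)) \<in> borel_measurable (Omega L m)"
  using pnorm_poly_measurable[of m x "- a"] by simp

lemma poly_values_bounded: "\<exists>B. \<forall>c\<in>space (Omega L m). pnorm (poly (poly_of m c) x) \<le> B"
proof -
  have "bounded (poly_values \<O> m x)"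
    by (rule compact_imp_bounded[OF compact_poly_values[OF compact_O zero_int]])
  then obtain B where "\<forall>y\<in>poly_values \<O> m x. pnorm y \<le> B"
    unfolding bounded_any_center[of _ 0] by (auto simp: dist_eq pnorm_diff_commute)
  then show ?thesis
    unfolding poly_values_image by blast
qed

lemma mean_shift_integrable: "integrable (Omega L m) (\<lambda>c. pnorm (poly (poly_of m c) x + a :: 'a) ^ r)"
proof -
  interpret prob_space "Omega L m" by (rule prob_space_Omega)
  obtain B where B: "\<And>c. c \<in> space (Omega L m) \<Longrightarrow> pnorm (poly (poly_of m c) x) \<le> B"
    using poly_values_bounded by blast
  have "pnorm (poly (poly_of m c) x + a) ^ r \<le> (max B (pnorm a)) ^ r" if "c \<in> space (Omega L m)" for c
    using B[OF that] pnorm_ultrametric[of "poly (poly_of m c) x" a] by (intro power_mono) auto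
  then show ?thesis
    by (intro integrable_const_bound[where B = "(max B (pnorm a)) ^ r"])
      (auto intro!: borel_measurable_power pnorm_shift_measurable)
qed

text \<open>The mean depends only on the coset of the shift, since adding a fixed polynomial
  preserves the law of the coefficients. The shift can thus be replaced by a minimal element of its
  coset.\<close>

lemma mean_shift_translate:
  assumes w: "w \<in> poly_values \<O> m x"
  shows "mean_shift r m x (w + a) = mean_shift r m x a"
proof -
  obtain R where R: "R \<in> space (Omega L m)" "w = poly (poly_of m R) x"
    using w unfolding poly_values_image by blast
  let ?t = "\<lambda>c. \<lambda>i\<in>{..m}. c i + R i"
  note t = Omega_translate[OF R(1)]
  have "mean_shift r m x a = (\<integral>c. pnorm (poly (poly_of m c) x + a) ^ r \<partial>distr (Omega L m) (Omega L m) ?t)"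
    unfolding t(2) by (simp add: mean_shift_def)
  also have "\<dots> = (\<integral>c. pnorm (poly (poly_of m (?t c)) x + a) ^ r \<partial>Omega L m)"
    by (rule integral_distr[OF t(1) borel_measurable_power[OF pnorm_shift_measurable]])
  also have "\<dots> = mean_shift r m x (w + a)"
    by (simp add: mean_shift_def poly_of_translate R(2) add_ac)
  finally show ?thesis by simp
qed

lemma mean_shift_0: "mean_shift r m x 0 = mean_power r m x"
  by (simp add: mean_shift_def mean_power_def)

text \<open>An element \<open>a\<^sub>0\<close> of minimal absolute value in the coset satisfies
  \<open>\<bar>t + a\<^sub>0\<bar> \<ge> max \<bar>t\<bar> \<bar>a\<^sub>0\<bar>\<close> for all \<open>t\<close> in the group.\<close>

lemma mean_shift_ge:
  shows "mean_power r m x \<le> mean_shift r m x a"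
    and "0 < r \<Longrightarrow> a \<notin> poly_values \<O> m x \<Longrightarrow> mean_power r m x < mean_shift r m x a"
proof -
  interpret prob_space "Omega L m" by (rule prob_space_Omega)
  let ?W = "poly_values \<O> m x"
  have cW: "compact ?W"
    by (rule compact_poly_values[OF compact_O zero_int])
  note W = add_subgroupD[OF add_subgroup_poly_values[OF is_subring_O, of m x]]
  have "compact ((\<lambda>w. a + w) ` ?W)"
    by (rule compact_translate[OF cW])
  moreover have "(\<lambda>w. a + w) ` ?W \<noteq> {}"
    using W(1) by blast
  ultimately obtain a0 where a0: "a0 \<in> (\<lambda>w. a + w) ` ?W" "\<forall>z\<in>(\<lambda>w. a + w) ` ?W. pnorm a0 \<le> pnorm z"
    using continuous_attains_inf[OF _ _ continuous_on_pnorm] by blast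
  then obtain w0 where w0: "w0 \<in> ?W" "a0 = a + w0"
    by blast
  have min: "pnorm a0 \<le> pnorm (t + a0)" if "t \<in> ?W" for t
  proof -
    have "t + a0 = a + (w0 + t)"
      by (simp add: w0)
    then show ?thesis
      using a0(2) W(4)[OF w0(1) that] by (metis imageI)
  qed
  have ge: "pnorm t \<le> pnorm (t + a0)" if "t \<in> ?W" for t
    using min[OF that] pnorm_diff_le[of "t + a0" a0] by simp
  have J: "mean_shift r m x a = mean_shift r m x a0"
    using mean_shift_translate[OF w0(1), of r a] by (simp add: w0 add.commute)
  have inW: "poly (poly_of m c) x \<in> ?W" if "c \<in> space (Omega L m)" for c
    using that unfolding poly_values_image by blast
  have le: "pnorm (poly (poly_of m c) x + 0) ^ r \<le> pnorm (poly (poly_of m c) x + a0) ^ r"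
    if "c \<in> space (Omega L m)" for c
    using ge[OF inW[OF that]] by (intro power_mono) auto
  show "mean_power r m x \<le> mean_shift r m x a"
    unfolding J mean_shift_0[symmetric] unfolding mean_shift_def
    using le by (intro integral_mono mean_shift_integrable) auto
  assume r: "0 < r" and a: "a \<notin> ?W"
  have "a0 \<noteq> 0"
    using a w0 W(3)[OF w0(1)] by (metis add_eq_0_iff minus_minus)
  then have pos: "0 < pnorm a0 / 2"
    by simp
  \<comment> \<open>On this event the unshifted value is at most half of \<open>pnorm a0\<close>,
    the shifted one at least \<open>pnorm a0\<close>. Its mass is positive because finitely many
    events of equal mass fill the space.\<close>
  let ?A = "{c \<in> space (Omega L m). pnorm (poly (poly_of m c) x - 0) \<le> pnorm a0 / 2}"
  have A: "?A \<in> sets (Omega L m)"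
    by (rule ball_event_sets[OF pos])
  have "finite_measure (Omega L m)"
    by unfold_locales
  from uniform_on_level[OF uniform_on_poly_values cW this pos] have "measure (Omega L m) ?A \<noteq> 0"
    by (auto simp: prob_space)
  then have A0: "emeasure (Omega L m) ?A \<noteq> 0"
    by (simp add: emeasure_eq_measure)
  have "mean_shift r m x 0 < mean_shift r m x a0"
    unfolding mean_shift_def
  proof (rule integral_less_AE[OF mean_shift_integrable mean_shift_integrable A0 A])
    have "pnorm (poly (poly_of m c) x + 0) ^ r < pnorm (poly (poly_of m c) x + a0) ^ r" if "c \<in> ?A" for c
    proof (rule power_strict_mono[OF _ _ r])
      have "c \<in> space (Omega L m)"
        using that by simp
      from min[OF inW[OF this]] have "pnorm a0 \<le> pnorm (poly (poly_of m c) x + a0)" .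
      moreover have "pnorm (poly (poly_of m c) x) \<le> pnorm a0 / 2"
        using that by simp
      ultimately show "pnorm (poly (poly_of m c) x + 0) < pnorm (poly (poly_of m c) x + a0)"
        using pos unfolding add_0_right by linarith
    qed simp
    then show "AE c in Omega L m. c \<in> ?A \<longrightarrow> pnorm (poly (poly_of m c) x + 0) ^ r \<noteq> pnorm (poly (poly_of m c) x + a0) ^ r"
      by (intro AE_I2 impI less_imp_neq)
    show "AE c in Omega L m. pnorm (poly (poly_of m c) x + 0) ^ r \<le> pnorm (poly (poly_of m c) x + a0) ^ r"
      using le by (intro AE_I2) auto
  qed
  then show "mean_power r m x < mean_shift r m x a"
    by (simp add: J mean_shift_0)
qed

text \<open>Integration over the top coefficient \<open>y\<close> is separated by the product
  formula; the inner integral is the mean shifted by \<open>y * x ^ Suc m\<close>. Nonnegative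
  integrals yield measurability in \<open>y\<close> at the same time.\<close>

lemma mean_power_Suc:
  shows "(\<lambda>y. ennreal (mean_shift r m x (y * x ^ Suc m))) \<in> borel_measurable oM"
    "ennreal (mean_power r (Suc m) x) = (\<integral>\<^sup>+ y. ennreal (mean_shift r m x (y * x ^ Suc m)) \<partial>oM)"
proof -
  interpret P: finite_product_prob_space "\<lambda>_. oM" "{..m}" by (rule finite_product_prob_space_oM)
  have ins: "insert (Suc m) {..m} = {..Suc m}"
    by auto
  let ?f = "\<lambda>c. ennreal (pnorm (poly (poly_of (Suc m) c) x) ^ r)"
  have f[measurable]: "?f \<in> borel_measurable (PiM (insert (Suc m) {..m}) (\<lambda>_. oM))"
    using pnorm_shift_measurable[of "Suc m" x 0] unfolding ins Omega_eq[symmetric] by simp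
  have upd: "poly (poly_of (Suc m) (c(Suc m := y))) x = poly (poly_of m c) x + y * x ^ Suc m" for c y
    by (simp add: poly_poly_of)
  have inner: "(\<integral>\<^sup>+ c. ?f (c(Suc m := y)) \<partial>PiM {..m} (\<lambda>_. oM)) = ennreal (mean_shift r m x (y * x ^ Suc m))" for y
    unfolding upd Omega_eq[symmetric] mean_shift_def
    by (rule nn_integral_eq_integral[OF mean_shift_integrable]) simp
  have "(\<lambda>y. \<integral>\<^sup>+ c. ?f (c(Suc m := y)) \<partial>PiM {..m} (\<lambda>_. oM)) \<in> borel_measurable oM"
    by measurable
  then show "(\<lambda>y. ennreal (mean_shift r m x (y * x ^ Suc m))) \<in> borel_measurable oM"
    unfolding inner .
  have "ennreal (mean_power r (Suc m) x) = (\<integral>\<^sup>+ c. ?f c \<partial>PiM (insert (Suc m) {..m}) (\<lambda>_. oM))"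
    unfolding mean_power_def ins Omega_eq[symmetric]
    using mean_shift_integrable[of "Suc m" x 0 r] by (intro nn_integral_eq_integral[symmetric]) auto
  also have "\<dots> = (\<integral>\<^sup>+ y. (\<integral>\<^sup>+ c. ?f (c(Suc m := y)) \<partial>PiM {..m} (\<lambda>_. oM)) \<partial>oM)"
    by (rule P.product_nn_integral_insert_rev[OF _ _ f]) auto
  finally show "ennreal (mean_power r (Suc m) x) = (\<integral>\<^sup>+ y. ennreal (mean_shift r m x (y * x ^ Suc m)) \<partial>oM)"
    unfolding inner .
qed

lemma mean_power_nonneg [simp]: "0 \<le> mean_power r m x"
  by (simp add: mean_power_def)

lemma mean_power_mono: "mean_power r m x \<le> mean_power r (Suc m) x"
proof -
  interpret prob_space oM by (rule prob_space_oM)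
  have "ennreal (mean_power r m x) = (\<integral>\<^sup>+ y. ennreal (mean_power r m x) \<partial>oM)"
    by (simp add: emeasure_space_1 del: space_oM)
  also have "\<dots> \<le> ennreal (mean_power r (Suc m) x)"
    unfolding mean_power_Suc(2) using mean_shift_ge(1) by (intro nn_integral_mono ennreal_leI)
  finally show ?thesis
    by simp
qed

lemma mean_power_less:
  assumes r: "0 < r" and new: "\<And>y. y \<in> \<O> \<Longrightarrow> y \<noteq> 0 \<Longrightarrow> y * x ^ Suc m \<notin> poly_values \<O> m x"
  shows "mean_power r m x < mean_power r (Suc m) x"
proof -
  interpret prob_space oM by (rule prob_space_oM)
  have "(\<integral>\<^sup>+ y. ennreal (mean_power r m x) \<partial>oM) < (\<integral>\<^sup>+ y. ennreal (mean_shift r m x (y * x ^ Suc m)) \<partial>oM)"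
  proof (rule nn_integral_less[OF _ mean_power_Suc(1)])
    show "(\<integral>\<^sup>+ y. ennreal (mean_power r m x) \<partial>oM) \<noteq> \<infinity>"
      by (simp add: emeasure_space_1 del: space_oM)
    show "AE y in oM. ennreal (mean_power r m x) \<le> ennreal (mean_shift r m x (y * x ^ Suc m))"
      using mean_shift_ge(1) by (intro AE_I2 ennreal_leI)
    show "\<not> (AE y in oM. ennreal (mean_shift r m x (y * x ^ Suc m)) \<le> ennreal (mean_power r m x))"
    proof
      assume "AE y in oM. ennreal (mean_shift r m x (y * x ^ Suc m)) \<le> ennreal (mean_power r m x)"
      \<comment> \<open>The only possible exception to strict inequality is \<open>y = 0\<close>. It
        suffices to enclose this point in a set of mass below \<open>1\<close>, and
        \<open>pball 0 1\<close> has mass \<open>1 / resq\<close>.\<close>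
      then have "AE y in oM. y \<in> pball 0 1"
      proof (rule AE_mp, intro AE_I2 impI)
        fix y assume y: "y \<in> space oM" and "ennreal (mean_shift r m x (y * x ^ Suc m)) \<le> ennreal (mean_power r m x)"
        then have "\<not> mean_power r m x < mean_shift r m x (y * x ^ Suc m)"
          by (simp add: not_less)
        then have "y = 0"
          using mean_shift_ge(2)[OF r] new y by fastforce
        then show "y \<in> pball 0 1"
          by (simp add: self_pball)
      qed
      then have "emeasure oM (pball 0 1) = 1"
        by (intro emeasure_eq_1_AE pball_sets_oM) auto
      moreover have "emeasure oM (pball 0 1) = ennreal (1 / real resq)"
        using emeasure_haar_pball[OF zero_L, of 1] pball_sets_oM[OF zero_int, of 1] by (simp add: emeasure_oM sets_oM)
      ultimately show False
        using resq_ge_2 by simp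
    qed
  qed simp
  then show ?thesis
    unfolding mean_power_Suc(2)[symmetric] by (simp add: emeasure_space_1 ennreal_less_iff del: space_oM)
qed

lemma mean_power_eq_if_poly_values_eq:
  assumes "poly_values \<O> n x = poly_values \<O> m x"
  shows "mean_power r n x = mean_power r m x"
proof -
  interpret prob_space "Omega L n" by (rule prob_space_Omega)
  have "mean_power r n x = measure (Omega L n) (space (Omega L n)) * mean_power r m x"
    unfolding mean_power_def[of r n]
    by (rule mean_power_unique) (use uniform_on_poly_values[of n x] assms in simp, unfold_locales)
  then show ?thesis
    by (simp add: prob_space)
qed

text \<open>Dominated convergence along sequences: a convergent sequence is bounded, and integral
  coefficients then bound the polynomial values by a constant.\<close>

lemma continuous_mean_power: "continuous_on S (mean_power r m)"
  unfolding continuous_on_sequentially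
proof (intro allI impI ballI, elim conjE)
  fix X a assume X: "\<forall>n. X n \<in> S" "X \<longlonglongrightarrow> (a :: 'a)"
  interpret prob_space "Omega L m" by (rule prob_space_Omega)
  have "(\<lambda>n. pnorm (X n)) \<longlonglongrightarrow> pnorm a"
    by (rule tendsto_pnorm[OF X(2)])
  then have "Bseq (\<lambda>n. pnorm (X n))"
    by (intro convergent_imp_Bseq convergentI)
  then obtain B where B: "0 < B" "\<And>n. pnorm (X n) \<le> B"
    by (auto elim: BseqE)
  let ?B = "(max 1 B ^ m) ^ r"
  have "(\<lambda>n. mean_power r m (X n)) \<longlonglongrightarrow> mean_power r m a"
    unfolding mean_power_def
  proof (rule integral_dominated_convergence[where w = "\<lambda>_. ?B"])
    show "(\<lambda>c. pnorm (poly (poly_of m c) a) ^ r) \<in> borel_measurable (Omega L m)"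
      "(\<lambda>c. pnorm (poly (poly_of m c) (X n)) ^ r) \<in> borel_measurable (Omega L m)" for n
      using pnorm_shift_measurable[of m _ 0] by (auto intro!: borel_measurable_power)
    show "AE c in Omega L m. (\<lambda>n. pnorm (poly (poly_of m c) (X n)) ^ r) \<longlonglongrightarrow> pnorm (poly (poly_of m c) a) ^ r"
      unfolding poly_poly_of
      by (intro AE_I2 tendsto_power tendsto_pnorm tendsto_vf_sum tendsto_vf_mult tendsto_vf_power X(2) tendsto_const)
    show "AE c in Omega L m. norm (pnorm (poly (poly_of m c) (X n)) ^ r) \<le> ?B" for n
    proof (rule AE_I2)
      fix c assume c: "c \<in> space (Omega L m)"
      have "pnorm (poly (poly_of m c) (X n)) \<le> max 1 B ^ m"
        unfolding poly_poly_of
      proof (rule pnorm_sum_le)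
        fix i assume i: "i \<in> {..m}"
        then have "pnorm (c i) \<le> 1"
          using c by (auto simp: space_Omega int_ring_iff PiE_iff)
        moreover have "pnorm (X n) ^ i \<le> max 1 B ^ m"
        proof -
          have "pnorm (X n) ^ i \<le> max 1 B ^ i"
            using B(2)[of n] by (intro power_mono) auto
          also have "\<dots> \<le> max 1 B ^ m"
            using i by (intro power_increasing) auto
          finally show ?thesis .
        qed
        ultimately have "pnorm (c i) * pnorm (X n) ^ i \<le> 1 * max 1 B ^ m"
          by (intro mult_mono) auto
        then show "pnorm (c i * X n ^ i) \<le> max 1 B ^ m"
          by (simp add: pnorm_mult pnorm_power)
      qed simp
      then show "norm (pnorm (poly (poly_of m c) (X n)) ^ r) \<le> ?B"
        by (simp add: power_mono)
    qed
  qed simp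
  then show "(mean_power r m \<circ> X) \<longlonglongrightarrow> mean_power r m a"
    by (simp add: comp_def)
qed

text \<open>In degree \<open>0\<close> the random element is uniform on \<open>\<O>\<close>,
  whatever \<open>x\<close> is. Units contribute \<open>1 - 1 / resq\<close>; on the maximal ideal,
  of mass \<open>1 / resq\<close>, division by \<open>unif\<close> restores the uniform law on
  \<open>\<O>\<close>, which brings the same mean back with factor
  \<open>pnorm unif ^ r\<close>.\<close>

lemma mean_power_degree_0:
  "mean_power r 0 x = (1 - 1 / real resq) + pnorm unif ^ r / real resq * mean_power r 0 x"
proof -
  let ?U = "pball 0 1"
  have P0: "poly_values \<O> 0 x = \<O>"
    unfolding poly_values_eq_lincomb_set[OF zero_int] lincomb_set_Suc by auto
  have sub: "add_subgroup ?U"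
    by (auto simp: add_subgroup_def pball_def diff_L pnorm_sub_le)
  have UO: "?U \<subseteq> \<O>"
    using pball_mono[of 0 1 0] by (simp add: pball_0)
  have U: "?U \<in> sets (haar L)" "?U \<subseteq> L"
    using pball_sub_L by (auto simp: sets_haar pball_sets)
  have mU: "measure (haar L) ?U = 1 / real resq"
    using emeasure_haar_pball[OF zero_L, of 1] by (simp add: measure_def)
  have int: "(LINT t|restrict_space (haar L) A. pnorm t ^ r) = (LINT t|haar L. indicator A t * pnorm t ^ r)"
    if "A \<in> sets (haar L)" "A \<subseteq> L" for A
    using that by (subst integral_restrict_space) (auto simp: Int_absorb2)
  have "uniform_on \<O> oM (\<lambda>t. t)"
    unfolding oM_def using uniform_on_restrict_haar[of \<O>] add_subgroup_O O_sets_haar int_ring_L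
    by (auto simp: \<O>_def)
  moreover have "finite_measure oM"
    using prob_space_oM by (simp add: prob_space_def)
  ultimately have "(LINT t|oM. pnorm t ^ r) = measure oM (space oM) * mean_power r 0 x"
    by (intro mean_power_unique) (simp_all add: P0)
  also have "(LINT t|oM. pnorm t ^ r) = (LINT t|haar L. indicator \<O> t * pnorm t ^ r)"
    unfolding oM_def \<O>_def[symmetric] using O_sets_haar int_ring_L by (intro int) auto
  finally have 1: "(LINT t|haar L. indicator \<O> t * pnorm t ^ r) = mean_power r 0 x"
    using prob_space.prob_space[OF prob_space_oM] by simp
  have "(*) (1 / unif) ` ?U = \<O>"
    unfolding pball_image[OF zero_L] by (auto simp: image_image)
  moreover have "uniform_on ((*) (1 / unif) ` ?U) (restrict_space (haar L) ?U) (\<lambda>t. 1 / unif * t)"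
    by (intro uniform_on_cmult uniform_on_restrict_haar U sub) simp
  moreover have "finite_measure (restrict_space (haar L) ?U)"
  proof (rule finite_measureI)
    show "emeasure (restrict_space (haar L) ?U) (space (restrict_space (haar L) ?U)) \<noteq> \<infinity>"
      using U emeasure_haar_pball[OF zero_L, of 1]
      by (simp add: space_restrict_space emeasure_restrict_space Int_absorb2)
  qed
  ultimately have "(LINT t|restrict_space (haar L) ?U. pnorm (1 / unif * t) ^ r) =
      measure (restrict_space (haar L) ?U) (space (restrict_space (haar L) ?U)) * mean_power r 0 x"
    by (intro mean_power_unique) (simp_all add: P0)
  also have "measure (restrict_space (haar L) ?U) (space (restrict_space (haar L) ?U)) = 1 / real resq"
    using U mU by (simp add: space_restrict_space measure_restrict_space Int_absorb2)
  also have "(LINT t|restrict_space (haar L) ?U. pnorm (1 / unif * t) ^ r) =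
      (LINT t|restrict_space (haar L) ?U. (1 / pnorm unif ^ r) * pnorm t ^ r)"
    by (simp add: pnorm_divide power_divide)
  also have "\<dots> = 1 / pnorm unif ^ r * (LINT t|haar L. indicator ?U t * pnorm t ^ r)"
    using int[OF U] by simp
  finally have 2: "(LINT t|haar L. indicator ?U t * pnorm t ^ r) = pnorm unif ^ r / real resq * mean_power r 0 x"
    using unif(2) by (simp add: field_simps)
  have units: "pnorm t = 1" if "t \<in> \<O>" "t \<notin> ?U" for t
    using that unif(4)[of t] by (force simp: int_ring_iff pball_def)
  have eq: "indicator \<O> t * pnorm t ^ r = indicator (\<O> - ?U) t + indicator ?U t * pnorm t ^ r" for t
    using UO units[of t] by (auto simp: indicator_def)
  have intU: "integrable (haar L) (\<lambda>t. indicator ?U t * pnorm t ^ r)"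
  proof (rule Bochner_Integration.integrable_bound)
    show "integrable (haar L) (indicator ?U :: 'a \<Rightarrow> real)"
      using U emeasure_haar_pball[OF zero_L, of 1] by (intro integrable_real_indicator) auto
    have "(pnorm :: 'a \<Rightarrow> real) \<in> borel_measurable (restrict_space borel L)"
      by (rule measurable_restrict_space1[OF borel_measurable_continuous_onI[OF continuous_on_pnorm]])
    then have "pnorm \<in> borel_measurable (haar L)"
      using measurable_cong_sets[OF sets_haar refl] by blast
    then show "(\<lambda>t. indicator ?U t * pnorm t ^ r) \<in> borel_measurable (haar L)"
      using U by measurable
    show "AE t in haar L. norm (indicator ?U t * pnorm t ^ r) \<le> norm (indicator ?U t :: real)"
      using UO by (intro AE_I2) (auto simp: indicator_def int_ring_iff intro!: power_le_one)
  qed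
  have "integrable (haar L) (indicator (\<O> - ?U) :: 'a \<Rightarrow> real)"
    using emeasure_mono[OF Diff_subset O_sets_haar, of ?U] emeasure_haar_O O_sets_haar U
    by (intro integrable_real_indicator) (auto simp: order_le_less_trans[OF _ ennreal_one_less_top])
  then have "(LINT t|haar L. indicator \<O> t * pnorm t ^ r) = measure (haar L) (\<O> - ?U) + (LINT t|haar L. indicator ?U t * pnorm t ^ r)"
    unfolding eq using intU U O_sets_haar
    by (subst Bochner_Integration.integral_add) (auto simp: Int_absorb2 Diff_subset int_ring_L subset_iff)
  also have "measure (haar L) (\<O> - ?U) = 1 - 1 / real resq"
    using measure_Diff[of "haar L" \<O> ?U] emeasure_haar_O O_sets_haar U UO mU measure_haar_O
    by simp
  finally show ?thesis
    unfolding 1 2 .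
qed

end

section \<open>Evaluation of means and continuity of the lattice measure\<close>

context normalized_ext
begin

text \<open>The linear equation of \<open>mean_power_degree_0\<close> solved with
  \<open>pnorm unif = 1 / q\<close>; this is the origin of the fraction in the statement.\<close>

lemma mean_power_degree_0_eq:
  "F.mean_power r 0 x = (real F.resq ^ (r + 1) - real F.resq ^ r) / (real F.resq ^ (r + 1) - 1)"
proof -
  let ?q = "real F.resq"
  have q: "1 < ?q"
    using F.resq_ge_2 by simp
  have "F.mean_power r 0 x = (1 - 1 / ?q) + 1 / ?q ^ (r + 1) * F.mean_power r 0 x"
    using F.mean_power_degree_0[of r x] by (simp add: normalized power_divide mult.commute)
  then have "F.mean_power r 0 x * ?q ^ (r + 1) = ((1 - 1 / ?q) + 1 / ?q ^ (r + 1) * F.mean_power r 0 x) * ?q ^ (r + 1)"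
    by (rule arg_cong)
  also have "\<dots> = ?q ^ (r + 1) - ?q ^ r + F.mean_power r 0 x"
    using q by (simp add: algebra_simps)
  finally have "F.mean_power r 0 x * (?q ^ (r + 1) - 1) = ?q ^ (r + 1) - ?q ^ r"
    by (simp add: algebra_simps)
  moreover have "1 < ?q ^ (r + 1)"
    using q by (intro one_less_power) auto
  ultimately show ?thesis
    by (simp add: field_simps)
qed

lemma mean_power_pos: "0 < F.mean_power r m x"
proof (induction m)
  case 0
  have q: "1 < real F.resq"
    using F.resq_ge_2 by simp
  have "1 < real F.resq ^ (r + 1)" "real F.resq ^ r < real F.resq ^ (r + 1)"
    using q by (intro one_less_power power_strict_increasing; simp)+
  then show ?case
    unfolding mean_power_degree_0_eq by (intro divide_pos_pos) auto
next
  case (Suc m)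
  then show ?case
    using F.mean_power_mono[of r m x] by linarith
qed

text \<open>Haar measure restricted to \<open>lat x\<close> is uniform on this group, with total
  mass \<open>measure (haar K) (lat x)\<close>, so \<open>mean_power_unique\<close> applies, even
  when this mass is \<open>0\<close>.\<close>

lemma integral_lat:
  assumes x: "x \<in> K"
  shows "(LINT t:lat x|haar K. pnorm t ^ r) = measure (haar K) (lat x) * F.mean_power r (deg - 1) x"
proof -
  let ?M = "restrict_space (haar K) (lat x)"
  have L: "lat x \<subseteq> K" "lat x \<in> sets (haar K)"
    using x by (auto intro: lat_K[THEN subsetD] lat_sets)
  have sp: "emeasure ?M (space ?M) = emeasure (haar K) (lat x)" "measure ?M (space ?M) = measure (haar K) (lat x)"
    using L by (simp_all add: space_restrict_space emeasure_restrict_space measure_restrict_space Int_absorb2)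
  have "finite_measure ?M"
    by (rule finite_measureI) (simp add: sp emeasure_lat[OF x])
  moreover have "uniform_on (poly_values F.\<O> (deg - 1) x) ?M (\<lambda>t. t)"
    using K.uniform_on_restrict_haar[OF L(1) _ L(2)] add_subgroup_PV by (simp add: lat_def)
  ultimately have "(LINT t|?M. pnorm t ^ r) = measure ?M (space ?M) * F.mean_power r (deg - 1) x"
    by (intro F.mean_power_unique)
  then show ?thesis
    unfolding sp set_lebesgue_integral_def using L by (subst (asm) integral_restrict_space) (auto simp: Int_absorb2)
qed

text \<open>Finitely many powers are close at once, and integral coefficients do not enlarge the
  error; the estimate is therefore uniform in \<open>c\<close>.\<close>

lemma powers_near:
  assumes s: "0 < s"
  shows "\<forall>\<^sub>F x in at x0 within K. \<forall>c. (\<forall>i<deg. c i \<in> F.\<O>) \<longrightarrow>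
    pnorm ((\<Sum>i<deg. c i * x ^ i) - (\<Sum>i<deg. c i * x0 ^ i)) \<le> s"
proof -
  have "\<forall>\<^sub>F x in at x0 within K. \<forall>i\<in>{..<deg}. pnorm (x ^ i - x0 ^ i) < s"
  proof (intro eventually_ball_finite ballI finite_lessThan)
    fix i
    have "((\<lambda>x. pnorm (x ^ i - x0 ^ i)) \<longlongrightarrow> 0) (at x0 within K)"
      using F.tendsto_vf_power[OF tendsto_ident_at, of i x0 K] unfolding F.tendsto_pnorm_iff .
    then show "\<forall>\<^sub>F x in at x0 within K. pnorm (x ^ i - x0 ^ i) < s"
      using s by (rule order_tendstoD)
  qed
  then show ?thesis
  proof (rule eventually_mono, intro allI impI)
    fix x c assume x: "\<forall>i\<in>{..<deg}. pnorm (x ^ i - x0 ^ i) < s" and c: "\<forall>i<deg. c i \<in> F.\<O>"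
    have "(\<Sum>i<deg. c i * x ^ i) - (\<Sum>i<deg. c i * x0 ^ i) = (\<Sum>i<deg. c i * (x ^ i - x0 ^ i))"
      by (simp add: right_diff_distrib sum_subtractf)
    also have "pnorm \<dots> \<le> s"
    proof (rule F.pnorm_sum_le)
      fix i assume i: "i \<in> {..<deg}"
      have "pnorm (c i) * pnorm (x ^ i - x0 ^ i) \<le> 1 * s"
        using c x i by (intro mult_mono) (auto simp: F.int_ring_iff less_imp_le)
      then show "pnorm (c i * (x ^ i - x0 ^ i)) \<le> s"
        by (simp add: F.pnorm_mult)
    qed (use s in simp)
    finally show "pnorm ((\<Sum>i<deg. c i * x ^ i) - (\<Sum>i<deg. c i * x0 ^ i)) \<le> s" .
  qed
qed

lemma lat_eq: "lat x = lincomb_set F.\<O> deg (\<lambda>i. x ^ i)"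
  using deg_pos by (simp add: lat_def poly_values_eq_lincomb_set)

text \<open>\<open>lat x0\<close> contains a ball around \<open>0\<close>, so combinations of nearby
  powers differ by its elements and \<open>lat x\<close> is contained in \<open>lat x0\<close>. The
  converse is an approximation argument in the style of Nakayama: \<open>lat x0\<close> lies in
  \<open>lat x + unif * lat x0\<close>, and \<open>lat x\<close> is closed.\<close>

lemma lat_locally_constant:
  assumes x0: "x0 \<in> K" "adjoin F x0 = K"
  shows "\<forall>\<^sub>F x in at x0 within K. lat x = lat x0"
proof -
  obtain N where N: "\<And>y. y \<in> K \<Longrightarrow> pnorm y \<le> pnorm F.unif ^ N \<Longrightarrow> y \<in> lat x0"
    using lat_open[OF x0] by blast
  let ?w = F.unif
  have "\<forall>\<^sub>F x in at x0 within K. (\<forall>c. (\<forall>i<deg. c i \<in> F.\<O>) \<longrightarrow>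
      pnorm ((\<Sum>i<deg. c i * x ^ i) - (\<Sum>i<deg. c i * x0 ^ i)) \<le> pnorm ?w ^ Suc N) \<and> x \<in> K"
    using F.unif(2) by (intro eventually_conj powers_near) (auto simp: eventually_at_filter)
  then show ?thesis
  proof (rule eventually_mono, elim conjE)
    fix x assume near: "\<forall>c. (\<forall>i<deg. c i \<in> F.\<O>) \<longrightarrow>
        pnorm ((\<Sum>i<deg. c i * x ^ i) - (\<Sum>i<deg. c i * x0 ^ i)) \<le> pnorm ?w ^ Suc N" and xK: "x \<in> K"
    note W0 = add_subgroupD[OF add_subgroup_PV[of "deg - 1" x0], folded lat_def]
    note W = add_subgroupD[OF add_subgroup_PV[of "deg - 1" x], folded lat_def]
    have PK: "lat x \<subseteq> K" "lat x0 \<subseteq> K"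
      using lat_K xK x0 by auto
    have lt: "pnorm ?w ^ Suc N \<le> pnorm ?w ^ N"
      using F.unif(2,3) by (intro power_decreasing) auto
    show "lat x = lat x0"
    proof (intro equalityI subsetI)
      fix y assume "y \<in> lat x"
      then obtain c where c: "\<forall>i<deg. c i \<in> F.\<O>" "y = (\<Sum>i<deg. c i * x ^ i)"
        unfolding lat_eq lincomb_set_def by blast
      let ?y = "\<Sum>i<deg. c i * x0 ^ i"
      have y: "?y \<in> lat x0"
        unfolding lat_eq using c(1) by (intro lincomb_setI) auto
      have "y - ?y \<in> lat x0"
      proof (rule N)
        show "y - ?y \<in> K"
          using PK y \<open>y \<in> lat x\<close> by (intro K.diff_L) auto
        show "pnorm (y - ?y) \<le> pnorm ?w ^ N"
          using near c lt order_trans by blast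
      qed
      from W0(4)[OF this y] show "y \<in> lat x0"
        by simp
    next
      fix u assume u: "u \<in> lat x0"
      \<comment> \<open>The exponent \<open>Suc N\<close>, in place of \<open>N\<close>, in the
        choice of the neighbourhood leaves room for dividing the error by \<open>unif\<close> and
        staying in \<open>lat x0\<close>; this drives the induction on \<open>k\<close>.\<close>
      have appr: "\<exists>w\<in>lat x. \<exists>v\<in>lat x0. u - w = ?w ^ k * v" for k
      proof (induction k)
        case 0
        show ?case
          using W(1) u by (intro bexI[of _ 0] bexI[of _ u]) auto
      next
        case (Suc k)
        then obtain w v where wv: "w \<in> lat x" "v \<in> lat x0" "u - w = ?w ^ k * v"
          by blast
        obtain c where c: "\<forall>i<deg. c i \<in> F.\<O>" "v = (\<Sum>i<deg. c i * x0 ^ i)"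
          using wv(2) unfolding lat_eq lincomb_set_def by blast
        define v' where "v' = (\<Sum>i<deg. c i * x ^ i)"
        have v': "v' \<in> lat x"
          unfolding lat_eq v'_def using c(1) by (intro lincomb_setI) auto
        have "pnorm (v - v') \<le> pnorm ?w ^ Suc N"
          using near c(1) F.pnorm_diff_commute[of v v'] unfolding v'_def c(2) by simp
        then have "(v - v') / ?w \<in> lat x0"
          using F.unif(1,2) wv(2) v' PK
          by (intro N K.divide_L[OF K.diff_L F_K]) (auto simp: F.pnorm_divide field_simps)
        moreover have "?w ^ k * v' \<in> lat x"
          using v' poly_values_scale[OF F.is_subring_O F.power_int[OF F.unif_int]] by (simp add: lat_def)
        then have "w + ?w ^ k * v' \<in> lat x"
          using W(4) wv(1) by blast
        moreover have "u - (w + ?w ^ k * v') = ?w ^ Suc k * ((v - v') / ?w)"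
        proof -
          have "u - (w + ?w ^ k * v') = (u - w) - ?w ^ k * v'"
            by simp
          also have "\<dots> = ?w ^ k * (v - v')"
            by (simp add: wv(3) right_diff_distrib)
          finally show ?thesis
            by simp
        qed
        ultimately show ?case
          by blast
      qed
      obtain B where B: "\<And>v. v \<in> lat x0 \<Longrightarrow> pnorm v \<le> B"
        using lat_bounded by blast
      have "\<exists>w\<in>lat x. dist w u < e" if e: "0 < e" for e
      proof -
        have B0: "0 < \<bar>B\<bar> + 1"
          by simp
        then obtain k where k: "pnorm ?w ^ k < e / (\<bar>B\<bar> + 1)"
          using F.unif_power_small[of "e / (\<bar>B\<bar> + 1)"] e by auto
        obtain w v where wv: "w \<in> lat x" "v \<in> lat x0" "u - w = ?w ^ k * v"
          using appr by blast
        have "pnorm (u - w) = pnorm ?w ^ k * pnorm v"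
          by (simp add: wv(3) F.pnorm_mult F.pnorm_power)
        also have "\<dots> \<le> pnorm ?w ^ k * (\<bar>B\<bar> + 1)"
          using B[OF wv(2)] by (intro mult_left_mono) auto
        also have "\<dots> < e"
          using k B0 by (simp add: pos_less_divide_eq)
        finally show ?thesis
          using wv(1) by (auto simp: F.dist_eq F.pnorm_diff_commute[of u])
      qed
      then show "u \<in> lat x"
        using compact_imp_closed[OF compact_PV[of "deg - 1" x], folded lat_def] closed_approachable by blast
    qed
  qed
qed

lemma continuous_measure_lat: "continuous_on K (\<lambda>x. measure (haar K) (lat x))"
  unfolding continuous_on_def
proof
  fix x0 assume x0: "x0 \<in> K"
  show "((\<lambda>x. measure (haar K) (lat x)) \<longlongrightarrow> measure (haar K) (lat x0)) (at x0 within K)"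
  proof (cases "adjoin F x0 = K")
    case True
    show ?thesis
      by (rule tendsto_eventually) (rule eventually_mono[OF lat_locally_constant[OF x0 True]], simp)
  next
    case False
    \<comment> \<open>Closed tubes around \<open>lat x0\<close> in \<open>K\<close>, of finite
      measure and decreasing to \<open>lat x0\<close>, which is null here. For \<open>x\<close> near
      \<open>x0\<close> each tube contains \<open>lat x\<close>, so the measures of
      \<open>lat x\<close> tend to \<open>0\<close>.\<close>
    let ?A = "\<lambda>k. (\<Union>z\<in>lat x0. {y. pnorm (y - z) \<le> pnorm F.unif ^ k}) \<inter> K"
    obtain B where B: "\<And>v. v \<in> lat x0 \<Longrightarrow> pnorm v \<le> B"
      using lat_bounded by blast
    have A: "?A k \<in> sets (haar K)" for k
    proof (rule K.sets_haarI)
      have "open (\<Union>z\<in>lat x0. {y. pnorm (y - z) \<le> pnorm F.unif ^ k})"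
        using F.unif(2) by (intro open_UN ballI F.open_pnorm_le) auto
      then show "?A k \<in> sets borel"
        using borel_closed[OF K.closed_L] by (intro sets.Int) auto
    qed blast
    have Abd: "emeasure (haar K) (?A k) \<noteq> \<infinity>" for k
    proof -
      have "pnorm y \<le> max 1 B" if y: "y \<in> ?A k" for y
      proof -
        obtain z where z: "z \<in> lat x0" "pnorm (y - z) \<le> pnorm F.unif ^ k"
          using y by blast
        have "pnorm F.unif ^ k \<le> 1"
          using F.unif(2,3) by (intro power_le_one) auto
        then show ?thesis
          using z(2) B[OF z(1)] F.pnorm_ultrametric[of "y - z" z] by simp
      qed
      then show ?thesis
        using K.emeasure_haar_bounded[OF A] by (metis less_irrefl)
    qed
    have dec: "decseq ?A"
    proof (rule decseq_SucI)
      fix k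
      have "pnorm F.unif ^ Suc k \<le> pnorm F.unif ^ k"
        using F.unif(2,3) by (intro power_decreasing) auto
      then show "?A (Suc k) \<subseteq> ?A k"
        using order_trans by blast
    qed
    have Int: "(\<Inter>k. ?A k) = lat x0"
    proof (intro equalityI subsetI)
      fix y assume y: "y \<in> (\<Inter>k. ?A k)"
      have "\<exists>z\<in>lat x0. dist z y < e" if e: "0 < e" for e
      proof -
        obtain k where k: "pnorm F.unif ^ k < e"
          using F.unif_power_small[OF e] by blast
        have "y \<in> ?A k"
          using y by blast
        then obtain z where "z \<in> lat x0" "pnorm (y - z) \<le> pnorm F.unif ^ k"
          by blast
        then show ?thesis
          using k by (intro bexI[of _ z]) (auto simp: F.dist_eq F.pnorm_diff_commute[of y])
      qed
      then show "y \<in> lat x0"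
        using compact_imp_closed[OF compact_PV[of "deg - 1" x0], folded lat_def] closed_approachable by blast
    next
      fix y assume y: "y \<in> lat x0"
      have "y \<in> ?A k" for k
      proof (intro IntI UN_I[OF y])
        show "y \<in> {z. pnorm (z - y) \<le> pnorm F.unif ^ k}"
          using F.unif(2) by simp
        show "y \<in> K"
          using lat_K[OF x0] y by blast
      qed
      then show "y \<in> (\<Inter>k. ?A k)"
        by blast
    qed
    have lim: "(\<lambda>k. measure (haar K) (?A k)) \<longlonglongrightarrow> 0"
    proof -
      have "range ?A \<subseteq> sets (haar K)"
        using A by blast
      from Lim_measure_decseq[OF this dec Abd] show ?thesis
        unfolding Int lat_null[OF x0 False] .
    qed
    show ?thesis
      unfolding lat_null[OF x0 False]
    proof (rule tendstoI)
      fix e :: real assume "0 < e"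
      then have "\<forall>\<^sub>F k in sequentially. measure (haar K) (?A k) < e"
        using order_tendstoD(2)[OF lim] by blast
      then obtain k where k: "measure (haar K) (?A k) < e"
        by (auto simp: eventually_sequentially)
      have "\<forall>\<^sub>F x in at x0 within K. (\<forall>c. (\<forall>i<deg. c i \<in> F.\<O>) \<longrightarrow>
          pnorm ((\<Sum>i<deg. c i * x ^ i) - (\<Sum>i<deg. c i * x0 ^ i)) \<le> pnorm F.unif ^ k) \<and> x \<in> K"
        using F.unif(2) by (intro eventually_conj powers_near) (auto simp: eventually_at_filter)
      then show "\<forall>\<^sub>F x in at x0 within K. dist (measure (haar K) (lat x)) 0 < e"
      proof (rule eventually_mono, elim conjE)
        fix x assume near: "\<forall>c. (\<forall>i<deg. c i \<in> F.\<O>) \<longrightarrow>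
          pnorm ((\<Sum>i<deg. c i * x ^ i) - (\<Sum>i<deg. c i * x0 ^ i)) \<le> pnorm F.unif ^ k" and xK: "x \<in> K"
        have "lat x \<subseteq> ?A k"
        proof
          fix y assume y: "y \<in> lat x"
          then obtain c where c: "\<forall>i<deg. c i \<in> F.\<O>" "y = (\<Sum>i<deg. c i * x ^ i)"
            unfolding lat_eq lincomb_set_def by blast
          have "(\<Sum>i<deg. c i * x0 ^ i) \<in> lat x0"
            unfolding lat_eq using c(1) by (intro lincomb_setI) auto
          then show "y \<in> ?A k"
            using near c lat_K[OF xK] y by blast
        qed
        then have "emeasure (haar K) (lat x) \<le> emeasure (haar K) (?A k)"
          by (rule emeasure_mono[OF _ A])
        then have "measure (haar K) (lat x) \<le> measure (haar K) (?A k)"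
          unfolding measure_def using Abd by (intro enn2real_mono) (auto simp: less_top)
        then show "dist (measure (haar K) (lat x)) 0 < e"
          using k by simp
      qed
    qed
  qed
qed

end

section \<open>Homographies and the extension of the density formula to all of K\<close>

context normalized_ext
begin

text \<open>Invertibility over the ring of integers written out in entries. Both products with the
  inverse are recorded, so that exchanging a matrix with its inverse gives data of the same
  form.\<close>

definition moebius_data :: "'a \<Rightarrow> 'a \<Rightarrow> 'a \<Rightarrow> 'a \<Rightarrow> 'a \<Rightarrow> bool" where
  "moebius_data a b c d x \<longleftrightarrow> {a, b, c, d} \<subseteq> F.\<O> \<and> x \<in> K \<and> c * x + d \<noteq> 0 \<and>
     (\<exists>a' b' c' d'. {a', b', c', d'} \<subseteq> F.\<O> \<and> a' * a + b' * c = 1 \<and> a' * b + b' * d = 0 \<and>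
        c' * a + d' * c = 0 \<and> c' * b + d' * d = 1 \<and>
        a * a' + b * c' = 1 \<and> a * b' + b * d' = 0 \<and> c * a' + d * c' = 0 \<and> c * b' + d * d' = 1)"

abbreviation (input) moebius :: "'a \<Rightarrow> 'a \<Rightarrow> 'a \<Rightarrow> 'a \<Rightarrow> 'a \<Rightarrow> 'a" where
  "moebius a b c d x \<equiv> (a * x + b) / (c * x + d)"

text \<open>The cocycle rule for \<open>c x + d\<close>: the factor of the inverse matrix at the
  image point is the reciprocal. It lets the following lemmas prove one direction and obtain the
  other from the inverse.\<close>

lemma moebius_inverse:
  assumes "moebius_data a b c d x"
  obtains a' b' c' d' where "moebius_data a' b' c' d' (moebius a b c d x)"
    "c' * moebius a b c d x + d' = 1 / (c * x + d)"
    "moebius a' b' c' d' (moebius a b c d x) = x"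
proof -
  obtain a' b' c' d' where *: "{a', b', c', d'} \<subseteq> F.\<O>" "a' * a + b' * c = 1" "a' * b + b' * d = 0"
    "c' * a + d' * c = 0" "c' * b + d' * d = 1"
    "a * a' + b * c' = 1" "a * b' + b * d' = 0" "c * a' + d * c' = 0" "c * b' + d * d' = 1"
    using assms unfolding moebius_data_def by metis
  have O: "{a, b, c, d} \<subseteq> F.\<O>" "x \<in> K" and nz: "c * x + d \<noteq> 0"
    using assms by (auto simp: moebius_data_def)
  let ?x = "moebius a b c d x"
  have den: "c' * ?x + d' = 1 / (c * x + d)"
  proof -
    have "(c' * ?x + d') * (c * x + d) = c' * (a * x + b) + d' * (c * x + d)"
      using nz by (simp add: distrib_right)
    also have "\<dots> = (c' * a + d' * c) * x + (c' * b + d' * d)"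
      by (simp add: algebra_simps)
    finally show ?thesis
      using nz *(4,5) by (simp add: nonzero_eq_divide_eq)
  qed
  have num: "a' * ?x + b' = x / (c * x + d)"
  proof -
    have "(a' * ?x + b') * (c * x + d) = a' * (a * x + b) + b' * (c * x + d)"
      using nz by (simp add: distrib_right)
    also have "\<dots> = (a' * a + b' * c) * x + (a' * b + b' * d)"
      by (simp add: algebra_simps)
    finally show ?thesis
      using nz *(2,3) by (simp add: nonzero_eq_divide_eq)
  qed
  have "?x \<in> K"
    using O by (auto simp: F.int_ring_iff intro!: K.divide_L K.add_L K.mult_L intro: F_K)
  then have "moebius_data a' b' c' d' ?x"
    unfolding moebius_data_def using * O nz den
    by (intro conjI exI[of _ a] exI[of _ b] exI[of _ c] exI[of _ d]) auto
  moreover have "moebius a' b' c' d' ?x = x"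
    unfolding den num using nz by simp
  ultimately show thesis
    using that den by blast
qed

text \<open>Multiplying out, the left side is the larger of \<open>pnorm (a * x + b)\<close> and
  \<open>pnorm (c * x + d)\<close>, and integral coefficients bound both by
  \<open>max 1 (pnorm x)\<close>.\<close>

lemma moebius_max_le:
  assumes "moebius_data a b c d x"
  shows "max 1 (pnorm (moebius a b c d x)) * pnorm (c * x + d) \<le> max 1 (pnorm x)"
proof -
  have le: "pnorm (a * x + b) \<le> max 1 (pnorm x)" if "a \<in> F.\<O>" "b \<in> F.\<O>" for a b
  proof (rule F.pnorm_add_le)
    have "pnorm a * pnorm x \<le> 1 * pnorm x"
      using that by (intro mult_right_mono) (auto simp: F.int_ring_iff)
    then show "pnorm (a * x) \<le> max 1 (pnorm x)"
      by (simp add: F.pnorm_mult)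
    show "pnorm b \<le> max 1 (pnorm x)"
      using that by (auto simp: F.int_ring_iff)
  qed
  have "max 1 (pnorm (moebius a b c d x)) * pnorm (c * x + d) = max (pnorm (c * x + d)) (pnorm (a * x + b))"
    using assms by (simp add: max_mult_distrib_right F.pnorm_divide moebius_data_def)
  then show ?thesis
    using le[of a b] le[of c d] assms by (simp add: moebius_data_def)
qed

lemma moebius_max:
  assumes "moebius_data a b c d x"
  shows "max 1 (pnorm (moebius a b c d x)) * pnorm (c * x + d) = max 1 (pnorm x)"
proof (rule antisym[OF moebius_max_le[OF assms]])
  obtain a' b' c' d' where *: "moebius_data a' b' c' d' (moebius a b c d x)"
    "c' * moebius a b c d x + d' = 1 / (c * x + d)" "moebius a' b' c' d' (moebius a b c d x) = x"
    using moebius_inverse[OF assms] .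
  have "max 1 (pnorm x) * pnorm (1 / (c * x + d)) \<le> max 1 (pnorm (moebius a b c d x))"
    using moebius_max_le[OF *(1)] unfolding *(3) unfolding *(2) .
  moreover have "0 < pnorm (c * x + d)"
    using assms by (simp add: moebius_data_def)
  ultimately show "max 1 (pnorm x) \<le> max 1 (pnorm (moebius a b c d x)) * pnorm (c * x + d)"
    unfolding F.pnorm_divide F.pnorm_one times_divide_eq_right mult_1_right by (simp only: pos_divide_le_eq)
qed

text \<open>One inclusion is \<open>moebius_poly_values\<close>; the other is the same for the
  inverse matrix. It is used with the ring of integers for the lattices and with \<open>F\<close>
  for the question whether \<open>x\<close> generates \<open>K\<close>.\<close>

lemma moebius_values:
  assumes "moebius_data a b c d x" and R: "is_subring R" "F.\<O> \<subseteq> R"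
  shows "(*) ((c * x + d) ^ m) ` poly_values R m (moebius a b c d x) = poly_values R m x"
proof (intro equalityI subsetI)
  fix y assume "y \<in> (*) ((c * x + d) ^ m) ` poly_values R m (moebius a b c d x)"
  then obtain v where v: "y = (c * x + d) ^ m * v" "v \<in> poly_values R m (moebius a b c d x)"
    by blast
  show "y \<in> poly_values R m x"
    unfolding v(1)
    by (rule moebius_poly_values[OF R(1) _ _ _ _ _ v(2)]) (use assms(1) R in \<open>auto simp: moebius_data_def\<close>)
next
  fix y assume y: "y \<in> poly_values R m x"
  obtain a' b' c' d' where *: "moebius_data a' b' c' d' (moebius a b c d x)"
    "c' * moebius a b c d x + d' = 1 / (c * x + d)" "moebius a' b' c' d' (moebius a b c d x) = x"
    using moebius_inverse[OF assms(1)] .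
  have nz: "c * x + d \<noteq> 0"
    using assms by (simp add: moebius_data_def)
  have "(c' * moebius a b c d x + d') ^ m * y \<in> poly_values R m (moebius a b c d x)"
    by (rule moebius_poly_values[OF R(1), of a' b' c' d']) (use * y R nz in \<open>auto simp: moebius_data_def\<close>)
  then show "y \<in> (*) ((c * x + d) ^ m) ` poly_values R m (moebius a b c d x)"
    unfolding *(2) using nz
    by (intro image_eqI[of _ _ "(1 / (c * x + d)) ^ m * y"]) (simp_all add: power_divide)
qed

lemma moebius_K: "moebius_data a b c d x \<Longrightarrow> moebius a b c d x \<in> K"
  by (auto simp: moebius_data_def F.int_ring_iff intro!: K.divide_L K.add_L K.mult_L intro: F_K)

lemma moebius_denom_K: "moebius_data a b c d x \<Longrightarrow> c * x + d \<in> K"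
  by (auto simp: moebius_data_def F.int_ring_iff intro!: K.add_L K.mult_L intro: F_K)

lemma moebius_adjoin_imp:
  assumes m: "moebius_data a b c d x" and gen: "adjoin F (moebius a b c d x) = K"
  shows "adjoin F x = K"
proof -
  have x: "x \<in> K" and nz: "c * x + d \<noteq> 0"
    using m by (auto simp: moebius_data_def)
  have F: "F.\<O> \<subseteq> F"
    using F.int_ring_L by blast
  have "(*) ((c * x + d) ^ (deg - 1)) ` K = poly_values F (deg - 1) x"
    using moebius_values[OF m F.is_subring_L F, of "deg - 1"] gen
    unfolding adjoin_F[OF moebius_K[OF m]] by simp
  moreover have "(*) ((c * x + d) ^ (deg - 1)) ` K = K"
  proof (intro equalityI subsetI)
    fix y assume "y \<in> K"
    then show "y \<in> (*) ((c * x + d) ^ (deg - 1)) ` K"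
      using nz moebius_denom_K[OF m]
      by (intro image_eqI[of _ _ "y / (c * x + d) ^ (deg - 1)"]) (auto intro!: K.divide_L K.power_L)
  qed (use moebius_denom_K[OF m] in \<open>auto intro!: K.mult_L K.power_L\<close>)
  ultimately show ?thesis
    using adjoin_F[OF x] by simp
qed

lemma moebius_adjoin:
  assumes "moebius_data a b c d x"
  shows "adjoin F (moebius a b c d x) = K \<longleftrightarrow> adjoin F x = K"
proof -
  obtain a' b' c' d' where *: "moebius_data a' b' c' d' (moebius a b c d x)"
    "moebius a' b' c' d' (moebius a b c d x) = x"
    using moebius_inverse[OF assms] by metis
  show ?thesis
    using moebius_adjoin_imp[OF assms] moebius_adjoin_imp[OF *(1)] unfolding *(2) by blast
qed

text \<open>The lattices differ by multiplication with \<open>(c x + d) ^ (deg - 1)\<close>, and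
  scaling by \<open>u\<close> in \<open>K\<close> multiplies Haar measure by
  \<open>pnorm u ^ deg\<close>.\<close>

lemma moebius_measure_lat:
  assumes m: "moebius_data a b c d x"
  shows "measure (haar K) (lat x) = pnorm (c * x + d) ^ (deg * (deg - 1)) * measure (haar K) (lat (moebius a b c d x))"
proof -
  let ?u = "(c * x + d) ^ (deg - 1)"
  have u: "?u \<in> K" "?u \<noteq> 0"
    using m moebius_denom_K[OF m] by (auto simp: moebius_data_def intro: K.power_L)
  have "lat x = (*) ?u ` lat (moebius a b c d x)"
    unfolding lat_def by (rule moebius_values[OF m F.is_subring_O order_refl, symmetric])
  then have "emeasure (haar K) (lat x) = ennreal (pnorm ?u ^ deg) * emeasure (haar K) (lat (moebius a b c d x))"
    using haar_scale(2)[OF u lat_sets[OF moebius_K[OF m]]] by simp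
  then show ?thesis
    by (simp add: measure_def enn2real_mult F.pnorm_power power_mult[symmetric] mult.commute)
qed

lemma moebius_mean_power:
  assumes m: "moebius_data a b c d x"
  shows "F.mean_power r j x = pnorm (c * x + d) ^ (j * r) * F.mean_power r j (moebius a b c d x)"
proof -
  interpret prob_space "Omega F j" by (rule F.prob_space_Omega)
  let ?u = "(c * x + d) ^ j"
  have "?u \<noteq> 0"
    using m by (simp add: moebius_data_def)
  then have "uniform_on ((*) ?u ` poly_values F.\<O> j (moebius a b c d x)) (Omega F j) (\<lambda>w. ?u * poly (poly_of j w) (moebius a b c d x))"
    by (intro F.uniform_on_cmult F.uniform_on_poly_values)
  then have "(\<integral>w. pnorm (?u * poly (poly_of j w) (moebius a b c d x)) ^ r \<partial>Omega F j) = measure (Omega F j) (space (Omega F j)) * F.mean_power r j x"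
    unfolding moebius_values[OF m F.is_subring_O order_refl]
    by (intro F.mean_power_unique) unfold_locales
  then show ?thesis
    by (simp add: F.pnorm_mult F.pnorm_power power_mult_distrib F.mean_power_def prob_space flip: power_mult)
qed

text \<open>The density without the discriminant. The denominator is \<open>1\<close> for integral
  \<open>x\<close>. Its exponent is chosen through
  \<open>(n + 1) * deg = deg * (deg - 1) + (n - deg) * deg + 2 * deg\<close>: the first two terms
  cancel the factors of the lattice measure and of the mean under homographies, leaving
  \<open>2 * deg\<close>.\<close>

definition weight :: "nat \<Rightarrow> 'a \<Rightarrow> real" where
  "weight n x = measure (haar K) (lat x) * F.mean_power deg (n - deg) x / max 1 (pnorm x) ^ ((n + 1) * deg)"

lemma moebius_weight:
  assumes m: "moebius_data a b c d x" and n: "deg \<le> n"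
  shows "weight n (moebius a b c d x) = pnorm (c * x + d) ^ (2 * deg) * weight n x"
proof -
  let ?x = "moebius a b c d x" and ?u = "pnorm (c * x + d)"
  have u: "?u \<noteq> 0"
    using m by (simp add: moebius_data_def)
  have "weight n x = (?u ^ (deg * (deg - 1)) * measure (haar K) (lat ?x)) *
      (?u ^ ((n - deg) * deg) * F.mean_power deg (n - deg) ?x) / (max 1 (pnorm ?x) * ?u) ^ ((n + 1) * deg)"
    unfolding weight_def moebius_max[OF m]
    by (simp only: moebius_measure_lat[OF m] moebius_mean_power[OF m, of deg "n - deg"])
  also have "\<dots> = weight n ?x * (?u ^ (deg * (deg - 1) + (n - deg) * deg) / ?u ^ ((n + 1) * deg))"
  proof -
    have "(A * l) * (B * k) / (M * u) ^ E = (l * k / M ^ E) * (A * B / u ^ E)" for A B l k M u :: real and E :: nat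
      by (simp add: power_mult_distrib)
    then show ?thesis
      unfolding weight_def power_add[of ?u "deg * (deg - 1)"] .
  qed
  also have "(n + 1) * deg = (deg * (deg - 1) + (n - deg) * deg) + 2 * deg"
  proof -
    obtain e where e: "deg = Suc e"
      using deg_pos by (cases deg) auto
    obtain k where k: "n = deg + k"
      using n le_iff_add by blast
    show ?thesis
      unfolding k by (simp add: e algebra_simps)
  qed
  also have "?u ^ (deg * (deg - 1) + (n - deg) * deg) / ?u ^ ((deg * (deg - 1) + (n - deg) * deg) + 2 * deg) = 1 / ?u ^ (2 * deg)"
    using u by (simp add: power_add)
  finally show ?thesis
    using u by simp
qed

lemma moebius_inversion:
  assumes "x \<in> K" "x \<noteq> 0"
  shows "moebius_data 0 1 1 0 x"
  unfolding moebius_data_def using assms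
  by (intro conjI exI[of _ 0] exI[of _ 1]) auto

lemma adjoin_inverse:
  assumes "x \<in> K" "x \<noteq> 0"
  shows "adjoin F (inverse x) = K \<longleftrightarrow> adjoin F x = K"
  using moebius_adjoin[OF moebius_inversion[OF assms]] by (simp add: inverse_eq_divide)

lemma outside_int:
  assumes "x \<in> K" "x \<notin> int_ring K"
  shows "x \<noteq> 0" "inverse x \<in> K.\<O>" "inverse x \<in> K" "1 < pnorm x"
proof -
  show 1: "1 < pnorm x"
    using assms by (auto simp: int_ring_def)
  then show "x \<noteq> 0"
    by auto
  show "inverse x \<in> K"
    using assms by (intro K.inverse_L)
  then show "inverse x \<in> K.\<O>"
    using 1 by (simp add: K.int_ring_iff F.pnorm_inverse inverse_le_1_iff)
qed

text \<open>If \<open>x\<close> generates \<open>K\<close>, the reciprocal of the index is the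
  lattice measure. Otherwise the case distinction in \<open>rho_int\<close> agrees with the formula
  because the lattice is null.\<close>

lemma rho_int_eq:
  assumes x: "x \<in> K.\<O>" and n: "deg \<le> n"
  shows "rho_int F K n x = pnorm (discriminant F K) * weight n x"
proof (cases "adjoin F x = K")
  case True
  have "max 1 (pnorm x) = 1"
    using x by (simp add: K.int_ring_iff)
  then show ?thesis
    using True n lat_index[OF x True]
    by (simp add: rho_int_def Let_def weight_def F.mean_power_def flip: deg_def)
next
  case False
  then show ?thesis
    using lat_null[OF K.int_ring_L[OF x] False] by (simp add: rho_int_def Let_def weight_def)
qed

text \<open>For \<open>x\<close> outside the ring of integers, the factor in the definition of
  \<open>rho\<close> cancels exactly the factor from \<open>moebius_weight\<close> for the inversion
  \<open>x \<mapsto> 1 / x\<close>.\<close>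

lemma rho_eq:
  assumes x: "x \<in> K" and n: "deg \<le> n"
  shows "rho F K n x = pnorm (discriminant F K) * weight n x"
proof (cases "x \<in> int_ring K")
  case True
  then show ?thesis
    using rho_int_eq[of x n] n by (simp add: rho_def K.\<O>_def)
next
  case False
  note out = outside_int[OF x False]
  have "weight n (inverse x) = pnorm x ^ (2 * deg) * weight n x"
    using moebius_weight[OF moebius_inversion[OF x out(1)] n] by (simp add: inverse_eq_divide)
  moreover have "pnorm x powi (- 2 * int deg) * pnorm x ^ (2 * deg) = 1"
  proof -
    have "pnorm x powi (- 2 * int deg) = inverse (pnorm x ^ (2 * deg))"
      by (metis mult_minus_left of_nat_mult of_nat_numeral power_int_minus power_int_of_nat)
    then show ?thesis
      using out(1) by simp
  qed
  moreover have "rho F K n x = pnorm x powi (- 2 * int deg) * (pnorm (discriminant F K) * weight n (inverse x))"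
    using False rho_int_eq[OF out(2) n] by (simp add: rho_def flip: deg_def)
  moreover have "P * (D * (X * w)) = (P * X) * (D * w)" for P D X w :: real
    by simp
  ultimately show ?thesis
    by (simp only: mult_1_left)
qed

lemma rho_int_eq_0: "adjoin F x \<noteq> K \<or> n < deg \<Longrightarrow> rho_int F K n x = 0"
  unfolding rho_int_def Let_def deg_def[symmetric] by (rule if_not_P) (use leD in blast)

lemma rho_eq_0:
  assumes x: "x \<in> K" and "adjoin F x \<noteq> K \<or> n < deg"
  shows "rho F K n x = 0"
proof (cases "x \<in> int_ring K")
  case True
  then show ?thesis
    using rho_int_eq_0[OF assms(2)] by (simp add: rho_def)
next
  case False
  have "adjoin F (inverse x) \<noteq> K \<or> n < deg"
    using assms(2) unfolding adjoin_inverse[OF x outside_int(1)[OF x False]] .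
  from rho_int_eq_0[OF this] show ?thesis
    using False by (simp add: rho_def)
qed

text \<open>\<open>rho\<close> is defined by cases, but \<open>rho_eq\<close> gives a single formula
  on all of \<open>K\<close>, so nothing has to be glued along the boundary of the ring of
  integers.\<close>

lemma continuous_rho: "continuous_on K (rho F K n)"
proof (cases "deg \<le> n")
  case True
  have "continuous_on K (\<lambda>x. pnorm (discriminant F K) * weight n x)"
    unfolding weight_def
    by (intro continuous_intros continuous_measure_lat F.continuous_mean_power F.continuous_on_pnorm) auto
  then show ?thesis
    by (rule continuous_on_eq) (simp add: rho_eq[OF _ True])
next
  case False
  have "continuous_on K (\<lambda>x. 0 :: real)"
    by (rule continuous_on_const)
  then show ?thesis
    by (rule continuous_on_eq) (use False rho_eq_0 in auto)
qed

lemma rho_moebius: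
  assumes m: "moebius_data a b c d x"
  shows "rho F K n (moebius a b c d x) = pnorm (c * x + d) ^ (2 * deg) * rho F K n x"
proof -
  have x: "x \<in> K"
    using m by (simp add: moebius_data_def)
  show ?thesis
  proof (cases "deg \<le> n")
    case True
    then show ?thesis
      using rho_eq[OF x True] rho_eq[OF moebius_K[OF m] True] moebius_weight[OF m True] by simp
  next
    case False
    then show ?thesis
      using rho_eq_0[OF x] rho_eq_0[OF moebius_K[OF m]] by simp
  qed
qed

text \<open>The mean grows strictly while \<open>Suc (n - deg) < deg\<close>, that is
  \<open>n < 2 * deg - 1\<close>, because \<open>x ^ Suc (n - deg)\<close> is then independent of
  the lower powers; from there on the groups of values are equal.\<close>

lemma weight_mono:
  assumes x: "x \<in> K.\<O>" "adjoin F x = K" and n: "deg \<le> n"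
  shows "weight n x \<le> weight (n + 1) x" "weight n x < weight (n + 1) x \<longleftrightarrow> n < 2 * deg - 1"
proof -
  let ?m = "n - deg"
  have xK: "x \<in> K"
    using x(1) by (rule K.int_ring_L)
  have max: "max 1 (pnorm x) = 1"
    using x by (simp add: K.int_ring_iff)
  have Suc: "n + 1 - deg = Suc ?m"
    using n by simp
  have w: "weight n x = measure (haar K) (lat x) * F.mean_power deg ?m x"
    "weight (n + 1) x = measure (haar K) (lat x) * F.mean_power deg (Suc ?m) x"
    unfolding weight_def max Suc by simp_all
  have pos: "0 < measure (haar K) (lat x)"
    by (rule lat_pos[OF xK x(2)])
  show "weight n x \<le> weight (n + 1) x"
    unfolding w using F.mean_power_mono pos by (intro mult_left_mono) auto
  show "weight n x < weight (n + 1) x \<longleftrightarrow> n < 2 * deg - 1"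
  proof (cases "n < 2 * deg - 1")
    case True
    then have "Suc ?m < deg"
      using n by linarith
    then have "F.mean_power deg ?m x < F.mean_power deg (Suc ?m) x"
      using power_notin_poly_values[OF xK x(2)] F.int_ring_L by (intro F.mean_power_less deg_pos) auto
    then show ?thesis
      using True pos unfolding w by simp
  next
    case False
    then have "deg - 1 \<le> ?m"
      using n by linarith
    then have "poly_values F.\<O> (Suc ?m) x = poly_values F.\<O> ?m x"
      by (metis poly_values_int[OF x(1)] le_SucI)
    then have "F.mean_power deg (Suc ?m) x = F.mean_power deg ?m x"
      by (rule F.mean_power_eq_if_poly_values_eq)
    then show ?thesis
      using False unfolding w by simp
  qed
qed

lemma weight_pos: "x \<in> K \<Longrightarrow> adjoin F x = K \<Longrightarrow> 0 < weight n x"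
  unfolding weight_def using lat_pos mean_power_pos by (intro divide_pos_pos mult_pos_pos) auto

text \<open>The discriminant multiplies both sides, so strictness can only be transferred when it is
  nonzero; \<open>discriminant_nonzero\<close> supplies this later.\<close>

lemma rho_int_mono:
  assumes x: "x \<in> K.\<O>" and D: "discriminant F K \<noteq> 0"
  shows "rho_int F K n x \<le> rho_int F K (n + 1) x"
    "rho_int F K n x < rho_int F K (n + 1) x \<longleftrightarrow> adjoin F x = K \<and> deg \<le> n + 1 \<and> n < 2 * deg - 1"
proof -
  have "rho_int F K n x \<le> rho_int F K (n + 1) x \<and>
    (rho_int F K n x < rho_int F K (n + 1) x \<longleftrightarrow> adjoin F x = K \<and> deg \<le> n + 1 \<and> n < 2 * deg - 1)"
  proof (cases "adjoin F x = K \<and> deg \<le> n + 1")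
    case False
    then have "adjoin F x \<noteq> K \<or> n < deg" "adjoin F x \<noteq> K \<or> n + 1 < deg"
      by linarith+
    then have "rho_int F K n x = 0" "rho_int F K (n + 1) x = 0"
      by (simp_all only: rho_int_eq_0)
    then show ?thesis
      using False by linarith
  next
    case True
    show ?thesis
    proof (cases "deg \<le> n")
      case le: True
      then show ?thesis
        using weight_mono[OF x _ le] True D rho_int_eq[OF x le] rho_int_eq[OF x, of "n + 1"]
        by (simp add: mult_left_mono mult_less_cancel_left_pos)
    next
      case False
      \<comment> \<open>The boundary value \<open>n = deg - 1\<close>: here the density jumps from
        \<open>0\<close> to a positive number. This strict step is why the lower bound reads
        \<open>deg \<le> n + 1\<close> and not \<open>deg \<le> n\<close>.\<close>
      then have n: "n + 1 = deg"
        using True by simp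
      have "rho_int F K n x = 0"
        using False by (simp add: rho_int_def Let_def flip: deg_def)
      moreover have "0 < rho_int F K (n + 1) x"
        using rho_int_eq[OF x, of "n + 1"] n weight_pos[OF K.int_ring_L[OF x]] True D by simp
      moreover have "n < 2 * deg - 1"
        using n by simp
      ultimately show ?thesis
        using True by simp
    qed
  qed
  then show "rho_int F K n x \<le> rho_int F K (n + 1) x"
    "rho_int F K n x < rho_int F K (n + 1) x \<longleftrightarrow> adjoin F x = K \<and> deg \<le> n + 1 \<and> n < 2 * deg - 1"
    by blast+
qed

end

section \<open>The trace form and the discriminant\<close>

lemma lincomb_delta:
  fixes r :: nat
  shows "j < r \<Longrightarrow> (\<Sum>i<r. (if i = j then a else 0) * b i) = (a :: 'a::comm_ring_1) * b j"
  by (simp add: if_distrib[of "\<lambda>x. x * _"] cong: if_cong)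

lemma is_basis_elt:
  fixes R :: "'a::comm_ring_1 set"
  assumes "is_basis R M r b" "0 \<in> R" "1 \<in> R" "j < r" shows "b j \<in> M"
  using is_basis_comb[OF assms(1), of "\<lambda>i. if i = j then 1 else 0"] assms by (simp add: lincomb_delta)

context valued_field
begin

text \<open>In effect a nonzero \<open>L\<close>-linear functional on the \<open>L\<close>-span of
  the \<open>u j\<close> is constructed and \<open>w j\<close> is its value at \<open>u j\<close>;
  every relation with coefficients in \<open>L\<close> is then inherited. It moves kernel vectors of
  matrices over \<open>L\<close> from the large field into \<open>L\<close>.\<close>

lemma relations_descend:
  fixes n :: nat
  assumes "\<exists>j<n. u j \<noteq> (0 :: 'a)"
  shows "\<exists>w. (\<forall>j<n. w j \<in> L) \<and> (\<exists>j<n. w j \<noteq> 0) \<and>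
    (\<forall>g. (\<forall>j<n. g j \<in> L) \<longrightarrow> (\<Sum>j<n. g j * u j) = 0 \<longrightarrow> (\<Sum>j<n. g j * w j) = 0)"
  using assms
proof (induction n)
  case (Suc n)
  show ?case
  proof (cases "\<exists>j<n. u j \<noteq> 0")
    case True
    then obtain w where w: "\<forall>j<n. w j \<in> L" "\<exists>j<n. w j \<noteq> 0"
      "\<And>g. (\<forall>j<n. g j \<in> L) \<Longrightarrow> (\<Sum>j<n. g j * u j) = 0 \<Longrightarrow> (\<Sum>j<n. g j * w j) = 0"
      using Suc.IH by blast
    \<comment> \<open>The value at the new vector: forced by linearity if \<open>u n\<close> lies in
      the span of its predecessors, and freely set to \<open>0\<close> otherwise, since then every
      relation has \<open>g n = 0\<close>.\<close>
    obtain z where z: "z \<in> L" "\<And>g. (\<forall>j<Suc n. g j \<in> L) \<Longrightarrow> (\<Sum>j<Suc n. g j * u j) = 0 \<Longrightarrow>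
        (\<Sum>j<n. g j * w j) + g n * z = 0"
    proof (cases "u n \<in> lincomb_set L n u")
      case True
      then obtain a where a: "\<forall>j<n. a j \<in> L" "u n = (\<Sum>j<n. a j * u j)"
        unfolding lincomb_set_def by blast
      show thesis
      proof (rule that)
        show "(\<Sum>j<n. a j * w j) \<in> L"
          using a w by (intro sum_L mult_L) auto
        fix g assume g: "\<forall>j<Suc n. g j \<in> L" "(\<Sum>j<Suc n. g j * u j) = 0"
        have "(\<Sum>j<n. (g j + g n * a j) * u j) = 0"
          using g(2) by (simp add: a(2) distrib_right sum.distrib sum_distrib_left mult.assoc)
        then have "(\<Sum>j<n. (g j + g n * a j) * w j) = 0"
          using g(1) a(1) by (intro w(3) allI impI add_L mult_L) auto
        then show "(\<Sum>j<n. g j * w j) + g n * (\<Sum>j<n. a j * w j) = 0"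
          by (simp add: distrib_right sum.distrib sum_distrib_left mult.assoc)
      qed
    next
      case False
      show thesis
      proof (rule that)
        fix g assume g: "\<forall>j<Suc n. g j \<in> L" "(\<Sum>j<Suc n. g j * u j) = 0"
        have "g n = 0"
        proof (rule ccontr)
          assume "g n \<noteq> 0"
          then have "u n = (\<Sum>j<n. (- g j / g n) * u j)"
            using g(2) by (simp add: sum_negf sum_divide_distrib[symmetric] eq_neg_iff_add_eq_0 field_simps)
          also have "\<dots> \<in> lincomb_set L n u"
            using g(1) by (intro lincomb_setI divide_L minus_L) auto
          finally show False
            using False by simp
        qed
        then show "(\<Sum>j<n. g j * w j) + g n * 0 = 0"
          using g w(3)[of g] by simp
      qed simp
    qed
    show ?thesis
    proof (intro exI[of _ "w(n := z)"] conjI allI impI)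
      show "(w(n := z)) j \<in> L" if "j < Suc n" for j
        using that w z by (auto simp: less_Suc_eq)
      show "\<exists>j<Suc n. (w(n := z)) j \<noteq> 0"
        using w(2) by (metis fun_upd_other less_SucI less_irrefl)
      show "(\<Sum>j<Suc n. g j * (w(n := z)) j) = 0"
        if "\<forall>j<Suc n. g j \<in> L" "(\<Sum>j<Suc n. g j * u j) = 0" for g
        using z(2)[OF that] by simp
    qed
  next
    case False
    then have u: "\<And>j. j < n \<Longrightarrow> u j = 0" "u n \<noteq> 0"
      using Suc.prems by (auto simp: less_Suc_eq)
    show ?thesis
    proof (intro exI[of _ "\<lambda>j. if j = n then 1 else 0"] conjI allI impI)
      fix g assume "(\<Sum>j<Suc n. g j * u j) = 0"
      then have "g n = 0"
        using u by simp
      then show "(\<Sum>j<Suc n. g j * (if j = n then 1 else 0)) = 0"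
        by simp
    qed auto
  qed
qed simp

end

definition mult_matrix :: "'a::field set \<Rightarrow> nat \<Rightarrow> (nat \<Rightarrow> 'a) \<Rightarrow> 'a \<Rightarrow> (nat \<Rightarrow> nat \<Rightarrow> 'a) \<Rightarrow> bool" where
  "mult_matrix F r b x T \<longleftrightarrow> (\<forall>i<r. \<forall>j<r. T i j \<in> F) \<and> (\<forall>j<r. x * b j = (\<Sum>i<r. T i j * b i))"

lemma mult_matrix_exists:
  assumes b: "is_basis F K r b" and K: "is_subfield F" "is_subfield K" and x: "x \<in> K"
  shows "\<exists>T. mult_matrix F r b x T"
proof -
  have "\<exists>c. (\<forall>i<r. c i \<in> F) \<and> x * b j = (\<Sum>i<r. c i * b i)" if "j < r" for j
  proof -
    have "x * b j \<in> K"
      by (rule is_subfieldD(4)[OF K(2) x is_basis_elt[OF b is_subfieldD(1,2)[OF K(1)] that]])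
    then show ?thesis
      using is_basis_coeffs[OF b] by metis
  qed
  then obtain T where "\<And>i j. j < r \<Longrightarrow> i < r \<Longrightarrow> T j i \<in> F" "\<And>j. j < r \<Longrightarrow> x * b j = (\<Sum>i<r. T j i * b i)"
    by metis
  then have "mult_matrix F r b x (\<lambda>i j. T j i)"
    by (simp add: mult_matrix_def)
  then show ?thesis
    by blast
qed

text \<open>With \<open>P\<close> and \<open>Q\<close> the mutually inverse base changes,
  \<open>T'\<close> is a conjugate of \<open>T\<close>, and cyclic reordering of the trace contracts
  \<open>Q\<close> with \<open>P\<close>. This makes the \<open>THE\<close> in
  \<open>field_trace\<close> well defined.\<close>

lemma mult_matrix_trace_unique:
  assumes b: "is_basis F K r b" and b': "is_basis F K r b'" and F: "is_subfield F"
    and T: "mult_matrix F r b x T" and T': "mult_matrix F r b' x T'"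
  shows "(\<Sum>i<r. T i i) = (\<Sum>i<r. T' i i)"
proof -
  note fld = is_subfieldD[OF F]
  have sumF: "sum f A \<in> F" if "\<And>i. i \<in> A \<Longrightarrow> f i \<in> F" for f and A :: "nat set"
    using that by (induction A rule: infinite_finite_induct) (auto intro: fld)
  have ex: "\<exists>P. (\<forall>j<r. \<forall>i<r. P j i \<in> F) \<and> (\<forall>j<r. b' j = (\<Sum>i<r. P j i * b i))"
    if "is_basis F K r b" "is_basis F K r b'" for b b'
  proof -
    have "\<exists>c. (\<forall>i<r. c i \<in> F) \<and> b' j = (\<Sum>i<r. c i * b i)" if "j < r" for j
      using is_basis_coeffs[OF \<open>is_basis F K r b\<close> is_basis_elt[OF \<open>is_basis F K r b'\<close> fld(1,2) that]] by metis
    then show ?thesis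
      by metis
  qed
  obtain P where P: "\<And>i j. j < r \<Longrightarrow> i < r \<Longrightarrow> P j i \<in> F" "\<And>j. j < r \<Longrightarrow> b' j = (\<Sum>i<r. P j i * b i)"
    using ex[OF b b'] by blast
  obtain Q where Q: "\<And>i j. j < r \<Longrightarrow> i < r \<Longrightarrow> Q j i \<in> F" "\<And>j. j < r \<Longrightarrow> b j = (\<Sum>i<r. Q j i * b' i)"
    using ex[OF b' b] by blast
  have PQ: "(\<Sum>k<r. Q l k * P k i) = (if i = l then 1 else 0)" if "l < r" "i < r" for l i
  proof -
    have "(\<Sum>i<r. (\<Sum>k<r. Q l k * P k i) * b i) = (\<Sum>k<r. Q l k * (\<Sum>i<r. P k i * b i))"
      unfolding sum_distrib_left sum_distrib_right by (subst sum.swap) (simp add: mult.assoc)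
    also have "\<dots> = (\<Sum>k<r. Q l k * b' k)"
      by (intro sum.cong refl) (simp only: lessThan_iff P(2))
    also have "\<dots> = b l"
      using Q(2)[OF that(1)] by simp
    also have "\<dots> = (\<Sum>i<r. (if i = l then 1 else 0) * b i)"
      using that(1) by (simp add: lincomb_delta)
    finally have eq: "(\<Sum>i<r. (\<Sum>k<r. Q l k * P k i) * b i) = (\<Sum>i<r. (if i = l then 1 else 0) * b i)" .
    show ?thesis
      by (rule is_basis_unique[OF b _ _ eq that(2)]) (use P(1) Q(1) that fld in \<open>auto intro!: sumF intro: fld(4)\<close>)
  qed
  have T'eq: "T' k j = (\<Sum>i<r. \<Sum>l<r. P j i * T l i * Q l k)" if "j < r" "k < r" for j k
  proof -
    have "(\<Sum>k<r. T' k j * b' k) = x * b' j"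
      using T' that by (simp add: mult_matrix_def)
    also have "\<dots> = (\<Sum>i<r. P j i * (x * b i))"
      by (subst P(2)[OF that(1)]) (simp add: sum_distrib_left mult_ac)
    also have "\<dots> = (\<Sum>i<r. P j i * (\<Sum>l<r. T l i * b l))"
      using T by (intro sum.cong refl) (simp add: mult_matrix_def)
    also have "\<dots> = (\<Sum>i<r. P j i * (\<Sum>l<r. T l i * (\<Sum>k<r. Q l k * b' k)))"
      by (intro sum.cong refl arg_cong2[where f = "(*)"]) (simp only: lessThan_iff Q(2))
    also have "\<dots> = (\<Sum>i<r. \<Sum>l<r. \<Sum>k<r. (P j i * T l i * Q l k) * b' k)"
      by (simp add: sum_distrib_left mult.assoc)
    also have "\<dots> = (\<Sum>i<r. \<Sum>k<r. \<Sum>l<r. (P j i * T l i * Q l k) * b' k)"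
      by (intro sum.cong refl sum.swap)
    also have "\<dots> = (\<Sum>k<r. \<Sum>i<r. \<Sum>l<r. (P j i * T l i * Q l k) * b' k)"
      by (rule sum.swap)
    also have "\<dots> = (\<Sum>k<r. (\<Sum>i<r. \<Sum>l<r. P j i * T l i * Q l k) * b' k)"
      by (simp add: sum_distrib_right)
    finally have eq: "(\<Sum>k<r. T' k j * b' k) = (\<Sum>k<r. (\<Sum>i<r. \<Sum>l<r. P j i * T l i * Q l k) * b' k)" .
    show ?thesis
      by (rule is_basis_unique[OF b' _ _ eq that(2)])
        (use P(1) Q(1) T T' that in \<open>auto simp: mult_matrix_def intro!: sumF fld(4)\<close>)
  qed
  have "(\<Sum>k<r. T' k k) = (\<Sum>k<r. \<Sum>i<r. \<Sum>l<r. P k i * T l i * Q l k)"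
    using T'eq by simp
  also have "\<dots> = (\<Sum>i<r. \<Sum>l<r. \<Sum>k<r. P k i * T l i * Q l k)"
    by (subst sum.swap) (intro sum.cong refl sum.swap)
  also have "\<dots> = (\<Sum>i<r. \<Sum>l<r. T l i * (\<Sum>k<r. Q l k * P k i))"
    by (simp add: sum_distrib_left mult_ac)
  also have "\<dots> = (\<Sum>i<r. \<Sum>l<r. T l i * (if i = l then 1 else 0))"
    using PQ by (intro sum.cong refl) simp
  also have "\<dots> = (\<Sum>i<r. T i i)"
    by (simp add: if_distrib[of "\<lambda>x. _ * x"] cong: if_cong)
  finally show ?thesis by simp
qed

context local_ext
begin

lemma field_trace_eq:
  assumes b: "is_basis F K deg b" and T: "mult_matrix F deg b x T"
  shows "field_trace F K x = (\<Sum>i<deg. T i i)"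
  unfolding field_trace_def deg_def[symmetric]
proof (rule the_equality)
  show "\<exists>b T'. is_basis F K deg b \<and> (\<forall>i<deg. \<forall>j<deg. T' i j \<in> F) \<and>
      (\<forall>j<deg. x * b j = (\<Sum>i<deg. T' i j * b i)) \<and> (\<Sum>i<deg. T i i) = (\<Sum>i<deg. T' i i)"
    using b T unfolding mult_matrix_def by blast
  fix t assume "\<exists>b T'. is_basis F K deg b \<and> (\<forall>i<deg. \<forall>j<deg. T' i j \<in> F) \<and>
      (\<forall>j<deg. x * b j = (\<Sum>i<deg. T' i j * b i)) \<and> t = (\<Sum>i<deg. T' i i)"
  then obtain b' T' where "is_basis F K deg b'" "mult_matrix F deg b' x T'" "t = (\<Sum>i<deg. T' i i)"
    unfolding mult_matrix_def by blast
  then show "t = (\<Sum>i<deg. T i i)"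
    using mult_matrix_trace_unique[OF _ b F.subfield _ T] by blast
qed

lemma field_trace_linear:
  assumes "x \<in> K" "y \<in> K" "c \<in> F"
  shows "field_trace F K (c * x + y) = c * field_trace F K x + field_trace F K y"
proof -
  obtain S T where S: "mult_matrix F deg ibasis x S" and T: "mult_matrix F deg ibasis y T"
    using mult_matrix_exists[OF ibasis(1) F.subfield K.subfield] assms by meson
  have "mult_matrix F deg ibasis (c * x + y) (\<lambda>i j. c * S i j + T i j)"
    using S T assms(3)
    by (auto simp: mult_matrix_def distrib_right sum.distrib sum_distrib_left mult.assoc intro!: F.add_L F.mult_L)
  then show ?thesis
    by (simp add: field_trace_eq[OF ibasis(1) S] field_trace_eq[OF ibasis(1) T] field_trace_eq[OF ibasis(1)]
        sum.distrib sum_distrib_left)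
qed

lemma field_trace_in_F:
  assumes "x \<in> K" shows "field_trace F K x \<in> F"
proof -
  obtain T where T: "mult_matrix F deg ibasis x T"
    using mult_matrix_exists[OF ibasis(1) F.subfield K.subfield assms] ..
  then show ?thesis
    unfolding field_trace_eq[OF ibasis(1) T] by (intro F.sum_L) (simp add: mult_matrix_def)
qed

lemma field_trace_0: "field_trace F K 0 = 0"
proof -
  have "mult_matrix F deg ibasis 0 (\<lambda>i j. 0)"
    by (simp add: mult_matrix_def)
  from field_trace_eq[OF ibasis(1) this] show ?thesis by simp
qed

lemma field_trace_1: "field_trace F K 1 = of_nat deg"
proof -
  have "mult_matrix F deg ibasis 1 (\<lambda>i j. if i = j then 1 else 0)"
    by (simp add: mult_matrix_def lincomb_delta)
  from field_trace_eq[OF ibasis(1) this] show ?thesis by simp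
qed

lemma field_trace_lincomb:
  fixes n :: nat
  assumes "\<And>i. i < n \<Longrightarrow> c i \<in> F" "\<And>i. i < n \<Longrightarrow> y i \<in> K"
  shows "field_trace F K (\<Sum>i<n. c i * y i) = (\<Sum>i<n. c i * field_trace F K (y i))"
  using assms
proof (induction n)
  case (Suc n)
  have "(\<Sum>i<Suc n. c i * y i) = c n * y n + (\<Sum>i<n. c i * y i)"
    by simp
  also have "field_trace F K \<dots> = c n * field_trace F K (y n) + field_trace F K (\<Sum>i<n. c i * y i)"
    using Suc.prems by (intro field_trace_linear K.sum_L K.mult_L) (auto intro: F_K)
  finally show ?case
    using Suc by simp
qed (simp add: field_trace_0)

text \<open>A relation over \<open>F\<close> becomes one over the ring of integers after
  multiplication by a common power of \<open>F.unif\<close>.\<close>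

lemma int_basis_independent:
  assumes b: "is_basis F.\<O> K.\<O> deg b" and c: "\<And>i. i < deg \<Longrightarrow> c i \<in> F" "(\<Sum>i<deg. c i * b i) = 0"
  shows "\<forall>i<deg. c i = 0"
proof -
  have "\<forall>i\<in>{..<deg}. \<exists>k. F.unif ^ k * c i \<in> F.\<O>"
    using F.scale_into_int c(1) by blast
  then obtain k where k: "\<And>i. i < deg \<Longrightarrow> F.unif ^ k i * c i \<in> F.\<O>"
    by (metis lessThan_iff)
  define N where "N = Max (k ` {..<deg})"
  have N: "F.unif ^ N * c i \<in> F.\<O>" if "i < deg" for i
  proof -
    have "k i \<le> N"
      unfolding N_def using that by (intro Max_ge) auto
    then have "F.unif ^ N * c i = F.unif ^ (N - k i) * (F.unif ^ k i * c i)"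
      by (simp add: mult.assoc[symmetric] power_add[symmetric])
    then show ?thesis
      using k[OF that] F.mult_int F.power_int[OF F.unif_int] by metis
  qed
  have "(\<Sum>i<deg. (F.unif ^ N * c i) * b i) = F.unif ^ N * (\<Sum>i<deg. c i * b i)"
    by (simp add: sum_distrib_left mult.assoc)
  then have eq: "(\<Sum>i<deg. (F.unif ^ N * c i) * b i) = (\<Sum>i<deg. 0 * b i)"
    using c(2) by simp
  have "F.unif ^ N * c i = 0" if "i < deg" for i
    by (rule is_basis_unique[OF b _ _ eq that]) (use N in auto)
  then show ?thesis
    by simp
qed

text \<open>The discriminant uses whichever integral basis \<open>SOME\<close> selects, so
  nondegeneracy has to be available for all of them and not only for \<open>ibasis\<close>.\<close>

lemma int_basis_basis:
  assumes b: "is_basis F.\<O> K.\<O> deg b"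
  shows "is_basis F K deg b"
proof (rule is_basisI)
  have bK: "b i \<in> K" if "i < deg" for i
    using is_basis_elt[OF b F.zero_int F.one_int that] K.int_ring_L by blast
  show "(\<Sum>i<deg. c i * b i) \<in> K" if "\<And>i. i < deg \<Longrightarrow> c i \<in> F" for c
    using that bK by (auto intro!: K.sum_L K.mult_L intro: F_K)
  fix y assume y: "y \<in> K"
  obtain k where k: "F.unif ^ k * y \<in> K.\<O>"
    using scale_F_into_KO[OF y] ..
  obtain c where c: "\<And>i. i < deg \<Longrightarrow> c i \<in> F.\<O>" "F.unif ^ k * y = (\<Sum>i<deg. c i * b i)"
    using is_basis_coeffs[OF b k] by blast
  show "\<exists>c. (\<forall>i<deg. c i \<in> F) \<and> y = (\<Sum>i<deg. c i * b i)"
  proof (intro exI[of _ "\<lambda>i. c i / F.unif ^ k"] conjI allI impI)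
    show "y = (\<Sum>i<deg. c i / F.unif ^ k * b i)"
      using c(2) by (simp add: sum_divide_distrib[symmetric] field_simps)
  qed (use c F.unif(1) in \<open>auto intro!: F.divide_L F.power_L intro: F.int_ring_L\<close>)
qed (use int_basis_independent[OF b] F.diff_L in auto)

text \<open>A kernel vector of the Gram matrix of the trace form, moved into \<open>F\<close>, gives a nonzero \<open>y\<close>
  with \<open>tr (z y) = 0\<close> for all \<open>z\<close>; but \<open>tr 1 = [K:F] \<noteq> 0\<close> in characteristic zero.\<close>

lemma trace_form_nondegenerate:
  assumes b: "is_basis F K deg b"
  shows "Determinant.det (mat deg deg (\<lambda>(i, j). field_trace F K (b i * b j))) \<noteq> 0"
proof
  let ?G = "mat deg deg (\<lambda>(i, j). field_trace F K (b i * b j))"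
  have bK: "b i \<in> K" if "i < deg" for i
    by (rule is_basis_elt[OF b F.zero_L F.one_L that])
  assume "Determinant.det ?G = 0"
  then obtain v where v: "v \<in> carrier_vec deg" "v \<noteq> 0\<^sub>v deg" "?G *\<^sub>v v = 0\<^sub>v deg"
    using det_0_iff_vec_prod_zero_field[of ?G deg] by auto
  have row: "(\<Sum>j<deg. field_trace F K (b i * b j) * v $ j) = 0" if "i < deg" for i
    using arg_cong[OF v(3), of "\<lambda>u. u $ i"] that v(1)
    by (auto simp: scalar_prod_def atLeast0LessThan)
  have "\<exists>j<deg. v $ j \<noteq> 0"
  proof (rule ccontr)
    assume "\<not> (\<exists>j<deg. v $ j \<noteq> 0)"
    then have "v = 0\<^sub>v deg"
      using v(1) by (intro eq_vecI) auto
    then show False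
      using v(2) by simp
  qed
  then obtain w where w: "\<forall>j<deg. w j \<in> F" "\<exists>j<deg. w j \<noteq> 0"
    "\<And>g. (\<forall>j<deg. g j \<in> F) \<Longrightarrow> (\<Sum>j<deg. g j * v $ j) = 0 \<Longrightarrow> (\<Sum>j<deg. g j * w j) = 0"
    using F.relations_descend[of deg "\<lambda>j. v $ j"] by blast
  define y where "y = (\<Sum>j<deg. w j * b j)"
  have yK: "y \<in> K"
    unfolding y_def using w(1) by (intro is_basis_comb[OF b]) auto
  have "y \<noteq> 0"
  proof
    assume "y = 0"
    then have eq: "(\<Sum>j<deg. w j * b j) = (\<Sum>j<deg. 0 * b j)"
      by (simp add: y_def)
    have "w j = 0" if "j < deg" for j
      by (rule is_basis_unique[OF b _ _ eq that]) (use w(1) in auto)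
    then show False
      using w(2) by blast
  qed
  have tr0: "field_trace F K (b i * y) = 0" if i: "i < deg" for i
  proof -
    have "b i * y = (\<Sum>j<deg. w j * (b i * b j))"
      by (simp add: y_def sum_distrib_left mult_ac)
    then have "field_trace F K (b i * y) = (\<Sum>j<deg. w j * field_trace F K (b i * b j))"
      using field_trace_lincomb[of deg w "\<lambda>j. b i * b j"] w(1) bK i by (auto intro: K.mult_L)
    also have "\<dots> = (\<Sum>j<deg. field_trace F K (b i * b j) * w j)"
      by (simp add: mult.commute)
    also have "\<dots> = 0"
      using row[OF i] bK i by (intro w(3)) (auto intro!: field_trace_in_F K.mult_L)
    finally show ?thesis .
  qed
  obtain c where c: "\<And>i. i < deg \<Longrightarrow> c i \<in> F" "inverse y = (\<Sum>i<deg. c i * b i)"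
    using is_basis_coeffs[OF b K.inverse_L[OF yK]] by blast
  have "inverse y * y = (\<Sum>i<deg. c i * (b i * y))"
    by (simp add: c(2) sum_distrib_right mult.assoc)
  then have "field_trace F K 1 = (\<Sum>i<deg. c i * field_trace F K (b i * y))"
    using \<open>y \<noteq> 0\<close> field_trace_lincomb[of deg c "\<lambda>i. b i * y"] c(1) bK yK by (auto intro: K.mult_L)
  then show False
    using tr0 deg_pos by (simp add: field_trace_1)
qed

text \<open>\<open>SOME\<close> satisfies its predicate because an integral basis exists, and every
  value allowed by the predicate is a nonzero Gram determinant.\<close>

lemma discriminant_nonzero: "discriminant F K \<noteq> 0"
proof -
  let ?P = "\<lambda>D. \<exists>b. is_basis F.\<O> K.\<O> deg b \<and> D = Determinant.det (mat deg deg (\<lambda>(i, j). field_trace F K (b i * b j)))"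
  have "\<exists>D. ?P D"
    using ibasis(2) by blast
  then have "?P (SOME D. ?P D)"
    by (rule someI_ex)
  moreover have "discriminant F K = (SOME D. ?P D)"
    by (simp add: discriminant_def F.\<O>_def K.\<O>_def deg_def)
  ultimately show ?thesis
    using trace_form_nondegenerate[OF int_basis_basis] by auto
qed

end

section \<open>Monotonicity on K and the explicit values of the density\<close>

context normalized_ext
begin

lemma rho_mono:
  assumes x: "x \<in> K"
  shows "rho F K n x \<le> rho F K (n + 1) x"
    "rho F K n x < rho F K (n + 1) x \<longleftrightarrow> adjoin F x = K \<and> deg \<le> n + 1 \<and> n < 2 * deg - 1"
proof -
  have "rho F K n x \<le> rho F K (n + 1) x \<and>
    (rho F K n x < rho F K (n + 1) x \<longleftrightarrow> adjoin F x = K \<and> deg \<le> n + 1 \<and> n < 2 * deg - 1)"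
  proof (cases "x \<in> int_ring K")
    case True
    then show ?thesis
      using rho_int_mono[of x n] discriminant_nonzero by (simp add: rho_def K.\<O>_def)
  next
    case False
    note out = outside_int[OF x False]
    have "0 < pnorm x powi (- 2 * int deg)"
      using out(1) by (intro zero_less_power_int) simp
    then show ?thesis
      using False rho_int_mono[OF out(2) discriminant_nonzero, of n] adjoin_inverse[OF x out(1)]
      by (simp add: rho_def flip: deg_def)
  qed
  then show "rho F K n x \<le> rho F K (n + 1) x"
    "rho F K n x < rho F K (n + 1) x \<longleftrightarrow> adjoin F x = K \<and> deg \<le> n + 1 \<and> n < 2 * deg - 1"
    by blast+
qed

text \<open>For \<open>n = deg\<close> the random polynomial has degree \<open>0\<close>, so the
  mean is the constant computed in \<open>mean_power_degree_0_eq\<close>.\<close>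

lemma rho_deg:
  assumes x: "x \<in> int_ring K" "adjoin F x = K"
  shows "rho F K deg x = pnorm (discriminant F K) * (1 / real (quot_card (int_ring K) (adjoin (int_ring F) x))) *
    ((real F.resq ^ (deg + 1) - real F.resq ^ deg) / (real F.resq ^ (deg + 1) - 1))"
  using x unfolding mean_power_degree_0_eq[of deg x, symmetric]
  by (simp add: rho_def rho_int_def Let_def F.mean_power_def flip: deg_def)

text \<open>The condition on \<open>m\<close> says \<open>deg - 1 \<le> m - deg\<close>. The values
  then fill the whole order, the mean is the one of degree \<open>deg - 1\<close>, and
  \<open>integral_lat\<close> turns lattice measure times mean into the integral.\<close>

lemma rho_stable:
  assumes x: "x \<in> int_ring K" "adjoin F x = K" and m: "2 * deg - 1 \<le> m"
  shows "rho F K m x = pnorm (discriminant F K) * (LINT t:adjoin (int_ring F) x|haar K. pnorm t ^ deg)"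
proof -
  have xO: "x \<in> K.\<O>"
    using x(1) by (simp add: K.\<O>_def)
  have le: "deg \<le> m" "deg - 1 \<le> m - deg"
    using m deg_pos by auto
  have "F.mean_power deg (m - deg) x = F.mean_power deg (deg - 1) x"
    by (rule F.mean_power_eq_if_poly_values_eq[OF poly_values_int[OF xO le(2)]])
  moreover have "adjoin (int_ring F) x = lat x"
    using adjoin_int[OF xO] by (simp add: lat_def F.\<O>_def)
  moreover have "max 1 (pnorm x) = 1"
    using xO by (simp add: K.int_ring_iff)
  ultimately show ?thesis
    using rho_eq[OF K.int_ring_L[OF xO] le(1)] integral_lat[OF K.int_ring_L[OF xO], of deg]
    by (simp add: weight_def)
qed

end

section \<open>Invariance under isomorphisms of extensions\<close>

locale ext_iso = K1: normalized_ext F K + K2: normalized_ext F L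
  for F K L :: "'a::{field_char_0, metric_space} set" +
  fixes \<sigma> :: "'a \<Rightarrow> 'a"
  assumes iso: "alg_iso F K L \<sigma>"
begin

lemma bij: "bij_betw \<sigma> K L"
  and fix_F: "a \<in> F \<Longrightarrow> \<sigma> a = a"
  and hom_add: "y \<in> K \<Longrightarrow> z \<in> K \<Longrightarrow> \<sigma> (y + z) = \<sigma> y + \<sigma> z"
  and hom_mult: "y \<in> K \<Longrightarrow> z \<in> K \<Longrightarrow> \<sigma> (y * z) = \<sigma> y * \<sigma> z"
  using iso by (auto simp: alg_iso_def)

lemma hom_L: "y \<in> K \<Longrightarrow> \<sigma> y \<in> L"
  using bij by (auto simp: bij_betw_def)

lemma image_K: "\<sigma> ` K = L"
  using bij by (simp add: bij_betw_def)

lemma hom_inj: "y \<in> K \<Longrightarrow> z \<in> K \<Longrightarrow> \<sigma> y = \<sigma> z \<longleftrightarrow> y = z"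
  using bij by (auto simp: bij_betw_def dest: inj_onD)

lemma hom_0: "\<sigma> 0 = 0" and hom_1: "\<sigma> 1 = 1"
  by (simp_all add: fix_F)

lemma hom_sum: "(\<And>i. i \<in> I \<Longrightarrow> f i \<in> K) \<Longrightarrow> \<sigma> (sum f I) = (\<Sum>i\<in>I. \<sigma> (f i))"
  by (induction I rule: infinite_finite_induct) (auto simp: hom_0 hom_add K1.K.sum_L)

lemma hom_power: "y \<in> K \<Longrightarrow> \<sigma> (y ^ k) = \<sigma> y ^ k"
  by (induction k) (auto simp: hom_1 hom_mult K1.K.power_L)

lemma hom_lincomb:
  "(\<And>i. i \<in> I \<Longrightarrow> c i \<in> F) \<Longrightarrow> (\<And>i. i \<in> I \<Longrightarrow> y i \<in> K) \<Longrightarrow> \<sigma> (\<Sum>i\<in>I. c i * y i) = (\<Sum>i\<in>I. c i * \<sigma> (y i))"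
  by (simp add: hom_sum K1.K.mult_L K1.F_K hom_mult fix_F)

lemma hom_diff: "y \<in> K \<Longrightarrow> z \<in> K \<Longrightarrow> \<sigma> (y - z) = \<sigma> y - \<sigma> z"
  using hom_add[of "y - z" z] K1.K.diff_L by simp

lemma hom_inverse:
  assumes "y \<in> K" shows "\<sigma> (inverse y) = inverse (\<sigma> y)"
proof (cases "y = 0")
  case False
  then have "\<sigma> (inverse y) * \<sigma> y = 1"
    using hom_mult[of "inverse y" y] assms by (simp add: K1.K.inverse_L hom_1)
  then show ?thesis
    by (metis inverse_unique mult.commute)
qed (simp add: hom_0)

lemma hom_integral:
  assumes y: "y \<in> K1.K.\<O>" shows "\<sigma> y \<in> K2.K.\<O>"
proof -
  have yK: "y \<in> K"
    using y by (rule K1.K.int_ring_L)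
  obtain c where c: "\<forall>i<K1.deg. c i \<in> K1.F.\<O>" "y ^ K1.deg = (\<Sum>i<K1.deg. c i * y ^ i)"
    using K1.integral_equation[OF y] by blast
  have "\<sigma> (\<Sum>i<K1.deg. c i * y ^ i) = (\<Sum>i<K1.deg. c i * \<sigma> (y ^ i))"
    using c(1) yK K1.F.int_ring_L by (intro hom_lincomb) (auto intro: K1.K.power_L)
  then have eq: "\<sigma> y ^ K1.deg = (\<Sum>i<K1.deg. c i * \<sigma> y ^ i)"
    by (simp only: hom_power[OF yK, symmetric] c(2))
  have "pnorm (\<sigma> y) \<le> 1"
    by (rule K1.F.pnorm_le_1_if_monic[OF _ eq]) (use c(1) in \<open>simp add: K1.F.int_ring_iff\<close>)
  then show ?thesis
    using hom_L[OF yK] by (simp add: K2.K.int_ring_iff)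
qed

text \<open>For integral \<open>y\<close>, a power \<open>y ^ e\<close> with \<open>e\<close> the
  ramification index has the absolute value of a power of \<open>unif\<close> of \<open>F\<close>,
  which is fixed by \<open>\<sigma>\<close>. The quotient and its inverse are integral,
  \<open>\<sigma>\<close> preserves integrality by transport of the monic equation, so the image of
  the quotient is again a unit.\<close>

lemma hom_pnorm:
  assumes y: "y \<in> K" shows "pnorm (\<sigma> y) = pnorm y"
proof -
  have int: "pnorm (\<sigma> y) = pnorm y" if y: "y \<in> K" "y \<noteq> 0" "pnorm y \<le> 1" for y
  proof -
    let ?e = K1.ram and ?w = "K1.F.unif"
    obtain k where k: "pnorm y = pnorm K1.K.unif ^ k"
      using K1.K.pnorm_int_cases[OF y] ..
    have eq: "pnorm (y ^ ?e) = pnorm (?w ^ k)"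
      by (simp add: K1.F.pnorm_power k K1.ram flip: power_mult) (simp add: mult.commute)
    have wF: "?w ^ k \<in> F"
      using K1.F.unif(1) by (rule K1.F.power_L)
    let ?u = "y ^ ?e * inverse (?w ^ k)"
    have uK: "?u \<in> K"
      by (rule K1.K.mult_L[OF K1.K.power_L[OF y(1)] K1.K.inverse_L[OF K1.F_K[OF wF]]])
    have "pnorm ?u = 1"
      using eq by (simp add: K1.F.pnorm_mult K1.F.pnorm_inverse)
    then have "?u \<in> K1.K.\<O>" "inverse ?u \<in> K1.K.\<O>"
      using uK K1.K.inverse_L[OF uK] by (simp_all add: K1.K.int_ring_iff K1.F.pnorm_inverse del: inverse_mult_distrib)
    then have "pnorm (\<sigma> ?u) \<le> 1" "pnorm (inverse (\<sigma> ?u)) \<le> 1"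
      using hom_integral hom_inverse[OF uK] by (metis K2.K.int_ring_iff)+
    moreover have "\<sigma> ?u \<noteq> 0"
      using hom_inj[OF uK K1.K.zero_L] y by (simp add: hom_0)
    ultimately have "pnorm (\<sigma> ?u) = 1"
      by (simp add: K1.F.pnorm_inverse inverse_le_1_iff)
    moreover have "\<sigma> ?u = \<sigma> y ^ ?e * inverse (?w ^ k)"
      using y wF by (simp add: hom_mult K1.K.power_L K1.K.inverse_L K1.F_K hom_power fix_F K1.F.inverse_L)
    then have "\<sigma> y ^ ?e = \<sigma> ?u * ?w ^ k"
      by simp
    then have "pnorm (\<sigma> y) ^ ?e = pnorm (\<sigma> ?u) * pnorm (?w ^ k)"
      by (metis K1.F.pnorm_mult K1.F.pnorm_power)
    ultimately have "pnorm (\<sigma> y) ^ ?e = pnorm (?w ^ k)"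
      by (simp only: mult_1_left)
    then have "pnorm (\<sigma> y) ^ ?e = pnorm y ^ ?e"
      using eq by (simp add: K1.F.pnorm_power)
    then show ?thesis
      by (rule power_eq_imp_eq_base) (use K1.ram_pos in auto)
  qed
  consider "y = 0" | "y \<noteq> 0" "pnorm y \<le> 1" | "y \<noteq> 0" "pnorm (inverse y) \<le> 1"
    using K1.F.pnorm_inverse[of y] by (metis inverse_le_1_iff linear)
  then show ?thesis
  proof cases
    case 3
    then show ?thesis
      using int[of "inverse y"] y by (simp add: K1.K.inverse_L hom_inverse K1.F.pnorm_inverse)
  qed (use int y hom_0 in auto)
qed

lemma hom_basis:
  assumes b: "is_basis R M r b" and R: "R \<subseteq> F" "0 \<in> R" "1 \<in> R" and M: "M \<subseteq> K"
  shows "is_basis R (\<sigma> ` M) r (\<lambda>i. \<sigma> (b i))"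
proof -
  have bK: "b i \<in> K" if "i < r" for i
    using is_basis_elt[OF b R(2,3) that] M by blast
  have lin: "(\<Sum>i<r. c i * \<sigma> (b i)) = \<sigma> (\<Sum>i<r. c i * b i)" if "\<And>i. i < r \<Longrightarrow> c i \<in> R" for c
    using that R(1) bK by (subst hom_lincomb) auto
  show ?thesis
    unfolding is_basis_def
  proof (intro conjI allI impI ballI)
    fix c assume "\<forall>i<r. c i \<in> R"
    then show "(\<Sum>i<r. c i * \<sigma> (b i)) \<in> \<sigma> ` M"
      using is_basis_comb[OF b, of c] by (simp add: lin)
  next
    fix y assume "y \<in> \<sigma> ` M"
    then obtain z where z: "z \<in> M" "y = \<sigma> z"
      by blast
    have "c \<in> {..<r} \<rightarrow>\<^sub>E R \<and> y = (\<Sum>i<r. c i * \<sigma> (b i)) \<longleftrightarrow> c \<in> {..<r} \<rightarrow>\<^sub>E R \<and> z = (\<Sum>i<r. c i * b i)" for c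
    proof (intro conj_cong refl)
      assume c: "c \<in> {..<r} \<rightarrow>\<^sub>E R"
      then have cR: "c i \<in> R" if "i < r" for i
        using that by auto
      have "(\<Sum>i<r. c i * b i) \<in> K"
        using is_basis_comb[OF b, of c] cR M by blast
      moreover have "(\<Sum>i<r. c i * \<sigma> (b i)) = \<sigma> (\<Sum>i<r. c i * b i)"
        by (rule lin) (rule cR)
      ultimately show "y = (\<Sum>i<r. c i * \<sigma> (b i)) \<longleftrightarrow> z = (\<Sum>i<r. c i * b i)"
        using z M hom_inj[of z "\<Sum>i<r. c i * b i"] by auto
    qed
    moreover have "\<exists>!c. c \<in> {..<r} \<rightarrow>\<^sub>E R \<and> z = (\<Sum>i<r. c i * b i)"
      using b z(1) unfolding is_basis_def by blast
    ultimately show "\<exists>!c. c \<in> {..<r} \<rightarrow>\<^sub>E R \<and> y = (\<Sum>i<r. c i * \<sigma> (b i))"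
      by simp
  qed
qed

lemma deg_eq: "K2.deg = K1.deg"
  using K2.basis_length[of K1.deg "\<lambda>i. \<sigma> (K1.ibasis i)"] hom_basis[OF K1.ibasis(1)] image_K by simp

lemma image_O: "\<sigma> ` K1.K.\<O> = K2.K.\<O>"
proof (intro equalityI subsetI)
  fix y assume y: "y \<in> K2.K.\<O>"
  then obtain z where z: "z \<in> K" "y = \<sigma> z"
    using image_K K2.K.int_ring_L by blast
  then show "y \<in> \<sigma> ` K1.K.\<O>"
    using y hom_pnorm[OF z(1)] by (auto simp: K1.K.int_ring_iff K2.K.int_ring_iff)
qed (use hom_integral in blast)

lemma hom_field_trace:
  assumes y: "y \<in> K" shows "field_trace F L (\<sigma> y) = field_trace F K y"
proof -
  obtain T where T: "mult_matrix F K1.deg K1.ibasis y T"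
    using mult_matrix_exists[OF K1.ibasis(1) K1.F.subfield K1.K.subfield y] ..
  have iK: "K1.ibasis i \<in> K" if "i < K1.deg" for i
    using K1.ibasis_int[OF that] by (rule K1.K.int_ring_L)
  have "mult_matrix F K2.deg (\<lambda>i. \<sigma> (K1.ibasis i)) (\<sigma> y) T"
    unfolding mult_matrix_def deg_eq
  proof (intro conjI allI impI)
    fix j assume j: "j < K1.deg"
    have "\<sigma> y * \<sigma> (K1.ibasis j) = \<sigma> (\<Sum>i<K1.deg. T i j * K1.ibasis i)"
      using T j y iK by (simp add: mult_matrix_def flip: hom_mult)
    also have "\<dots> = (\<Sum>i<K1.deg. T i j * \<sigma> (K1.ibasis i))"
      using T j iK by (intro hom_lincomb) (auto simp: mult_matrix_def)
    finally show "\<sigma> y * \<sigma> (K1.ibasis j) = (\<Sum>i<K1.deg. T i j * \<sigma> (K1.ibasis i))" .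
  qed (use T in \<open>auto simp: mult_matrix_def\<close>)
  moreover have "is_basis F L K2.deg (\<lambda>i. \<sigma> (K1.ibasis i))"
    using hom_basis[OF K1.ibasis(1)] image_K by (simp add: deg_eq)
  ultimately show ?thesis
    using K2.field_trace_eq K1.field_trace_eq[OF K1.ibasis(1) T] by (simp add: deg_eq)
qed

text \<open>The predicate under \<open>SOME\<close> in \<open>discriminant\<close>. Isomorphic
  extensions have the same predicate, so \<open>SOME\<close> returns literally the same element and
  no ambiguity by units arises.\<close>

definition disc_values :: "'a set \<Rightarrow> 'a \<Rightarrow> bool" where
  "disc_values M D \<longleftrightarrow> (\<exists>b. is_basis (int_ring F) (int_ring M) (ext_degree F M) b \<and>
     D = Determinant.det (mat (ext_degree F M) (ext_degree F M) (\<lambda>(i, j). field_trace F M (b i * b j))))"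

lemma disc_values_hom:
  assumes "disc_values K D" shows "disc_values L D"
proof -
  obtain b where b: "is_basis K1.F.\<O> K1.K.\<O> K1.deg b"
    "D = Determinant.det (mat K1.deg K1.deg (\<lambda>(i, j). field_trace F K (b i * b j)))"
    using assms unfolding disc_values_def K1.deg_def K1.F.\<O>_def K1.K.\<O>_def by blast
  have bK: "b i \<in> K" if "i < K1.deg" for i
    using is_basis_elt[OF b(1) K1.F.zero_int K1.F.one_int that] K1.K.int_ring_L by blast
  have "is_basis K1.F.\<O> (\<sigma> ` K1.K.\<O>) K1.deg (\<lambda>i. \<sigma> (b i))"
    using K1.F.int_ring_L K1.K.int_ring_L by (intro hom_basis[OF b(1)]) auto
  then have "is_basis (int_ring F) (int_ring L) (ext_degree F L) (\<lambda>i. \<sigma> (b i))"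
    using deg_eq unfolding image_O K1.F.\<O>_def K2.K.\<O>_def K2.deg_def by simp
  moreover have "D = Determinant.det (mat (ext_degree F L) (ext_degree F L) (\<lambda>(i, j). field_trace F L (\<sigma> (b i) * \<sigma> (b j))))"
    unfolding b(2) K2.deg_def[symmetric] deg_eq
    using bK by (intro arg_cong[where f = Determinant.det] cong_mat) (auto simp: hom_field_trace K1.K.mult_L simp flip: hom_mult)
  ultimately show ?thesis
    unfolding disc_values_def by (intro exI[of _ "\<lambda>i. \<sigma> (b i)"]) auto
qed

lemma inverse_iso: "alg_iso F L K (inv_into K \<sigma>)"
proof -
  let ?t = "inv_into K \<sigma>"
  have inj: "inj_on \<sigma> K"
    using bij by (simp add: bij_betw_def)
  have t: "?t y \<in> K" "\<sigma> (?t y) = y" if "y \<in> L" for y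
    using that image_K by (auto intro: inv_into_into f_inv_into_f)
  have ti: "?t y = z" if "z \<in> K" "\<sigma> z = y" for y z
    using that inj by (metis inv_into_f_f)
  show ?thesis
    unfolding alg_iso_def
  proof (intro conjI ballI)
    show "bij_betw ?t L K"
      by (rule bij_betw_inv_into[OF bij])
    show "?t a = a" if "a \<in> F" for a
      using that by (intro ti K1.F_K fix_F)
    show "?t (y + z) = ?t y + ?t z" "?t (y * z) = ?t y * ?t z" if "y \<in> L" "z \<in> L" for y z
      using t[OF that(1)] t[OF that(2)] by (auto intro!: ti simp: hom_add hom_mult K1.K.add_L K1.K.mult_L)
  qed
qed

end

lemma (in ext_iso) discriminant_eq: "discriminant F L = discriminant F K"
proof -
  interpret inv: ext_iso F L K "inv_into K \<sigma>"
    by unfold_locales (rule inverse_iso)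
  have "disc_values L D \<longleftrightarrow> disc_values K D" for D
    using disc_values_hom[of D] inv.disc_values_hom[of D] unfolding inv.disc_values_def disc_values_def by blast
  then have "disc_values L = disc_values K"
    by blast
  then show ?thesis
    by (simp add: discriminant_def disc_values_def[abs_def] fun_eq_iff)
qed

context ext_iso
begin

lemma adjoin_hom:
  assumes "y \<in> K" "R \<subseteq> F" shows "adjoin R (\<sigma> y) = \<sigma> ` adjoin R y"
proof -
  have "poly P (\<sigma> y) = \<sigma> (poly P y)" if "range (coeff P) \<subseteq> R" for P
    using that assms unfolding poly_altdef by (subst hom_lincomb) (auto simp: hom_power K1.K.power_L)
  then show ?thesis
    unfolding adjoin_def by (auto simp: image_def) metis+
qed

text \<open>The classes are translates of the subgroup, and \<open>\<sigma>\<close> maps translates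
  to translates injectively.\<close>

lemma quot_card_image:
  assumes B: "add_subgroup B" "B \<subseteq> A" and A: "add_subgroup A" "A \<subseteq> K"
  shows "quot_card (\<sigma> ` A) (\<sigma> ` B) = quot_card A B"
proof -
  have sub: "add_subgroup (\<sigma> ` C)" if "add_subgroup C" "C \<subseteq> K" for C
    unfolding add_subgroup_def
  proof (intro conjI ballI)
    show "0 \<in> \<sigma> ` C"
      using add_subgroupD(1)[OF that(1)] hom_0 by (metis imageI)
    fix u v assume "u \<in> \<sigma> ` C" "v \<in> \<sigma> ` C"
    then obtain a b where "a \<in> C" "b \<in> C" "u = \<sigma> a" "v = \<sigma> b"
      by blast
    then show "u - v \<in> \<sigma> ` C"
      using hom_diff[of a b] add_subgroupD(2)[OF that(1), of a b] that(2) by (metis imageI subsetD)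
  qed
  have quot: "A // {(u, v). u \<in> A \<and> v \<in> A \<and> u - v \<in> B} = (\<lambda>a. (+) a ` B) ` A"
    if "add_subgroup B" "B \<subseteq> A" "add_subgroup A" for A B :: "'a set"
    using quot_class_eq[OF that] by (auto simp: quotient_def image_def)
  have BK: "B \<subseteq> K"
    using A B by blast
  have im: "(\<lambda>a. (+) a ` \<sigma> ` B) ` \<sigma> ` A = (`) \<sigma> ` (\<lambda>a. (+) a ` B) ` A"
  proof -
    have "(+) (\<sigma> a) ` \<sigma> ` B = \<sigma> ` (+) a ` B" if "a \<in> A" for a
      unfolding image_image using that A(2) BK by (intro image_cong refl) (auto simp: hom_add subset_iff)
    then show ?thesis
      unfolding image_image[of "\<lambda>a. (+) a ` \<sigma> ` B" \<sigma> A] image_image[of "(`) \<sigma>" "\<lambda>a. (+) a ` B" A]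
      by (rule image_cong[OF refl])
  qed
  have "inj_on ((`) \<sigma>) ((\<lambda>a. (+) a ` B) ` A)"
  proof (rule inj_on_subset[OF inj_on_image])
    show "inj_on \<sigma> (\<Union> (Pow K))"
      using bij by (simp add: bij_betw_def)
    show "(\<lambda>a. (+) a ` B) ` A \<subseteq> Pow K"
      using A(2) BK by (auto intro!: K1.K.add_L)
  qed
  then show ?thesis
    unfolding quot_card_def quot[OF sub[OF B(1) BK] image_mono[OF B(2)] sub[OF A]] quot[OF B A(1)] im
    by (rule card_image)
qed

text \<open>Every ingredient is transported: generation, index and discriminant by the lemmas above,
  and the integrand pointwise, because a polynomial over \<open>F\<close> commutes with
  \<open>\<sigma>\<close> and \<open>\<sigma>\<close> preserves \<open>pnorm\<close>.\<close>

lemma rho_int_hom: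
  assumes y: "y \<in> K1.K.\<O>"
  shows "rho_int F L n (\<sigma> y) = rho_int F K n y"
proof -
  have yK: "y \<in> K"
    using y by (rule K1.K.int_ring_L)
  have "adjoin F y \<subseteq> K"
    using K1.adjoin_F[OF yK] K1.K.poly_values_L[of F y] yK K1.F_K by auto
  then have gen: "adjoin F (\<sigma> y) = L \<longleftrightarrow> adjoin F y = K"
    unfolding adjoin_hom[OF yK order_refl] image_K[symmetric]
    using bij by (metis bij_betw_def inj_on_image_eq_iff order_refl)
  have lat: "adjoin (int_ring F) y = K1.lat y"
    using K1.adjoin_int[OF y] by (simp add: K1.lat_def K1.F.\<O>_def)
  have sub: "K1.lat y \<subseteq> K1.K.\<O>"
    using y by (auto simp: K1.lat_def poly_values_def polys_over_iff poly_altdef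
        intro!: K1.K.sum_int K1.K.mult_int K1.K.power_int intro: K1.FO_KO)
  have "quot_card (\<sigma> ` K1.K.\<O>) (\<sigma> ` K1.lat y) = quot_card K1.K.\<O> (K1.lat y)"
    using sub K1.K.int_ring_L K1.add_subgroup_PV
    by (intro quot_card_image K1.K.add_subgroup_O) (auto simp: K1.lat_def)
  moreover have "adjoin (int_ring F) (\<sigma> y) = \<sigma> ` K1.lat y"
    using adjoin_hom[OF yK, of "int_ring F"] lat by (auto simp: int_ring_def)
  ultimately have index: "quot_card (int_ring L) (adjoin (int_ring F) (\<sigma> y)) = quot_card (int_ring K) (adjoin (int_ring F) y)"
    unfolding image_O lat by (simp add: K1.K.\<O>_def K2.K.\<O>_def)
  have int: "(\<integral>c. pnorm (poly (poly_of m c) (\<sigma> y)) ^ r \<partial>Omega F m) = (\<integral>c. pnorm (poly (poly_of m c) y) ^ r \<partial>Omega F m)" for m r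
  proof (rule Bochner_Integration.integral_cong[OF refl])
    fix c assume "c \<in> space (Omega F m)"
    then have c: "c i \<in> F" if "i \<le> m" for i
      using that K1.F.int_ring_L by (auto simp: K1.F.space_Omega)
    then have "poly (poly_of m c) (\<sigma> y) = \<sigma> (poly (poly_of m c) y)"
      unfolding poly_poly_of using yK by (subst hom_lincomb) (auto simp: hom_power K1.K.power_L)
    moreover have "poly (poly_of m c) y \<in> K"
      unfolding poly_poly_of using c yK by (auto intro!: K1.K.sum_L K1.K.mult_L K1.K.power_L intro: K1.F_K)
    ultimately show "pnorm (poly (poly_of m c) (\<sigma> y)) ^ r = pnorm (poly (poly_of m c) y) ^ r"
      by (simp add: hom_pnorm)
  qed
  show ?thesis
    unfolding rho_int_def Let_def gen index int discriminant_eq deg_eq[unfolded K1.deg_def K2.deg_def] ..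
qed

lemma rho_hom:
  assumes x: "x \<in> K" shows "rho F L n (\<sigma> x) = rho F K n x"
proof -
  have iff: "\<sigma> x \<in> int_ring L \<longleftrightarrow> x \<in> int_ring K"
    using hom_pnorm[OF x] hom_L[OF x] x by (simp add: int_ring_def)
  show ?thesis
  proof (cases "x \<in> int_ring K")
    case True
    then show ?thesis
      using iff rho_int_hom[of x n] by (simp add: rho_def K1.K.\<O>_def)
  next
    case False
    note out = K1.outside_int[OF x False]
    show ?thesis
      using False iff rho_int_hom[OF out(2), of n] hom_pnorm[OF x] deg_eq
      by (simp add: rho_def hom_inverse[OF x] flip: K1.deg_def K2.deg_def)
  qed
qed

end

section \<open>Matrices in \<open>GL\<close> and the final statement\<close>

lemma (in normalized_ext) moebius_data_GL:
  assumes GL: "mat_of_rows_list 2 [[a, b], [c, d]] \<in> GL 2 (int_ring F)" and x: "x \<in> K" "c * x + d \<noteq> 0"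
  shows "moebius_data a b c d x"
proof -
  let ?A = "mat_of_rows_list 2 [[a, b], [c, d]]"
  have A: "?A \<in> carrier_mat 2 2" "elements_mat ?A \<subseteq> F.\<O>"
    using GL by (auto simp: GL_def F.\<O>_def)
  have entry: "?A $$ (0, 0) = a" "?A $$ (0, 1) = b" "?A $$ (1, 0) = c" "?A $$ (1, 1) = d"
    by (simp_all add: mat_of_rows_list_def)
  have el: "M $$ (i, j) \<in> F.\<O>" if "M \<in> carrier_mat 2 2" "elements_mat M \<subseteq> F.\<O>" "i < 2" "j < 2" for M i j
  proof -
    have "M $$ (i, j) \<in> elements_mat M"
      by (rule elements_matI[OF that(1,3,4) refl])
    then show ?thesis
      using that(2) by blast
  qed
  obtain B where B: "B \<in> carrier_mat 2 2" "elements_mat B \<subseteq> F.\<O>" "?A * B = 1\<^sub>m 2" "B * ?A = 1\<^sub>m 2"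
    using GL by (auto simp: GL_def F.\<O>_def)
  have prod: "(M * N) $$ (i, j) = M $$ (i, 0) * N $$ (0, j) + M $$ (i, 1) * N $$ (1, j)"
    if "M \<in> carrier_mat 2 2" "N \<in> carrier_mat 2 2" "i < 2" "j < 2" for M N :: "'a mat" and i j
    using that by (simp add: scalar_prod_def numeral_2_eq_2)
  have AB: "?A $$ (i, 0) * B $$ (0, j) + ?A $$ (i, 1) * B $$ (1, j) = (if i = j then 1 else 0)"
    and BA: "B $$ (i, 0) * ?A $$ (0, j) + B $$ (i, 1) * ?A $$ (1, j) = (if i = j then 1 else 0)"
    if "i < 2" "j < 2" for i j
    using prod[OF A(1) B(1) that] prod[OF B(1) A(1) that] that unfolding B(3,4) by simp_all
  have "{a, b, c, d} \<subseteq> F.\<O>"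
    using el[OF A, of 0 0] el[OF A, of 0 1] el[OF A, of 1 0] el[OF A, of 1 1] unfolding entry by simp
  moreover have "{B $$ (0, 0), B $$ (0, 1), B $$ (1, 0), B $$ (1, 1)} \<subseteq> F.\<O>"
    using el[OF B(1,2)] by simp
  ultimately show ?thesis
    unfolding moebius_data_def
    using x AB[of 0 0] AB[of 0 1] AB[of 1 0] AB[of 1 1] BA[of 0 0] BA[of 0 1] BA[of 1 0] BA[of 1 1]
    unfolding entry
    by (intro conjI exI[of _ "B $$ (0, 0)"] exI[of _ "B $$ (0, 1)"] exI[of _ "B $$ (1, 0)"] exI[of _ "B $$ (1, 1)"])
      simp_all
qed

theorem theoremB:
  fixes p n r q :: nat
    and F K :: "'a::{alg_closed_field, field_char_0, metric_space} set"
    and x :: 'a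
  assumes "padic_setting p F"
    and "finite_extension F K"
    and "x \<in> K"
    and "n > 0"
    and "r = ext_degree F K"
    and "q = residue_card F"
  shows
    "(adjoin F x \<noteq> K \<or> n < r \<longrightarrow> rho F K n x = 0) \<and>
     continuous_on K (rho F K n) \<and>
     (\<forall>L \<sigma>. finite_extension F L \<longrightarrow> alg_iso F K L \<sigma> \<longrightarrow> rho F K n x = rho F L n (\<sigma> x)) \<and>
     (\<forall>a b c d. mat_of_rows_list 2 [[a, b], [c, d]] \<in> GL 2 (int_ring F) \<longrightarrow> c * x + d \<noteq> 0 \<longrightarrow>
        rho F K n ((a * x + b) / (c * x + d)) = pnorm (c * x + d) ^ (2 * r) * rho F K n x) \<and>
     (rho F K n x \<le> rho F K (n + 1) x \<and>
        (rho F K n x < rho F K (n + 1) x \<longleftrightarrow> adjoin F x = K \<and> r \<le> n + 1 \<and> n < 2 * r - 1)) \<and>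
     (adjoin F x = K \<and> x \<in> int_ring K \<longrightarrow>
        rho F K r x =
          pnorm (discriminant F K) * (1 / real (quot_card (int_ring K) (adjoin (int_ring F) x))) *
          ((real q ^ (r + 1) - real q ^ r) / (real q ^ (r + 1) - 1)) \<and>
        (\<forall>m \<ge> 2 * r - 1.
           rho F K m x =
             pnorm (discriminant F K) * (LINT t:adjoin (int_ring F) x|haar K. pnorm t ^ r)))"
proof -
  interpret padic_setting p F by fact
  interpret normalized_ext F K
    by (rule normalized_extI) fact
  have r: "r = deg"
    using \<open>r = ext_degree F K\<close> by (simp add: deg_def)
  have q: "q = QF.K.resq"
    using \<open>q = residue_card F\<close> by (simp add: QF.K.residue_card_eq)
  note x = \<open>x \<in> K\<close>
  have iso: "rho F K n x = rho F L n (\<sigma> x)" if "finite_extension F L" "alg_iso F K L \<sigma>" for L \<sigma>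
  proof -
    interpret ext: normalized_ext F L
      by (rule normalized_extI) fact
    interpret ext_iso F K L \<sigma>
      by unfold_locales fact
    show ?thesis
      by (rule rho_hom[OF x, symmetric])
  qed
  have moebius: "rho F K n ((a * x + b) / (c * x + d)) = pnorm (c * x + d) ^ (2 * r) * rho F K n x"
    if GL: "mat_of_rows_list 2 [[a, b], [c, d]] \<in> GL 2 (int_ring F)" and nz: "c * x + d \<noteq> 0" for a b c d
    unfolding r by (rule rho_moebius[OF moebius_data_GL[OF GL x nz]])
  have integral: "rho F K r x = pnorm (discriminant F K) *
      (1 / real (quot_card (int_ring K) (adjoin (int_ring F) x))) *
      ((real q ^ (r + 1) - real q ^ r) / (real q ^ (r + 1) - 1)) \<and>
    (\<forall>m \<ge> 2 * r - 1. rho F K m x =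
      pnorm (discriminant F K) * (LINT t:adjoin (int_ring F) x|haar K. pnorm t ^ r))"
    if "adjoin F x = K \<and> x \<in> int_ring K"
    using rho_deg[of x] rho_stable[of x] that unfolding r q by blast
  show ?thesis
    by (intro conjI impI allI rho_eq_0[OF x] continuous_rho iso moebius rho_mono[OF x, folded r] integral)
      (simp_all add: r)
qed

end
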